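(* Let $p\in\,]1,\infty[$, $\alpha>-1$, $X=H^p$ or $X=A^p_\alpha$, and let $g_t\in\mathcal{A}$ for $t\in\,]0,1[$. If $\{M_{g_t}:t\in\,]0,1[\}$ satisfies $W(X)$, then the inequality \[ \mathrm{EN}\Big(\int_0^1 M_{g_t}\,dt\Big)\le\int_0^1\mathrm{EN}(M_{g_t})\,dt \] is an equality if and only if there exist $\xi,\theta\in\partial\mathbb{D}$ such that $\theta g_t(\xi)=\|g_t\|_\infty$ for almost every $t\in\,]0,1[$.
   Context: $\mathbb{D}$ is the open unit disk, $m$ normalized arc length on $\partial\mathbb{D}$, $A$ normalized area measure on $\mathbb{D}$. $H^p$ is the Hardy space of analytic $f$ on $\mathbb{D}$ with $\|f\|_{H^p}=\lim_{r\to1}(\int_{\partial\mathbb{D}}|f(rz)|^p\,dm(z))^{1/p}<\infty$; $A^p_\alpha$ is the weighted Bergman space of analytic $f$ on $\mathbb{D}$ with $\|f\|_{A^p_\alpha}=(\int_{\mathbb{D}}|f(z)|^p(\alpha+1)(1-|z|^2)^\alpha\,dA(z))^{1/p}<\infty$. $H^\infty$ is the space of bounded analytic functions on $\mathbb{D}$ with $\|g\|_\infty=\sup_{z\in\mathbb{D}}|g(z)|$; $\mathcal{A}$ is the disk algebra, the functions in $H^\infty$ that extend continuously to $\overline{\mathbb{D}}$ (so $g_t(\xi)$ for $\xi\in\partial\mathbb{D}$ is the value of the extension). $M_gf=gf$. A family $\{S_t:t\in\,]0,1[\}$ of bounded operators on $X$ satisfies $W(X)$ if for every $f\in X$, $t\mapsto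 S_tf$ is norm continuous on $]0,1[$ and $\int_0^1\|S_tf\|_X\,dt<\infty$; then $\int_0^1S_t\,dt$ is the operator $f\mapsto\int_0^1S_tf\,dt$. For a bounded operator $S$ on $X$, $\mathrm{EN}(S)=\sup_{(f_n)}\limsup_n\|Sf_n\|_X$, the supremum over all sequences $(f_n)\subset X$ with $\|f_n\|_X=1$ converging weakly to $0$. *)

theory Defs
  imports "HOL-Analysis.Analysis"
begin

text \<open>Elements of the spaces are functions complex => complex that are analytic on the
  open unit disk and vanish outside it (so that an element is determined by its values
  on the disk).\<close>

definition disk :: "complex set" where "disk = ball 0 1"

definition extensional_disk :: "(complex \<Rightarrow> complex) \<Rightarrow> bool" where
  "extensional_disk f \<longleftrightarrow> (\<forall>z. z \<notin> disk \<longrightarrow> f z = 0)"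

definition hp_mean :: "real \<Rightarrow> (complex \<Rightarrow> complex) \<Rightarrow> real \<Rightarrow> real" where
  "hp_mean p f r =
     ((LINT \<theta>:{0..2*pi}|lborel. cmod (f (complex_of_real r * cis \<theta>)) powr p) / (2*pi)) powr (1/p)"

definition Hardy_space :: "real \<Rightarrow> (complex \<Rightarrow> complex) set" where
  "Hardy_space p = {f. f holomorphic_on disk \<and> extensional_disk f \<and>
                        (\<exists>L. (hp_mean p f \<longlongrightarrow> L) (at_left 1))}"

definition Hardy_norm :: "real \<Rightarrow> (complex \<Rightarrow> complex) \<Rightarrow> real" where
  "Hardy_norm p f = Lim (at_left 1) (hp_mean p f)"

text \<open>Weight (alpha+1)(1-|z|^2)^alpha times the density 1/pi of normalized area measure.\<close>
definition bergman_weight :: "real \<Rightarrow> complex \<Rightarrow> real" where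
  "bergman_weight \<alpha> z = (\<alpha> + 1) * (1 - (cmod z)\<^sup>2) powr \<alpha> / pi"

definition Bergman_space :: "real \<Rightarrow> real \<Rightarrow> (complex \<Rightarrow> complex) set" where
  "Bergman_space p \<alpha> = {f. f holomorphic_on disk \<and> extensional_disk f \<and>
      set_integrable lborel disk (\<lambda>z. cmod (f z) powr p * bergman_weight \<alpha> z)}"

definition Bergman_norm :: "real \<Rightarrow> real \<Rightarrow> (complex \<Rightarrow> complex) \<Rightarrow> real" where
  "Bergman_norm p \<alpha> f =
     (LINT z:disk|lborel. cmod (f z) powr p * bergman_weight \<alpha> z) powr (1/p)"

definition disk_algebra :: "(complex \<Rightarrow> complex) \<Rightarrow> bool" where
  "disk_algebra g \<longleftrightarrow> continuous_on (cball 0 1) g \<and> g holomorphic_on disk"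

definition sup_norm :: "(complex \<Rightarrow> complex) \<Rightarrow> real" where
  "sup_norm g = (SUP z\<in>disk. cmod (g z))"

definition mult_op :: "(complex \<Rightarrow> complex) \<Rightarrow> (complex \<Rightarrow> complex) \<Rightarrow> (complex \<Rightarrow> complex)" where
  "mult_op g f = (\<lambda>z. if z \<in> disk then g z * f z else 0)"

definition bounded_functional ::
  "(complex \<Rightarrow> complex) set \<Rightarrow> ((complex \<Rightarrow> complex) \<Rightarrow> real) \<Rightarrow>
   ((complex \<Rightarrow> complex) \<Rightarrow> complex) \<Rightarrow> bool" where
  "bounded_functional X N \<phi> \<longleftrightarrow>
     (\<forall>f\<in>X. \<forall>h\<in>X. \<forall>a b. \<phi> (\<lambda>z. a * f z + b * h z) = a * \<phi> f + b * \<phi> h) \<and>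
     (\<exists>C. \<forall>f\<in>X. cmod (\<phi> f) \<le> C * N f)"

definition bounded_op ::
  "(complex \<Rightarrow> complex) set \<Rightarrow> ((complex \<Rightarrow> complex) \<Rightarrow> real) \<Rightarrow>
   ((complex \<Rightarrow> complex) \<Rightarrow> (complex \<Rightarrow> complex)) \<Rightarrow> bool" where
  "bounded_op X N S \<longleftrightarrow>
     (\<forall>f\<in>X. S f \<in> X) \<and>
     (\<forall>f\<in>X. \<forall>h\<in>X. \<forall>a b. S (\<lambda>z. a * f z + b * h z) = (\<lambda>z. a * S f z + b * S h z)) \<and>
     (\<exists>C. \<forall>f\<in>X. N (S f) \<le> C * N f)"

definition weakly_null ::
  "(complex \<Rightarrow> complex) set \<Rightarrow> ((complex \<Rightarrow> complex) \<Rightarrow> real) \<Rightarrow>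
   (nat \<Rightarrow> complex \<Rightarrow> complex) \<Rightarrow> bool" where
  "weakly_null X N fs \<longleftrightarrow>
     (\<forall>\<phi>. bounded_functional X N \<phi> \<longrightarrow> (\<lambda>n. \<phi> (fs n)) \<longlonglongrightarrow> 0)"

definition EN ::
  "(complex \<Rightarrow> complex) set \<Rightarrow> ((complex \<Rightarrow> complex) \<Rightarrow> real) \<Rightarrow>
   ((complex \<Rightarrow> complex) \<Rightarrow> (complex \<Rightarrow> complex)) \<Rightarrow> ennreal" where
  "EN X N S = (SUP fs \<in> {fs. (\<forall>n. fs n \<in> X \<and> N (fs n) = 1) \<and> weakly_null X N fs}.
                 limsup (\<lambda>n. ennreal (N (S (fs n)))))"

definition cond_W ::
  "(complex \<Rightarrow> complex) set \<Rightarrow> ((complex \<Rightarrow> complex) \<Rightarrow> real) \<Rightarrow>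
   (real \<Rightarrow> (complex \<Rightarrow> complex) \<Rightarrow> (complex \<Rightarrow> complex)) \<Rightarrow> bool" where
  "cond_W X N S \<longleftrightarrow>
     (\<forall>t\<in>{0<..<1}. bounded_op X N (S t)) \<and>
     (\<forall>f\<in>X. (\<forall>t0\<in>{0<..<1}. ((\<lambda>t. N (\<lambda>z. S t f z - S t0 f z)) \<longlongrightarrow> 0) (at t0)) \<and>
            set_integrable lborel {0<..<1::real} (\<lambda>t. N (S t f)))"

text \<open>The X-valued integral f |-> int_0^1 S_t f dt. Under W(X) the Bochner integral exists;
  it is characterised as the unique element h of X with phi(h) = int_0^1 phi(S_t f) dt for
  every bounded linear functional phi.\<close>
definition integral_op ::
  "(complex \<Rightarrow> complex) set \<Rightarrow> ((complex \<Rightarrow> complex) \<Rightarrow> real) \<Rightarrow>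
   (real \<Rightarrow> (complex \<Rightarrow> complex) \<Rightarrow> (complex \<Rightarrow> complex)) \<Rightarrow>
   (complex \<Rightarrow> complex) \<Rightarrow> (complex \<Rightarrow> complex)" where
  "integral_op X N S f = (THE h. h \<in> X \<and>
      (\<forall>\<phi>. bounded_functional X N \<phi> \<longrightarrow>
             \<phi> h = (LINT t:{0<..<1::real}|lborel. \<phi> (S t f))))"

end

theory Submission
  imports Defs "HOL-Complex_Analysis.Complex_Analysis"
begin

text \<open>Both spaces embed isometrically, on the disk algebra, into \<open>L\<^sup>p(\<mu>)\<close> for a finite measure \<open>\<mu>\<close>
  on the closed disk without atoms on the circle: arc length, respectively weighted area. For
  \<open>\<bar>\<xi>\<bar> = 1\<close> the normalised powers of \<open>(1 + cnj \<xi> z) / 2\<close> concentrate at \<open>\<xi>\<close>. They are therefore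
  almost disjoint in \<open>L\<^sup>p\<close>, hence weakly null because \<open>p > 1\<close>, and multiplication by \<open>g\<close> acts on them
  asymptotically as multiplication by \<open>g \<xi>\<close>. This gives \<open>EN (M\<^sub>g) = \<parallel>g\<parallel>\<^sub>\<infinity>\<close> for \<open>g\<close> in the disk algebra.

  The operator \<open>\<integral> M\<^sub>g\<^sub>t dt\<close> is multiplication by \<open>G = \<integral> g\<^sub>t dt\<close>. If \<open>\<integral> \<parallel>g\<^sub>t\<parallel> dt\<close> is finite, then \<open>G\<close> is
  in the disk algebra, and \<open>\<bar>G \<xi>\<bar> = \<integral> \<parallel>g\<^sub>t\<parallel> dt\<close> for some \<open>\<xi>\<close> on the circle means exactly that the
  values \<open>g\<^sub>t \<xi>\<close> have a common argument and maximal modulus. If it is infinite, the uniform boundedness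
  principle still bounds \<open>\<integral> \<bar>g\<^sub>t z\<bar> dt\<close> uniformly in \<open>z\<close>, so that both sides of the equivalence fail.\<close>

subsection \<open>Hoelder and Minkowski inequalities\<close>

text \<open>The spaces are plain sets of functions, so limits, integrals and series of elements are
  formed pointwise and brought back into the space by one closure property: lower semicontinuity of
  the norm under pointwise convergence, which both spaces owe to Fatou's lemma. The price is that a
  bounded functional need not respect pointwise limits, so moving one through a limit always
  requires an estimate of the error in norm. Condition W controls \<open>t \<mapsto> g t z\<close>
  only at points z of the open disk and only the norm of one product \<open>g t * f\<close> at a
  time. Measurability of boundary values and of sup norms in t must therefore be derived, and
  integrability of the sup norm is not given; this is what forces the separate infinite case. The
  uniform boundedness argument there is stated for point evaluations with weights, so that dividing
  by the norm of the evaluation yields a bound on the integral of \<open>cmod (g t z)\<close>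
  itself. The condition p > 1 decides weak nullity: a sum of m almost disjoint unit vectors has norm
  of order at most \<open>m powr (1/p)\<close>, which is o(m).\<close>

lemma powr_add_weighted_le:
  fixes a b p s :: real
  assumes "p \<ge> 1" "a \<ge> 0" "b \<ge> 0" "0 < s" "s < 1"
  shows "(a + b) powr p \<le> s powr (1 - p) * a powr p + (1 - s) powr (1 - p) * b powr p"
proof -
  have conv: "(s * x + (1 - s) * y) powr p \<le> s * x powr p + (1 - s) * y powr p"
    if xy: "x \<ge> 0" "y \<ge> 0" for x y
  proof -
    \<comment> \<open>On the boundary of the quadrant the convexity inequality reduces to this bound
      for the remaining weight.\<close>
    have le: "u powr p \<le> u" if "0 < u" "u < 1" for u :: real
      using powr_mono'[of 1 p u] that assms by simp
    consider "x = 0" | "y = 0" | "x > 0" "y > 0" using xy by linarith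
    then show ?thesis
    proof cases
      case 1
      then show ?thesis using assms xy le[of "1 - s"]
        by (simp add: powr_mult mult_right_mono)
    next
      case 2
      then show ?thesis using assms xy le[of s]
        by (simp add: powr_mult mult_right_mono)
    next
      case 3
      then show ?thesis
        using convex_onD[OF powr_convex[OF assms(1)], of "1 - s" x y] assms by simp
    qed
  qed
  \<comment> \<open>Convexity is used at a/s and b/(1 - s). The weight s stays free: an optimal s
    yields Minkowski's inequality, and s = 1/2 yields the constant
    \<open>2 powr (p - 1)\<close>.\<close>
  have "(a + b) powr p = (s * (a / s) + (1 - s) * (b / (1 - s))) powr p"
    using assms by simp
  also have "\<dots> \<le> s * (a / s) powr p + (1 - s) * (b / (1 - s)) powr p"
    using assms by (intro conv) auto
  also have "\<dots> = s powr (1 - p) * a powr p + (1 - s) powr (1 - p) * b powr p"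
    using assms by (simp add: powr_divide powr_diff)
  finally show ?thesis .
qed

lemma Lp_add_integrable:
  fixes f h :: "'a \<Rightarrow> complex" and p :: real
  assumes "p \<ge> 1" and [measurable]: "f \<in> borel_measurable M" "h \<in> borel_measurable M"
    and "integrable M (\<lambda>x. cmod (f x) powr p)" "integrable M (\<lambda>x. cmod (h x) powr p)"
  shows "integrable M (\<lambda>x. cmod (f x + h x) powr p)"
proof (rule Bochner_Integration.integrable_bound)
  show "integrable M (\<lambda>x. (1/2) powr (1 - p) * cmod (f x) powr p + (1/2) powr (1 - p) * cmod (h x) powr p)"
    using assms by simp
  have "cmod (f x + h x) powr p \<le> (cmod (f x) + cmod (h x)) powr p" for x
    using assms by (intro powr_mono2 norm_triangle_ineq) auto
  also have "(cmod (f x) + cmod (h x)) powr p \<le>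
      (1/2) powr (1 - p) * cmod (f x) powr p + (1/2) powr (1 - p) * cmod (h x) powr p" for x
    using powr_add_weighted_le[of p "cmod (f x)" "cmod (h x)" "1/2"] assms by simp
  finally show "AE x in M. norm (cmod (f x + h x) powr p)
      \<le> norm ((1/2) powr (1 - p) * cmod (f x) powr p + (1/2) powr (1 - p) * cmod (h x) powr p)"
    by fastforce
qed simp

lemma Minkowski_inequality:
  fixes f h :: "'a \<Rightarrow> complex" and p :: real
  assumes p: "p \<ge> 1" and [measurable]: "f \<in> borel_measurable M" "h \<in> borel_measurable M"
    and int: "integrable M (\<lambda>x. cmod (f x) powr p)" "integrable M (\<lambda>x. cmod (h x) powr p)"
  shows "(\<integral>x. cmod (f x + h x) powr p \<partial>M) powr (1/p) \<le>
    (\<integral>x. cmod (f x) powr p \<partial>M) powr (1/p) + (\<integral>x. cmod (h x) powr p \<partial>M) powr (1/p)"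
proof (rule field_le_epsilon)
  fix e :: real assume "e > 0"
  \<comment> \<open>The summand e/2 keeps A and B positive when a norm vanishes, so that the weight
    s below lies strictly between 0 and 1.\<close>
  define A where "A = (\<integral>x. cmod (f x) powr p \<partial>M) powr (1/p) + e/2"
  define B where "B = (\<integral>x. cmod (h x) powr p \<partial>M) powr (1/p) + e/2"
  have pos: "A > 0" "B > 0" using \<open>e > 0\<close> by (auto simp: A_def B_def add_nonneg_pos)
  have bnd: "I \<le> (I powr (1/p) + e/2) powr p" if "I \<ge> 0" for I
  proof -
    have "I = (I powr (1/p)) powr p" using that p by (simp add: powr_powr)
    also have "\<dots> \<le> (I powr (1/p) + e/2) powr p" using \<open>e > 0\<close> p by (intro powr_mono2) auto
    finally show ?thesis .
  qed
  have bA: "(\<integral>x. cmod (f x) powr p \<partial>M) \<le> A powr p" and bB: "(\<integral>x. cmod (h x) powr p \<partial>M) \<le> B powr p"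
    unfolding A_def B_def by (auto intro!: bnd)
  \<comment> \<open>With this weight both terms become multiples of the same power
    \<open>(A + B) powr (p - 1)\<close>, with factors A and B, and add up to
    \<open>(A + B) powr p\<close>.\<close>
  define s where "s = A / (A + B)"
  have s: "0 < s" "s < 1" "1 - s = B / (A + B)" using pos by (auto simp: s_def field_simps)
  have "(\<integral>x. cmod (f x + h x) powr p \<partial>M) \<le>
      (\<integral>x. s powr (1 - p) * cmod (f x) powr p + (1 - s) powr (1 - p) * cmod (h x) powr p \<partial>M)"
  proof (rule integral_mono[OF Lp_add_integrable[OF assms]])
    fix x
    have "cmod (f x + h x) powr p \<le> (cmod (f x) + cmod (h x)) powr p"
      using p by (intro powr_mono2 norm_triangle_ineq) auto
    also have "\<dots> \<le> s powr (1 - p) * cmod (f x) powr p + (1 - s) powr (1 - p) * cmod (h x) powr p"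
      using s p by (intro powr_add_weighted_le) auto
    finally show "cmod (f x + h x) powr p \<le> s powr (1 - p) * cmod (f x) powr p + (1 - s) powr (1 - p) * cmod (h x) powr p" .
  qed (use int in simp)
  also have "\<dots> = s powr (1 - p) * (\<integral>x. cmod (f x) powr p \<partial>M) + (1 - s) powr (1 - p) * (\<integral>x. cmod (h x) powr p \<partial>M)"
    using int by simp
  also have "\<dots> \<le> s powr (1 - p) * A powr p + (1 - s) powr (1 - p) * B powr p"
    using bA bB by (intro add_mono mult_left_mono) auto
  also have "\<dots> = (A + B) powr p"
  proof -
    have "s powr (1 - p) * A powr p = (A + B) powr (p - 1) * A"
      using pos by (simp add: s_def powr_divide powr_diff)
    moreover have "(1 - s) powr (1 - p) * B powr p = (A + B) powr (p - 1) * B"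
      using pos unfolding s(3) by (simp add: powr_divide powr_diff)
    moreover have "(A + B) powr p = (A + B) powr (p - 1) * (A + B)"
      using pos by (simp add: powr_diff)
    ultimately show ?thesis by (simp add: ring_distribs)
  qed
  finally have "(\<integral>x. cmod (f x + h x) powr p \<partial>M) powr (1/p) \<le> ((A + B) powr p) powr (1/p)"
    using p by (intro powr_mono2) auto
  also have "\<dots> = A + B" using p pos by (simp add: powr_powr)
  finally show "(\<integral>x. cmod (f x + h x) powr p \<partial>M) powr (1/p) \<le>
    (\<integral>x. cmod (f x) powr p \<partial>M) powr (1/p) + (\<integral>x. cmod (h x) powr p \<partial>M) powr (1/p) + e"
    by (simp add: A_def B_def)
qed

lemma Holder_inequality:
  fixes u v :: "'a \<Rightarrow> real" and p q :: real
  assumes pq: "p > 1" "q > 1" "1/p + 1/q = 1"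
    and [measurable]: "u \<in> borel_measurable M" "v \<in> borel_measurable M"
    and nonneg: "\<And>x. u x \<ge> 0" "\<And>x. v x \<ge> 0"
    and int: "integrable M (\<lambda>x. u x powr p)" "integrable M (\<lambda>x. v x powr q)"
  shows "(\<integral>x. u x * v x \<partial>M) \<le> (\<integral>x. u x powr p \<partial>M) powr (1/p) * (\<integral>x. v x powr q \<partial>M) powr (1/q)"
proof -
  define A where "A = (\<integral>x. u x powr p \<partial>M) powr (1/p)"
  define B where "B = (\<integral>x. v x powr q \<partial>M) powr (1/q)"
  have "A \<ge> 0" "B \<ge> 0" by (auto simp: A_def B_def)
  have AB: "(\<integral>x. u x powr p \<partial>M) = A powr p" "(\<integral>x. v x powr q \<partial>M) = B powr q"
    using pq by (simp_all add: A_def B_def powr_powr)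
  have int_uv: "integrable M (\<lambda>x. u x * v x)"
    by (rule Bochner_Integration.integrable_bound[of _ "\<lambda>x. u x powr p / p + v x powr q / q"])
      (use int nonneg pq Youngs_inequality[OF pq] in \<open>auto simp: abs_mult intro!: AE_I2\<close>)
  \<comment> \<open>Young's inequality is applied to u and v divided by their norms; adding e avoids
    division by zero and is removed by a limit at the end.\<close>
  have *: "(\<integral>x. u x * v x \<partial>M) \<le> (A + e) * (B + e)" if "e > 0" for e
  proof -
    have pos: "A + e > 0" "B + e > 0" using \<open>A \<ge> 0\<close> \<open>B \<ge> 0\<close> that by auto
    have "(\<integral>x. u x * v x \<partial>M) \<le>
        (\<integral>x. (A + e) * (B + e) * (u x powr p / (p * (A + e) powr p) + v x powr q / (q * (B + e) powr q)) \<partial>M)"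
    proof (rule integral_mono[OF int_uv])
      fix x
      have "u x * v x = (A + e) * (B + e) * ((u x / (A + e)) * (v x / (B + e)))"
        using pos by simp
      also have "\<dots> \<le> (A + e) * (B + e) * ((u x / (A + e)) powr p / p + (v x / (B + e)) powr q / q)"
        using pos nonneg by (intro mult_left_mono Youngs_inequality pq) auto
      also have "\<dots> = (A + e) * (B + e) * (u x powr p / (p * (A + e) powr p) + v x powr q / (q * (B + e) powr q))"
        using pos nonneg by (simp add: powr_divide mult.commute)
      finally show "u x * v x \<le> \<dots>" .
    qed (use int in simp)
    also have "\<dots> = (A + e) * (B + e) * (A powr p / (A + e) powr p / p + B powr q / (B + e) powr q / q)"
      using int by (simp add: AB mult.commute)
    also have "\<dots> \<le> (A + e) * (B + e) * (1 / p + 1 / q)"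
    proof (intro mult_left_mono add_mono divide_right_mono)
      show "A powr p / (A + e) powr p \<le> 1" "B powr q / (B + e) powr q \<le> 1"
        using pos that pq \<open>A \<ge> 0\<close> \<open>B \<ge> 0\<close> by (auto simp: divide_le_eq_1 intro!: powr_mono2)
    qed (use pos pq in auto)
    finally show ?thesis using pq by simp
  qed
  have "((\<lambda>e. (A + e) * (B + e)) \<longlongrightarrow> (A + 0) * (B + 0)) (at_right 0)"
    by (intro tendsto_intros)
  then have "(\<integral>x. u x * v x \<partial>M) \<le> (A + 0) * (B + 0)"
    by (rule tendsto_lowerbound) (auto intro!: * simp: eventually_at_right_field intro: exI[of _ 1])
  then show ?thesis by (simp add: A_def B_def)
qed

subsection \<open>Spaces of analytic functions on the disk\<close>

text \<open>By uniform continuity each cell contributes an error of at most its length times e'.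
  Explicit left endpoint sums are wanted because they are finite linear combinations, for which
  membership in the function space and a norm bound come from linearity.\<close>

lemma Riemann_sum_tendsto:
  fixes w :: "real \<Rightarrow> 'a::euclidean_space"
  assumes "a \<le> b" and cont: "continuous_on {a..b} w"
  shows "(\<lambda>n. \<Sum>i<Suc n. ((b - a) / Suc n) *\<^sub>R w (a + i * ((b - a) / Suc n)))
           \<longlonglongrightarrow> integral {a..b} w"
proof (rule LIMSEQ_I)
  fix e :: real assume "e > 0"
  \<comment> \<open>The added 1 makes the quotient meaningful for a = b and the final inequality
    strict.\<close>
  define e' where "e' = e / (b - a + 1)"
  have "e' > 0" using \<open>e > 0\<close> \<open>a \<le> b\<close> by (simp add: e'_def)
  have "uniformly_continuous_on {a..b} w"
    using cont by (intro compact_uniformly_continuous) auto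
  then obtain d where "d > 0"
    and d: "\<And>x y. x \<in> {a..b} \<Longrightarrow> y \<in> {a..b} \<Longrightarrow> dist y x < d \<Longrightarrow> dist (w y) (w x) < e'"
    unfolding uniformly_continuous_on_def using \<open>e' > 0\<close> by metis
  obtain M :: nat where M: "(b - a) / d < M" using reals_Archimedean2 by blast
  show "\<exists>no. \<forall>n\<ge>no. norm ((\<Sum>i<Suc n. ((b - a) / Suc n) *\<^sub>R w (a + i * ((b - a) / Suc n)))
      - integral {a..b} w) < e"
  proof (intro exI[of _ M] allI impI)
    fix n assume "n \<ge> M"
    define h where "h = (b - a) / Suc n"
    have "h \<ge> 0" using \<open>a \<le> b\<close> by (simp add: h_def)
    have "(b - a) / d < Suc n" using M \<open>n \<ge> M\<close> by linarith
    then have "h < d" using \<open>d > 0\<close> by (simp add: h_def field_simps)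
    have b: "b = a + Suc n * h" by (simp add: h_def)
    have mono: "a + m * h \<le> b" if "m \<le> Suc n" for m :: nat
      unfolding b using that \<open>h \<ge> 0\<close> by (simp add: mult_right_mono)
    have *: "norm (integral {a..a + m * h} w - (\<Sum>i<m. h *\<^sub>R w (a + i * h))) \<le> m * h * e'"
      if "m \<le> Suc n" for m :: nat
      using that
    proof (induction m)
      case 0
      then show ?case by simp
    next
      case (Suc m)
      let ?c = "a + m * h" and ?d = "a + Suc m * h"
      have "?c \<le> ?d" "a \<le> ?c" using \<open>h \<ge> 0\<close> by (auto simp: algebra_simps)
      have "?d \<le> b" using Suc.prems mono[of "Suc m"] by simp
      have sub: "{?c..?d} \<subseteq> {a..b}" "{a..?d} \<subseteq> {a..b}"
        using \<open>?c \<le> ?d\<close> \<open>a \<le> ?c\<close> \<open>?d \<le> b\<close> by auto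
      have int: "w integrable_on {?c..?d}" "w integrable_on {a..?d}"
        using sub cont by (auto intro!: integrable_continuous_real continuous_on_subset[OF cont])
      have "integral {a..?d} w = integral {a..?c} w + integral {?c..?d} w"
        using \<open>?c \<le> ?d\<close> \<open>a \<le> ?c\<close> int by (simp add: Henstock_Kurzweil_Integration.integral_combine)
      moreover have "norm (integral {?c..?d} w - h *\<^sub>R w ?c) \<le> h * e'"
      proof -
        have hd: "?d - ?c = h" by (simp add: algebra_simps)
        have "((\<lambda>t. w t - w ?c) has_integral (integral {?c..?d} w - (?d - ?c) *\<^sub>R w ?c)) {?c..?d}"
          using int \<open>?c \<le> ?d\<close> has_integral_const_real[of "w ?c" ?c ?d]
          by (intro has_integral_diff integrable_integral) auto
        then have "norm (integral {?c..?d} w - (?d - ?c) *\<^sub>R w ?c) \<le> e' * measure lborel {?c..?d}"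
        proof (rule has_integral_bound_real[where S = "{}", rotated 2])
          fix t assume "t \<in> {?c..?d} - {}"
          then have "dist t ?c < d" "t \<in> {a..b}"
            using hd \<open>h < d\<close> subsetD[OF sub(1)] by (auto simp: dist_real_def)
          moreover have "?c \<in> {a..b}" using \<open>a \<le> ?c\<close> \<open>?c \<le> ?d\<close> \<open>?d \<le> b\<close> by simp
          ultimately have "dist t ?c < d" "t \<in> {a..b}" "?c \<in> {a..b}" by blast+
          then show "norm (w t - w ?c) \<le> e'" using d[of ?c t] by (simp add: dist_norm)
        qed (use \<open>e' > 0\<close> in auto)
        then show ?thesis using \<open>?c \<le> ?d\<close> hd by (simp add: mult.commute)
      qed
      moreover have "norm (integral {a..?c} w - (\<Sum>i<m. h *\<^sub>R w (a + i * h))) \<le> m * h * e'"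
        using Suc by simp
      moreover have "integral {a..?c} w + integral {?c..?d} w - (\<Sum>i<Suc m. h *\<^sub>R w (a + i * h)) =
          (integral {a..?c} w - (\<Sum>i<m. h *\<^sub>R w (a + i * h))) + (integral {?c..?d} w - h *\<^sub>R w ?c)"
        by simp
      ultimately have "norm (integral {a..?d} w - (\<Sum>i<Suc m. h *\<^sub>R w (a + i * h))) \<le> m * h * e' + h * e'"
        using norm_triangle_mono by metis
      then show ?case by (simp add: algebra_simps)
    qed
    have "norm (integral {a..b} w - (\<Sum>i<Suc n. h *\<^sub>R w (a + i * h))) \<le> (b - a) * e'"
      using *[of "Suc n"] unfolding b by simp
    also have "\<dots> < e"
      using \<open>e > 0\<close> \<open>a \<le> b\<close> by (simp add: e'_def field_simps)
    finally show "norm ((\<Sum>i<Suc n. ((b - a) / Suc n) *\<^sub>R w (a + i * ((b - a) / Suc n))) - integral {a..b} w) < e"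
      unfolding h_def by (simp add: norm_minus_commute)
  qed
qed

lemma compact_subset_disk:
  assumes "compact K" "K \<subseteq> disk"
  obtains r where "0 \<le> r" "r < 1" "K \<subseteq> cball 0 r"
proof (cases "K = {}")
  case True
  then show ?thesis using that[of 0] by auto
next
  case False
  obtain z where "z \<in> K" "\<And>w. w \<in> K \<Longrightarrow> cmod w \<le> cmod z"
    using continuous_attains_sup[OF assms(1) False, of cmod] by (auto intro: continuous_intros)
  moreover from this have "K \<subseteq> cball 0 (cmod z)" "cmod z < 1"
    using assms(2) by (auto simp: disk_def)
  ultimately show ?thesis using that[of "cmod z"] by simp
qed

text \<open>The common interface of Hardy and Bergman spaces. \<open>lower_semicont\<close> takes
  the place of completeness: it returns pointwise limits of Riemann sums, exhaustions and series to
  X, with a norm bound. \<open>eval_bound\<close> makes point evaluations bounded functionals and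
  makes norm-bounded families locally bounded.\<close>

locale disk_function_space =
  fixes X :: "(complex \<Rightarrow> complex) set" and N :: "(complex \<Rightarrow> complex) \<Rightarrow> real"
  assumes holo: "f \<in> X \<Longrightarrow> f holomorphic_on disk"
    and ext: "f \<in> X \<Longrightarrow> extensional_disk f"
    and lin: "f \<in> X \<Longrightarrow> h \<in> X \<Longrightarrow> (\<lambda>z. a * f z + b * h z) \<in> X"
    and one_in: "(\<lambda>z. if z \<in> disk then 1 else 0) \<in> X"
    and N_nonneg: "f \<in> X \<Longrightarrow> N f \<ge> 0"
    and N_scale: "f \<in> X \<Longrightarrow> N (\<lambda>z. a * f z) = cmod a * N f"
    and N_triangle: "f \<in> X \<Longrightarrow> h \<in> X \<Longrightarrow> N (\<lambda>z. f z + h z) \<le> N f + N h"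
    and eval_bound: "0 \<le> r \<Longrightarrow> r < 1 \<Longrightarrow> \<exists>C. \<forall>f\<in>X. \<forall>z. cmod z \<le> r \<longrightarrow> cmod (f z) \<le> C * N f"
    and lower_semicont: "(\<And>n. F n \<in> X) \<Longrightarrow> (\<And>n. N (F n) \<le> c n) \<Longrightarrow> c \<longlonglongrightarrow> C \<Longrightarrow>
      (\<And>z. z \<in> disk \<Longrightarrow> (\<lambda>n. F n z) \<longlonglongrightarrow> h z) \<Longrightarrow> h holomorphic_on disk \<Longrightarrow> extensional_disk h \<Longrightarrow>
      h \<in> X \<and> N h \<le> C"
    and multiplier: "g holomorphic_on disk \<Longrightarrow> (\<And>z. z \<in> disk \<Longrightarrow> cmod (g z) \<le> B) \<Longrightarrow> f \<in> X \<Longrightarrow>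
      mult_op g f \<in> X \<and> N (mult_op g f) \<le> B * N f"
begin

lemma scale: "f \<in> X \<Longrightarrow> (\<lambda>z. a * f z) \<in> X"
  using lin[of f f a 0] by simp

lemma add: "f \<in> X \<Longrightarrow> h \<in> X \<Longrightarrow> (\<lambda>z. f z + h z) \<in> X"
  using lin[of f h 1 1] by simp

lemma diff: "f \<in> X \<Longrightarrow> h \<in> X \<Longrightarrow> (\<lambda>z. f z - h z) \<in> X"
  using lin[of f h 1 "-1"] by simp

lemma zero: "(\<lambda>z. 0) \<in> X"
  using scale[OF one_in, of 0] by simp

lemma N_zero: "N (\<lambda>z. 0) = 0"
  using N_scale[OF one_in, of 0] by simp

lemma N_minus: "f \<in> X \<Longrightarrow> N (\<lambda>z. - f z) = N f"
  using N_scale[of f "-1"] by simp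

lemma N_diff_commute: "f \<in> X \<Longrightarrow> h \<in> X \<Longrightarrow> N (\<lambda>z. f z - h z) = N (\<lambda>z. h z - f z)"
  using N_minus[OF diff, of f h] by simp

lemma N_diff_abs: "f \<in> X \<Longrightarrow> h \<in> X \<Longrightarrow> \<bar>N f - N h\<bar> \<le> N (\<lambda>z. f z - h z)"
  using N_triangle[OF diff, of f h h] N_triangle[OF diff, of h f f] N_diff_commute[of f h] by simp

lemma outside: "f \<in> X \<Longrightarrow> z \<notin> disk \<Longrightarrow> f z = 0"
  using ext by (simp add: extensional_disk_def)

lemma sum_in:
  assumes "\<And>i. i < n \<Longrightarrow> F i \<in> X"
  shows "(\<lambda>z. \<Sum>i<n. F i z) \<in> X \<and> N (\<lambda>z. \<Sum>i<n. F i z) \<le> (\<Sum>i<(n::nat). N (F i))"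
  using assms
proof (induction n)
  case 0
  then show ?case using zero N_zero by simp
next
  case (Suc n)
  then show ?case
    using add[of "\<lambda>z. \<Sum>i<n. F i z" "F n"] N_triangle[of "\<lambda>z. \<Sum>i<n. F i z" "F n"] by force
qed

text \<open>Holomorphy of the limit comes from Montel's theorem: by \<open>eval_bound\<close> the
  sequence is uniformly bounded on compact sets, so a subsequence has a holomorphic limit, which can
  only be the given pointwise limit h.\<close>

lemma limit_in:
  assumes F: "\<And>n. F n \<in> X" and c: "\<And>n. N (F n) \<le> c n" "c \<longlonglongrightarrow> C"
    and lim: "\<And>z. z \<in> disk \<Longrightarrow> (\<lambda>n. F n z) \<longlonglongrightarrow> h z" and h: "extensional_disk h"
  shows "h \<in> X" "N h \<le> C"
proof -
  obtain B where B: "\<And>n. \<bar>c n\<bar> \<le> B"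
    using convergent_imp_Bseq[OF convergentI[OF c(2)]] by (metis BseqE real_norm_def)
  have "h holomorphic_on disk"
  proof -
    obtain k r where k: "k holomorphic_on disk" "strict_mono (r :: nat \<Rightarrow> nat)"
      "\<And>x. x \<in> disk \<Longrightarrow> (\<lambda>n. F (r n) x) \<longlonglongrightarrow> k x"
    proof (rule Montel[of disk "range F" F])
      fix K assume "compact K" "K \<subseteq> disk"
      then obtain s where s: "0 \<le> s" "s < 1" "K \<subseteq> cball 0 s" by (rule compact_subset_disk)
      obtain D where D: "\<forall>f\<in>X. \<forall>z. cmod z \<le> s \<longrightarrow> cmod (f z) \<le> D * N f"
        using eval_bound[OF s(1,2)] by blast
      have "cmod (F n z) \<le> \<bar>D\<bar> * B" if "z \<in> K" for n z
      proof -
        have "cmod (F n z) \<le> D * N (F n)" using D F s(3) that by auto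
        also have "\<dots> \<le> \<bar>D\<bar> * B"
        proof (rule mult_mono)
          show "N (F n) \<le> B" using c(1)[of n] B[of n] by linarith
        qed (use N_nonneg[OF F] in auto)
        finally show ?thesis .
      qed
      then show "\<exists>B. \<forall>f\<in>range F. \<forall>z\<in>K. norm (f z) \<le> B" by auto
    qed (use F holo in \<open>auto simp: disk_def\<close>)
    have "h z = k z" if "z \<in> disk" for z
      using LIMSEQ_subseq_LIMSEQ[OF lim[OF that] k(2)] k(3)[OF that]
      by (auto simp: o_def intro: LIMSEQ_unique)
    then show ?thesis using k(1) holomorphic_transform[of k disk h] by simp
  qed
  then show "h \<in> X" "N h \<le> C" using lower_semicont[OF F c lim _ h] by auto
qed

lemma bounded_functionalE:
  assumes "bounded_functional X N \<phi>"
  obtains C where "C \<ge> 0" "\<And>f. f \<in> X \<Longrightarrow> cmod (\<phi> f) \<le> C * N f"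
proof -
  obtain C where C: "\<forall>f\<in>X. cmod (\<phi> f) \<le> C * N f"
    using assms by (auto simp: bounded_functional_def)
  have "cmod (\<phi> f) \<le> \<bar>C\<bar> * N f" if "f \<in> X" for f
    using C that N_nonneg[OF that] by (meson abs_ge_self dual_order.trans mult_right_mono)
  then show ?thesis using that[of "\<bar>C\<bar>"] by simp
qed

lemma functional_lin: "bounded_functional X N \<phi> \<Longrightarrow> f \<in> X \<Longrightarrow> h \<in> X \<Longrightarrow>
    \<phi> (\<lambda>z. a * f z + b * h z) = a * \<phi> f + b * \<phi> h"
  by (auto simp: bounded_functional_def)

lemma functional_diff: "bounded_functional X N \<phi> \<Longrightarrow> f \<in> X \<Longrightarrow> h \<in> X \<Longrightarrow> \<phi> (\<lambda>z. f z - h z) = \<phi> f - \<phi> h"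
  using functional_lin[of \<phi> f h 1 "-1"] by simp

lemma functional_scale: "bounded_functional X N \<phi> \<Longrightarrow> f \<in> X \<Longrightarrow> \<phi> (\<lambda>z. a * f z) = a * \<phi> f"
  using functional_lin[of \<phi> f f a 0] by simp

text \<open>Evaluations separate the elements of X. A vector-valued integral defined through
  functionals is thereby forced to be the pointwise integral.\<close>

lemma bounded_functional_eval: "bounded_functional X N (\<lambda>f. f z)"
proof (cases "z \<in> disk")
  case True
  then show ?thesis
    using eval_bound[of "cmod z"] unfolding bounded_functional_def disk_def by auto
next
  case False
  then show ?thesis unfolding bounded_functional_def
    using outside by (intro conjI exI[of _ 0]) auto
qed

section \<open>Integrals of norm continuous curves in the space\<close>

definition norm_continuous_on :: "real set \<Rightarrow> (real \<Rightarrow> complex \<Rightarrow> complex) \<Rightarrow> bool" where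
  "norm_continuous_on S v \<longleftrightarrow> (\<forall>t\<in>S. v t \<in> X) \<and>
     (\<forall>s\<in>S. ((\<lambda>t. N (\<lambda>z. v t z - v s z)) \<longlongrightarrow> 0) (at s within S))"

lemma norm_continuous_on_subset: "norm_continuous_on S v \<Longrightarrow> T \<subseteq> S \<Longrightarrow> norm_continuous_on T v"
  unfolding norm_continuous_on_def by (meson subsetD tendsto_within_subset)

lemma norm_continuous_on_functional:
  assumes v: "norm_continuous_on S v" and \<phi>: "bounded_functional X N \<phi>"
  shows "continuous_on S (\<lambda>t. \<phi> (v t))"
  unfolding continuous_on_def
proof
  fix s assume s: "s \<in> S"
  obtain C where C: "\<And>f. f \<in> X \<Longrightarrow> cmod (\<phi> f) \<le> C * N f" using bounded_functionalE[OF \<phi>] by blast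
  have "((\<lambda>t. C * N (\<lambda>z. v t z - v s z)) \<longlongrightarrow> 0) (at s within S)"
    using v s by (auto simp: norm_continuous_on_def intro!: tendsto_mult_right_zero)
  moreover have "\<forall>\<^sub>F t in at s within S. norm (\<phi> (v t) - \<phi> (v s)) \<le> C * N (\<lambda>z. v t z - v s z)"
    using v s C[OF diff] functional_diff[OF \<phi>] unfolding eventually_at_filter norm_continuous_on_def
    by (intro always_eventually) metis
  ultimately have "((\<lambda>t. \<phi> (v t) - \<phi> (v s)) \<longlongrightarrow> 0) (at s within S)"
    by (rule Lim_null_comparison[rotated])
  then show "((\<lambda>t. \<phi> (v t)) \<longlongrightarrow> \<phi> (v s)) (at s within S)" by (simp add: LIM_zero_iff)
qed

lemma norm_continuous_on_N:
  assumes v: "norm_continuous_on S v"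
  shows "continuous_on S (\<lambda>t. N (v t))"
  unfolding continuous_on_def
proof
  fix s assume s: "s \<in> S"
  have "((\<lambda>t. N (\<lambda>z. v t z - v s z)) \<longlongrightarrow> 0) (at s within S)"
    using v s by (auto simp: norm_continuous_on_def)
  moreover have "\<forall>\<^sub>F t in at s within S. norm (N (v t) - N (v s)) \<le> N (\<lambda>z. v t z - v s z)"
    using v s N_diff_abs unfolding eventually_at_filter norm_continuous_on_def
    by (intro always_eventually) auto
  ultimately have "((\<lambda>t. N (v t) - N (v s)) \<longlongrightarrow> 0) (at s within S)"
    by (rule Lim_null_comparison[rotated])
  then show "((\<lambda>t. N (v t)) \<longlongrightarrow> N (v s)) (at s within S)" by (simp add: LIM_zero_iff)
qed

lemma norm_continuous_on_eval: "norm_continuous_on S v \<Longrightarrow> continuous_on S (\<lambda>t. v t z)"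
  using norm_continuous_on_functional[OF _ bounded_functional_eval] .

lemma norm_continuous_on_diff_const:
  assumes v: "norm_continuous_on S v" and w: "w \<in> X"
  shows "norm_continuous_on S (\<lambda>t z. v t z - w z)"
  using assms diff by (auto simp: norm_continuous_on_def)

text \<open>For each n the same finite combination of values of v approximates the integral at every
  z, so the approximants lie in X, and their norms are bounded by the Riemann sums of
  \<open>N (v t)\<close>.\<close>

lemma integral_in:
  assumes "a \<le> b" and v: "norm_continuous_on {a..b} v"
  shows "(\<lambda>z. integral {a..b} (\<lambda>t. v t z)) \<in> X"
    and "N (\<lambda>z. integral {a..b} (\<lambda>t. v t z)) \<le> integral {a..b} (\<lambda>t. N (v t))"
proof -
  define h where "h n = (b - a) / Suc n" for n
  have pt: "a + i * h n \<in> {a..b}" if "i < Suc n" for i n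
  proof -
    have "i * h n \<le> Suc n * h n"
      using that \<open>a \<le> b\<close> by (intro mult_right_mono) (auto simp: h_def)
    then show ?thesis using \<open>a \<le> b\<close> by (auto simp: h_def)
  qed
  define F where "F n = (\<lambda>z. \<Sum>i<Suc n. complex_of_real (h n) * v (a + i * h n) z)" for n
  have inX: "v (a + i * h n) \<in> X" if "i < Suc n" for i n
    using v pt[OF that] by (auto simp: norm_continuous_on_def)
  have "h n \<ge> 0" for n using \<open>a \<le> b\<close> by (simp add: h_def)
  have F: "F n \<in> X" "N (F n) \<le> (\<Sum>i<Suc n. h n *\<^sub>R N (v (a + i * h n)))" for n
    using sum_in[of "Suc n" "\<lambda>i z. complex_of_real (h n) * v (a + i * h n) z"] scale inX
      N_scale[OF inX] \<open>h n \<ge> 0\<close> unfolding F_def by auto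
  have lim: "(\<lambda>n. F n z) \<longlonglongrightarrow> integral {a..b} (\<lambda>t. v t z)" for z
    using Riemann_sum_tendsto[OF \<open>a \<le> b\<close> norm_continuous_on_eval[OF v], of z]
    by (simp add: F_def h_def scaleR_conv_of_real)
  have limN: "(\<lambda>n. \<Sum>i<Suc n. h n *\<^sub>R N (v (a + i * h n))) \<longlonglongrightarrow> integral {a..b} (\<lambda>t. N (v t))"
    using Riemann_sum_tendsto[OF \<open>a \<le> b\<close> norm_continuous_on_N[OF v]] by (simp only: h_def)
  have "extensional_disk (\<lambda>z. integral {a..b} (\<lambda>t. v t z))"
    unfolding extensional_disk_def
  proof (intro allI impI)
    fix z assume "z \<notin> disk"
    then have "integral {a..b} (\<lambda>t. v t z) = integral {a..b} (\<lambda>t. 0)"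
      using v outside by (intro integral_cong) (auto simp: norm_continuous_on_def)
    then show "integral {a..b} (\<lambda>t. v t z) = 0" by simp
  qed
  from limit_in[OF F limN lim this]
  show "(\<lambda>z. integral {a..b} (\<lambda>t. v t z)) \<in> X"
    and "N (\<lambda>z. integral {a..b} (\<lambda>t. v t z)) \<le> integral {a..b} (\<lambda>t. N (v t))" by auto
qed

text \<open>Pointwise convergence of Riemann sums says nothing about their images under \<phi>.
  Instead, \<phi> of the integral up to x is shown to have derivative \<open>\<phi> (v x)\<close>,
  and the fundamental theorem of calculus gives the formula.\<close>

lemma functional_integral:
  assumes "a \<le> b" and v: "norm_continuous_on {a..b} v" and \<phi>: "bounded_functional X N \<phi>"
  shows "\<phi> (\<lambda>z. integral {a..b} (\<lambda>t. v t z)) = integral {a..b} (\<lambda>t. \<phi> (v t))"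
proof -
  obtain C where "C \<ge> 0" and C: "\<And>f. f \<in> X \<Longrightarrow> cmod (\<phi> f) \<le> C * N f"
    using bounded_functionalE[OF \<phi>] by blast
  define \<Phi> where "\<Phi> x = \<phi> (\<lambda>z. integral {a..x} (\<lambda>t. v t z))" for x
  \<comment> \<open>The difference quotient estimate: v is compared with a constant element w on
    [c,d], and the norm bound for integrals is applied to v - w. It is used with w = v x on either
    side of x.\<close>
  have step: "cmod (\<Phi> d - \<Phi> c - (d - c) *\<^sub>R \<phi> w) \<le> C * e * (d - c)"
    if cd: "a \<le> c" "c \<le> d" "d \<le> b" and w: "w \<in> X" and e: "\<And>t. t \<in> {c..d} \<Longrightarrow> N (\<lambda>z. v t z - w z) \<le> e"
    for c d w e
  proof -
    have sub: "norm_continuous_on {a..c} v" "norm_continuous_on {a..d} v" "norm_continuous_on {c..d} v"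
      using cd by (auto intro: norm_continuous_on_subset[OF v])
    have int: "(\<lambda>t. v t z) integrable_on {a..d}" "(\<lambda>t. v t z) integrable_on {c..d}" for z
      using sub norm_continuous_on_eval integrable_continuous_real by blast+
    have "integral {c..d} (\<lambda>t. v t z - w z) =
        integral {a..d} (\<lambda>t. v t z) - integral {a..c} (\<lambda>t. v t z) - (d - c) * w z" for z
      using Henstock_Kurzweil_Integration.integral_combine[OF cd(1,2) int(1)[of z]] int(2)[of z] cd
      by (subst Henstock_Kurzweil_Integration.integral_diff) (auto simp: scaleR_conv_of_real algebra_simps)
    moreover have d: "norm_continuous_on {c..d} (\<lambda>t z. v t z - w z)"
      by (rule norm_continuous_on_diff_const[OF sub(3) w])
    moreover have X: "(\<lambda>z. integral {a..d} (\<lambda>t. v t z)) \<in> X" "(\<lambda>z. integral {a..c} (\<lambda>t. v t z)) \<in> X"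
      using cd by (auto intro!: integral_in sub)
    ultimately have "\<Phi> d - \<Phi> c - (d - c) *\<^sub>R \<phi> w = \<phi> (\<lambda>z. integral {c..d} (\<lambda>t. v t z - w z))"
      unfolding \<Phi>_def
      by (simp add: functional_diff[OF \<phi>] functional_scale[OF \<phi>] diff scale w scaleR_conv_of_real flip: of_real_diff)
    also have "cmod \<dots> \<le> C * N (\<lambda>z. integral {c..d} (\<lambda>t. v t z - w z))"
      using cd by (intro C integral_in d) auto
    also have "\<dots> \<le> C * integral {c..d} (\<lambda>t. N (\<lambda>z. v t z - w z))"
      using cd \<open>C \<ge> 0\<close> by (intro mult_left_mono integral_in d) auto
    also have "\<dots> \<le> C * integral {c..d} (\<lambda>t. e)"
      using e \<open>C \<ge> 0\<close> norm_continuous_on_N[OF d]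
      by (intro mult_left_mono integral_le integrable_continuous_real) auto
    finally show ?thesis using cd by (simp add: mult_ac)
  qed
  have "((\<lambda>t. \<phi> (v t)) has_integral (\<Phi> b - \<Phi> a)) {a..b}"
  proof (rule fundamental_theorem_of_calculus[OF \<open>a \<le> b\<close>])
    fix x assume x: "x \<in> {a..b}"
    have vx: "v x \<in> X" using v x by (auto simp: norm_continuous_on_def)
    show "(\<Phi> has_vector_derivative \<phi> (v x)) (at x within {a..b})"
      unfolding has_vector_derivative_def has_derivative_within_alt
    proof (intro conjI allI impI)
      fix e :: real assume "e > 0"
      define e' where "e' = e / (C + 1)"
      have "e' > 0" "C * e' \<le> e" using \<open>e > 0\<close> \<open>C \<ge> 0\<close> by (auto simp: e'_def field_simps)
      have "((\<lambda>t. N (\<lambda>z. v t z - v x z)) \<longlongrightarrow> 0) (at x within {a..b})"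
        using v x by (auto simp: norm_continuous_on_def)
      then have "\<forall>\<^sub>F t in at x within {a..b}. N (\<lambda>z. v t z - v x z) < e'"
        using \<open>e' > 0\<close> by (auto dest: order_tendstoD)
      then obtain d where "d > 0" and d: "\<And>t. t \<in> {a..b} \<Longrightarrow> t \<noteq> x \<Longrightarrow> dist t x < d \<Longrightarrow> N (\<lambda>z. v t z - v x z) < e'"
        unfolding eventually_at by blast
      have d': "N (\<lambda>z. v t z - v x z) \<le> e'" if "t \<in> {a..b}" "dist t x < d" for t
        using d[OF that(1) _ that(2)] \<open>e' > 0\<close> N_zero by (cases "t = x") auto
      show "\<exists>d>0. \<forall>y\<in>{a..b}. norm (y - x) < d \<longrightarrow>
          norm (\<Phi> y - \<Phi> x - (y - x) *\<^sub>R \<phi> (v x)) \<le> e * norm (y - x)"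
      proof (intro exI[of _ d] conjI ballI impI \<open>d > 0\<close>)
        fix y assume y: "y \<in> {a..b}" "norm (y - x) < d"
        have "norm (\<Phi> y - \<Phi> x - (y - x) *\<^sub>R \<phi> (v x)) \<le> C * e' * norm (y - x)"
        proof (cases "x \<le> y")
          case True
          then show ?thesis using step[of x y "v x" e'] d' x y vx by (auto simp: dist_real_def)
        next
          case False
          have "norm (\<Phi> y - \<Phi> x - (y - x) *\<^sub>R \<phi> (v x)) = norm (- (\<Phi> x - \<Phi> y - (x - y) *\<^sub>R \<phi> (v x)))"
            by (simp add: algebra_simps)
          also have "\<dots> \<le> C * e' * (x - y)"
            unfolding norm_minus_cancel using False d' x y vx by (intro step) (auto simp: dist_real_def)
          finally show ?thesis using False by simp
        qed
        also have "\<dots> \<le> e * norm (y - x)" using \<open>C * e' \<le> e\<close> by (intro mult_right_mono) auto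
        finally show "norm (\<Phi> y - \<Phi> x - (y - x) *\<^sub>R \<phi> (v x)) \<le> e * norm (y - x)" .
      qed
    qed (rule bounded_linear_scaleR_left)
  qed
  moreover have "\<Phi> a = 0"
    using functional_scale[OF \<phi> zero, of 0] by (simp add: \<Phi>_def)
  ultimately show ?thesis by (simp add: \<Phi>_def integral_unique)
qed

end

text \<open>Curves obtained from condition W are continuous on the open interval only, so the
  integral is reached through compact subintervals.\<close>

lemma integral_exhaust_unit_interval:
  fixes w :: "real \<Rightarrow> 'a::euclidean_space"
  assumes "set_integrable lborel {0<..<1} w"
  shows "(\<lambda>n::nat. integral {1/(n+3)..1-1/(n+3)} w) \<longlonglongrightarrow> (LINT t:{0<..<1}|lborel. w t)"
proof -
  \<comment> \<open>The shift by 3 makes every interval nondegenerate, already for n = 0.\<close>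
  define K where "K n = {1/(real n+3)..1-1/(real n+3)}" for n
  have U: "(\<Union>n. K n) = {0<..<1}"
  proof (intro equalityI subsetI)
    fix t :: real assume t: "t \<in> {0<..<1}"
    define m where "m = min t (1 - t)"
    have "m > 0" using t by (auto simp: m_def)
    obtain n where "1 / m < real n" using reals_Archimedean2 by blast
    then have "1 / (real n + 3) \<le> m"
      using \<open>m > 0\<close> by (simp add: field_simps)
    then show "t \<in> (\<Union>n. K n)" by (auto simp: K_def m_def intro!: exI[of _ n])
  next
    fix t :: real assume "t \<in> (\<Union>n. K n)"
    then obtain n where n: "1/(real n+3) \<le> t" "t \<le> 1 - 1/(real n+3)" by (auto simp: K_def)
    moreover have "1/(real n+3) > 0" by simp
    ultimately show "t \<in> {0<..<1}" unfolding greaterThanLessThan_iff by linarith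
  qed
  have "incseq K"
  proof (rule incseq_SucI)
    fix n
    have "1/(real (Suc n)+3) \<le> 1/(real n + 3)" by (intro divide_left_mono) auto
    then show "K n \<le> K (Suc n)" by (auto simp: K_def)
  qed
  have "(\<lambda>n. LINT t:K n|lborel. w t) \<longlonglongrightarrow> (LINT t:(\<Union>n. K n)|lborel. w t)"
    using assms U by (intro set_integral_cont_up \<open>incseq K\<close>) (auto simp: K_def)
  moreover have "(LINT t:K n|lborel. w t) = integral (K n) w" for n
    using U assms by (intro set_borel_integral_eq_integral set_integrable_subset[OF assms]) (auto simp: K_def)
  ultimately show ?thesis unfolding U by (simp add: K_def)
qed

context disk_function_space
begin

lemma set_integrable_functional:
  assumes v: "norm_continuous_on {0<..<1} v" and int: "set_integrable lborel {0<..<1} (\<lambda>t. N (v t))"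
    and \<phi>: "bounded_functional X N \<phi>"
  shows "set_integrable lborel {0<..<1} (\<lambda>t. \<phi> (v t))"
proof -
  obtain C where C: "C \<ge> 0" "\<And>f. f \<in> X \<Longrightarrow> cmod (\<phi> f) \<le> C * N f"
    using bounded_functionalE[OF \<phi>] by blast
  show ?thesis
  proof (rule set_integrable_bound)
    show "set_integrable lborel {0<..<1} (\<lambda>t. C * N (v t))" using int by simp
    show "set_borel_measurable lborel {0<..<1} (\<lambda>t. \<phi> (v t))"
      unfolding set_borel_measurable_def
      using borel_measurable_continuous_on_indicator[OF _ norm_continuous_on_functional[OF v \<phi>]] by simp
    show "AE t in lborel. t \<in> {0<..<1} \<longrightarrow> norm (\<phi> (v t)) \<le> norm (C * N (v t))"
      using C v N_nonneg by (auto simp: norm_continuous_on_def abs_mult intro!: AE_I2 order_trans[OF C(2)])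
  qed
qed

text \<open>The integrals H n over compact subintervals form a Cauchy sequence, with differences
  bounded by those of the scalar integrals J n. Letting the larger index tend to infinity gives a
  bound I - J n for the norm of h - H n. This is convergence in norm, which every bounded functional
  respects.\<close>

theorem Bochner_integral:
  assumes v: "norm_continuous_on {0<..<1} v" and int: "set_integrable lborel {0<..<1} (\<lambda>t. N (v t))"
  defines "h \<equiv> \<lambda>z. LINT t:{0<..<1}|lborel. v t z"
  shows "h \<in> X"
    and "bounded_functional X N \<phi> \<Longrightarrow> \<phi> h = (LINT t:{0<..<1}|lborel. \<phi> (v t))"
proof -
  define a where "a n = 1/(real n+3)" for n
  define b where "b n = 1 - 1/(real n+3)" for n
  have ab: "0 < a n" "a n \<le> b n" "b n < 1" for n
    by (auto simp: a_def b_def field_simps)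
  have mono: "a m \<le> a n" "b n \<le> b m" if "n \<le> m" for n m
    using that by (auto simp: a_def b_def intro!: divide_left_mono)
  have sub: "norm_continuous_on {c..d} v" if "0 < c" "d < 1" for c d
    using that by (intro norm_continuous_on_subset[OF v]) auto
  define H where "H n = (\<lambda>z. integral {a n..b n} (\<lambda>t. v t z))" for n
  define J where "J n = integral {a n..b n} (\<lambda>t. N (v t))" for n
  define I where "I = (LINT t:{0<..<1}|lborel. N (v t))"
  have HX: "H n \<in> X" for n
    unfolding H_def using ab by (intro integral_in sub)
  have J: "J \<longlonglongrightarrow> I"
    using integral_exhaust_unit_interval[OF int] by (simp add: J_def[abs_def] a_def b_def I_def)
  have Hlim: "(\<lambda>n. H n z) \<longlonglongrightarrow> h z" for z
    using integral_exhaust_unit_interval[OF set_integrable_functional[OF v int bounded_functional_eval[of z]]]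
    by (simp add: H_def a_def b_def h_def)
  have split: "integral {a m..b m} w = integral {a m..a n} w + integral {a n..b n} w + integral {b n..b m} w"
    if "n \<le> m" "continuous_on {a m..b m} w" for n m and w :: "real \<Rightarrow> 'c::euclidean_space"
  proof -
    have i: "w integrable_on {c..d}" if "a m \<le> c" "d \<le> b m" for c d
      using that \<open>continuous_on {a m..b m} w\<close>
      by (intro integrable_continuous_real) (auto intro: continuous_on_subset)
    have "a n \<le> b m" using ab[of n] mono[OF \<open>n \<le> m\<close>] by linarith
    have "integral {a m..a n} w + integral {a n..b m} w = integral {a m..b m} w"
      using mono[OF \<open>n \<le> m\<close>] \<open>a n \<le> b m\<close> i
      by (intro Henstock_Kurzweil_Integration.integral_combine) auto
    moreover have "integral {a n..b n} w + integral {b n..b m} w = integral {a n..b m} w"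
      using mono[OF \<open>n \<le> m\<close>] ab i
      by (intro Henstock_Kurzweil_Integration.integral_combine) auto
    ultimately show ?thesis by (simp add: add.assoc)
  qed
  \<comment> \<open>H m - H n consists of the two end pieces, and the integrals of
    \<open>N (v t)\<close> over them add up to J m - J n.\<close>
  have cauchy: "N (\<lambda>z. H m z - H n z) \<le> J m - J n" if "n \<le> m" for n m
  proof -
    have s: "norm_continuous_on {a m..b m} v" "norm_continuous_on {a m..a n} v" "norm_continuous_on {b n..b m} v"
      using ab[of m] ab[of n] by (auto intro!: sub)
    have "(\<lambda>z. H m z - H n z) = (\<lambda>z. integral {a m..a n} (\<lambda>t. v t z) + integral {b n..b m} (\<lambda>t. v t z))"
      using split[OF that norm_continuous_on_eval[OF s(1)]] by (auto simp: H_def)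
    then have "N (\<lambda>z. H m z - H n z) \<le> N (\<lambda>z. integral {a m..a n} (\<lambda>t. v t z)) + N (\<lambda>z. integral {b n..b m} (\<lambda>t. v t z))"
      using mono[OF that] by (simp add: N_triangle integral_in s)
    also have "\<dots> \<le> integral {a m..a n} (\<lambda>t. N (v t)) + integral {b n..b m} (\<lambda>t. N (v t))"
      using mono[OF that] by (intro add_mono integral_in s)
    also have "\<dots> = J m - J n"
      using split[OF that norm_continuous_on_N[OF s(1)]] by (simp add: J_def)
    finally show ?thesis .
  qed
  have hext: "extensional_disk h"
    unfolding extensional_disk_def
  proof (intro allI impI)
    fix z assume "z \<notin> disk"
    then have "H n z = 0" for n using outside[OF HX] by simp
    then show "h z = 0" using LIMSEQ_unique[OF Hlim[of z], of 0] by simp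
  qed
  have tail: "(\<lambda>z. h z - H n z) \<in> X \<and> N (\<lambda>z. h z - H n z) \<le> I - J n" for n
  proof -
    have "(\<lambda>m. J (m + n) - J n) \<longlonglongrightarrow> I - J n"
      by (intro tendsto_intros LIMSEQ_ignore_initial_segment J)
    moreover have "(\<lambda>m. H (m + n) z - H n z) \<longlonglongrightarrow> h z - H n z" for z
      by (intro tendsto_intros LIMSEQ_ignore_initial_segment Hlim)
    moreover have "extensional_disk (\<lambda>z. h z - H n z)"
      using hext ext[OF HX] by (simp add: extensional_disk_def)
    ultimately show ?thesis
      using limit_in[of "\<lambda>m z. H (m + n) z - H n z" "\<lambda>m. J (m + n) - J n" "I - J n"] cauchy diff[OF HX HX]
      by auto
  qed
  then show hX: "h \<in> X" using add[OF conjunct1[OF tail[of 0]] HX[of 0]] by simp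
  show "\<phi> h = (LINT t:{0<..<1}|lborel. \<phi> (v t))" if \<phi>: "bounded_functional X N \<phi>"
  proof -
    obtain C where C: "C \<ge> 0" "\<And>f. f \<in> X \<Longrightarrow> cmod (\<phi> f) \<le> C * N f"
      using bounded_functionalE[OF \<phi>] by blast
    have "(\<lambda>n. \<phi> h - \<phi> (H n)) \<longlonglongrightarrow> 0"
    proof (rule Lim_null_comparison)
      show "(\<lambda>n. C * (I - J n)) \<longlonglongrightarrow> 0"
        using tendsto_mult_left[OF tendsto_diff[OF tendsto_const J], of C I] by simp
      show "\<forall>\<^sub>F n in sequentially. norm (\<phi> h - \<phi> (H n)) \<le> C * (I - J n)"
        using tail C functional_diff[OF \<phi> hX HX]
        by (auto intro!: always_eventually order_trans[OF _ mult_left_mono[OF conjunct2[OF tail] C(1)]]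
            simp flip: functional_diff[OF \<phi> hX HX])
    qed
    then have "(\<lambda>n. \<phi> (H n)) \<longlonglongrightarrow> \<phi> h"
      using tendsto_diff[OF tendsto_const[of "\<phi> h"]] by force
    moreover have "(\<lambda>n. \<phi> (H n)) \<longlonglongrightarrow> (LINT t:{0<..<1}|lborel. \<phi> (v t))"
      using integral_exhaust_unit_interval[OF set_integrable_functional[OF v int \<phi>]]
        functional_integral[OF ab(2) sub[OF ab(1,3)] \<phi>]
      by (simp add: H_def a_def b_def)
    ultimately show ?thesis by (rule LIMSEQ_unique)
  qed
qed

text \<open>The description in \<open>integral_op\<close> has at most one solution because
  evaluations are among the functionals it quantifies over.\<close>

lemma integral_op_eqI:
  assumes "h \<in> X" "\<And>\<phi>. bounded_functional X N \<phi> \<Longrightarrow> \<phi> h = (LINT t:{0<..<1::real}|lborel. \<phi> (S t f))"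
  shows "integral_op X N S f = h"
  unfolding integral_op_def
proof (rule the_equality)
  fix k assume k: "k \<in> X \<and> (\<forall>\<phi>. bounded_functional X N \<phi> \<longrightarrow> \<phi> k = (LINT t:{0<..<1}|lborel. \<phi> (S t f)))"
  show "k = h"
  proof
    fix z
    show "k z = h z"
      using k assms(2)[OF bounded_functional_eval[of z]] bounded_functional_eval[of z] by auto
  qed
qed (use assms in auto)

lemma cond_W_norm_continuous:
  assumes "cond_W X N S" "f \<in> X"
  shows "norm_continuous_on {0<..<1} (\<lambda>t. S t f)"
proof -
  have "S t f \<in> X" if "t \<in> {0<..<1}" for t
    using assms that by (auto simp: cond_W_def bounded_op_def)
  moreover have "((\<lambda>t. N (\<lambda>z. S t f z - S s f z)) \<longlongrightarrow> 0) (at s within {0<..<1})" if "s \<in> {0<..<1}" for s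
  proof (rule Lim_at_imp_Lim_at_within)
    show "((\<lambda>t. N (\<lambda>z. S t f z - S s f z)) \<longlongrightarrow> 0) (at s)"
      using assms that unfolding cond_W_def by blast
  qed
  ultimately show ?thesis by (auto simp: norm_continuous_on_def)
qed

text \<open>Since the vector-valued integral is computed pointwise, the factor \<open>f z\<close>,
  constant in t, comes out of it.\<close>

lemma integral_op_mult_op:
  assumes W: "cond_W X N (\<lambda>t. mult_op (g t))" and f: "f \<in> X"
  defines "G \<equiv> \<lambda>z. LINT t:{0<..<1}|lborel. g t z"
  shows "integral_op X N (\<lambda>t. mult_op (g t)) f = mult_op G f" "mult_op G f \<in> X"
proof -
  have int: "set_integrable lborel {0<..<1} (\<lambda>t. N (mult_op (g t) f))"
    using W f by (auto simp: cond_W_def)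
  have eq: "(\<lambda>z. LINT t:{0<..<1}|lborel. mult_op (g t) f z) = mult_op G f"
  proof
    fix z
    show "(LINT t:{0<..<1}|lborel. mult_op (g t) f z) = mult_op G f z"
      by (cases "z \<in> disk") (simp_all add: mult_op_def G_def)
  qed
  note B = Bochner_integral[OF cond_W_norm_continuous[OF W f] int, unfolded eq]
  show "mult_op G f \<in> X" by (rule B)
  show "integral_op X N (\<lambda>t. mult_op (g t)) f = mult_op G f"
    using B by (intro integral_op_eqI)
qed

text \<open>The instance of completeness needed for uniform boundedness. For fixed n the blocks P (n
  + m) - P n have norms below the geometric tail, and their pointwise limit in m inherits that
  bound.\<close>

lemma series_in:
  assumes u: "\<And>n. u n \<in> X" "\<And>n. N (u n) \<le> q ^ n" and q: "0 < q" "q < 1"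
  obtains x where "x \<in> X" "\<And>n. N (\<lambda>z. x z - (\<Sum>k<n. u k z)) \<le> q ^ n / (1 - q)"
proof -
  define P where "P n = (\<lambda>z. \<Sum>k<n. u k z)" for n
  define x where "x = (\<lambda>z. \<Sum>k. u k z)"
  have PX: "P n \<in> X" for n unfolding P_def using sum_in u by blast
  have lim: "(\<lambda>n. P n z) \<longlonglongrightarrow> x z" for z
  proof -
    obtain C where C: "C \<ge> 0" "\<And>f. f \<in> X \<Longrightarrow> cmod (f z) \<le> C * N f"
      using bounded_functionalE[OF bounded_functional_eval[of z]] by blast
    have "summable (\<lambda>k. u k z)"
    proof (rule summable_comparison_test')
      show "summable (\<lambda>k. C * q ^ k)" using q by (intro summable_mult summable_geometric) auto
      show "norm (u n z) \<le> C * q ^ n" if "0 \<le> n" for n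
        using order_trans[OF C(2)[OF u(1)] mult_left_mono[OF u(2) C(1)]] .
    qed
    then show ?thesis unfolding P_def x_def by (rule summable_LIMSEQ)
  qed
  have xext: "extensional_disk x"
    using outside[OF u(1)] by (auto simp: extensional_disk_def x_def)
  have tail: "(\<lambda>z. x z - P n z) \<in> X \<and> N (\<lambda>z. x z - P n z) \<le> q ^ n / (1 - q)" for n
  proof -
    have "N (\<lambda>z. P (n + m) z - P n z) \<le> q ^ n / (1 - q)" for m
    proof -
      have "(\<lambda>z. P (n + m) z - P n z) = (\<lambda>z. \<Sum>k<m. u (n + k) z)"
        by (induction m) (auto simp: P_def fun_eq_iff)
      then have "N (\<lambda>z. P (n + m) z - P n z) \<le> (\<Sum>k<m. N (u (n + k)))"
        using sum_in[of m "\<lambda>k. u (n + k)"] u by simp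
      also have "\<dots> \<le> (\<Sum>k<m. q ^ n * q ^ k)"
        using u(2) by (intro sum_mono) (simp flip: power_add)
      also have "\<dots> = q ^ n * ((1 - q ^ m) / (1 - q))"
        using q by (simp add: sum_gp_strict flip: sum_distrib_left)
      also have "\<dots> \<le> q ^ n * (1 / (1 - q))"
        using q by (intro mult_left_mono divide_right_mono) auto
      finally show ?thesis by simp
    qed
    moreover have "(\<lambda>m. P (n + m) z - P n z) \<longlonglongrightarrow> x z - P n z" for z
      using LIMSEQ_ignore_initial_segment[OF lim[of z], of n]
      by (intro tendsto_intros) (simp add: add.commute)
    moreover have "extensional_disk (\<lambda>z. x z - P n z)"
      using xext ext[OF PX] by (simp add: extensional_disk_def)
    ultimately show ?thesis
      using limit_in[OF diff[OF PX PX] _ tendsto_const, of "\<lambda>m. n + m" "\<lambda>m. n" "q ^ n / (1 - q)"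
          "\<lambda>z. x z - P n z"] by blast
  qed
  have "P 0 = (\<lambda>z. 0)" by (simp add: P_def)
  then have "x \<in> X" using conjunct1[OF tail[of 0]] by simp
  then show ?thesis using that[of x] conjunct2[OF tail] unfolding P_def by simp
qed

section \<open>Uniform boundedness for point evaluations\<close>

definition eval_norm :: "complex \<Rightarrow> real" where
  "eval_norm z = (SUP f\<in>{f\<in>X. N f \<le> 1}. cmod (f z))"

lemma eval_norm_bdd: "bdd_above ((\<lambda>f. cmod (f z)) ` {f\<in>X. N f \<le> 1})"
proof -
  obtain C where C: "C \<ge> 0" "\<And>f. f \<in> X \<Longrightarrow> cmod (f z) \<le> C * N f"
    using bounded_functionalE[OF bounded_functional_eval[of z]] by blast
  then have "cmod (f z) \<le> C" if "f \<in> X" "N f \<le> 1" for f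
    using C(2)[OF that(1)] mult_left_mono[OF that(2) C(1)] by simp
  then show ?thesis by (intro bdd_aboveI[of _ C]) auto
qed

lemma N_eq_0:
  assumes "f \<in> X" "N f = 0"
  shows "f z = 0"
  using bounded_functionalE[OF bounded_functional_eval[of z]] assms by (metis mult_zero_right norm_le_zero_iff)

lemma eval_le: "f \<in> X \<Longrightarrow> cmod (f z) \<le> eval_norm z * N f"
proof (cases "N f = 0")
  case True
  then show "f \<in> X \<Longrightarrow> ?thesis" using N_eq_0 by simp
next
  case False
  assume f: "f \<in> X"
  then have pos: "N f > 0" using False N_nonneg[OF f] by simp
  have "cmod (complex_of_real (1 / N f) * f z) \<le> eval_norm z"
    unfolding eval_norm_def
    using pos scale[OF f, of "complex_of_real (1 / N f)"] N_scale[OF f, of "complex_of_real (1 / N f)"]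
    by (intro cSUP_upper2[OF eval_norm_bdd _ order_refl, of "\<lambda>z. complex_of_real (1 / N f) * f z"])
      (auto simp: norm_divide)
  then show ?thesis using pos by (simp add: norm_mult norm_divide field_simps)
qed

lemma eval_norm_pos: "z \<in> disk \<Longrightarrow> eval_norm z > 0"
  using eval_le[OF one_in, of z] N_nonneg[OF one_in]
  by (smt (verit) mult_nonpos_nonneg norm_one)

text \<open>The factor 3/4 exceeds the 1/2 that the gliding hump later loses to the tail of its
  series.\<close>

lemma eval_norm_attained:
  assumes "z \<in> disk"
  obtains u where "u \<in> X" "N u \<le> 1" "3/4 * eval_norm z < cmod (u z)"
proof -
  have "3/4 * eval_norm z < eval_norm z" using eval_norm_pos[OF assms] by simp
  then have "\<exists>u\<in>{f\<in>X. N f \<le> 1}. 3/4 * eval_norm z < cmod (u z)"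
    using zero N_zero unfolding eval_norm_def[of z] 
    by (subst (asm) less_cSUP_iff[OF _ eval_norm_bdd]) (auto intro!: exI[of _ "\<lambda>z. 0"])
  then show ?thesis using that by blast
qed

text \<open>Sokal's gliding hump: with \<open>y = 3\<^sup>-\<^sup>n u\<^sub>n\<close> one of \<open>x + y\<close>, \<open>x - y\<close> is at least as
  large as \<open>y\<close> at the \<open>n\<close>-th point, and the later terms are too small to undo this.\<close>

lemma uniform_boundedness_eval:
  fixes A :: "complex \<Rightarrow> real"
  assumes A: "\<And>z. z \<in> disk \<Longrightarrow> A z \<ge> 0" and bd: "\<And>f. f \<in> X \<Longrightarrow> \<exists>K. \<forall>z\<in>disk. A z * cmod (f z) \<le> K"
  shows "\<exists>K. \<forall>z\<in>disk. A z * eval_norm z \<le> K"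
proof (rule ccontr)
  assume "\<not> ?thesis"
  \<comment> \<open>Growth like \<open>4 ^ n\<close> outweighs the damping \<open>(1/3) ^ n\<close>
    of the n-th summand and leaves \<open>(4/3) ^ n\<close>.\<close>
  then have "\<forall>n. \<exists>z\<in>disk. A z * eval_norm z > 4 ^ n" by (meson not_le)
  then obtain z where z: "\<And>n. z n \<in> disk" "\<And>n. A (z n) * eval_norm (z n) > 4 ^ n" by metis
  have "\<forall>n. \<exists>u. u \<in> X \<and> N u \<le> 1 \<and> 3/4 * eval_norm (z n) < cmod (u (z n))"
    using eval_norm_attained[OF z(1)] by metis
  then obtain u where u: "\<And>n. u n \<in> X" "\<And>n. N (u n) \<le> 1" "\<And>n. 3/4 * eval_norm (z n) < cmod (u n (z n))"
    by metis
  define y where "y n = (\<lambda>w. complex_of_real ((1/3) ^ n) * u n w)" for n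
  define s where "s x n = (if cmod (x (z n) + y n (z n)) \<ge> cmod (y n (z n)) then 1 else - 1 :: complex)"
    for x :: "complex \<Rightarrow> complex" and n
  have s: "cmod (x (z n) + s x n * y n (z n)) \<ge> cmod (y n (z n))" "cmod (s x n) = 1" for x n
  proof -
    have "2 * y n (z n) = (x (z n) + y n (z n)) - (x (z n) - y n (z n))" by simp
    then have "2 * cmod (y n (z n)) \<le> cmod (x (z n) + y n (z n)) + cmod (x (z n) - y n (z n))"
      by (metis norm_triangle_ineq4 norm_mult norm_numeral)
    then show "cmod (x (z n) + s x n * y n (z n)) \<ge> cmod (y n (z n))" by (auto simp: s_def)
  qed (auto simp: s_def)
  \<comment> \<open>The sign of the n-th summand depends on the partial sum already built, hence the
    recursion on functions.\<close>
  define P where "P = rec_nat (\<lambda>w. 0) (\<lambda>n x w. x w + s x n * y n w)"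
  have P0: "P 0 = (\<lambda>w. 0)" and PS: "P (Suc n) = (\<lambda>w. P n w + s (P n) n * y n w)" for n
    by (simp_all add: P_def)
  define d where "d n = (\<lambda>w. s (P n) n * y n w)" for n
  have P: "P n = (\<lambda>w. \<Sum>k<n. d k w)" for n
    by (induction n) (auto simp: P0 PS d_def)
  have yX: "y n \<in> X" "N (y n) \<le> (1/3) ^ n" for n
    using u(1,2)[of n] by (auto simp: y_def scale N_scale norm_power)
  have dX: "d n \<in> X" "N (d n) \<le> (1/3) ^ n" for n
    using yX[of n] s(2) by (auto simp: d_def scale N_scale)
  obtain x where x: "x \<in> X" "\<And>n. N (\<lambda>w. x w - (\<Sum>k<n. d k w)) \<le> (1/3) ^ n / (1 - 1/3)"
    using series_in[of d "1/3", OF dX] by auto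
  have PX: "P n \<in> X" for n unfolding P using sum_in dX by blast
  obtain K where K: "\<And>z. z \<in> disk \<Longrightarrow> A z * cmod (x z) \<le> K" using bd[OF x(1)] by blast
  have "(4/3) ^ n / 4 \<le> K" for n :: nat
  proof -
    let ?E = "eval_norm (z n)"
    have "cmod (x (z n) - P (Suc n) (z n)) \<le> ?E * N (\<lambda>w. x w - P (Suc n) w)"
      by (rule eval_le[OF diff[OF x(1) PX]])
    also have "\<dots> \<le> ?E * ((1/3) ^ n / 2)"
      using x(2)[of "Suc n"] eval_norm_pos[OF z(1)[of n]] by (intro mult_left_mono) (simp_all add: P)
    finally have 1: "cmod (x (z n) - P (Suc n) (z n)) \<le> ?E * ((1/3) ^ n / 2)" .
    have "(1/3) ^ n * (3/4 * ?E) \<le> (1/3) ^ n * cmod (u n (z n))"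
      using u(3)[of n] by (intro mult_left_mono) auto
    also have "\<dots> = cmod (y n (z n))" by (simp add: y_def norm_mult norm_power)
    also have "\<dots> \<le> cmod (P (Suc n) (z n))" using s(1) by (simp add: PS)
    also have "\<dots> \<le> cmod (x (z n)) + cmod (x (z n) - P (Suc n) (z n))"
      by (metis add.commute norm_minus_commute norm_triangle_sub)
    \<comment> \<open>At the n-th point the partial sum is at least 3/4 and the tail at most 1/2 of
      \<open>(1/3) ^ n * ?E\<close>; a quarter survives.\<close>
    finally have "(1/3) ^ n * ?E / 4 \<le> cmod (x (z n))" using 1 by (simp add: algebra_simps)
    then have "A (z n) * ((1/3) ^ n * ?E / 4) \<le> A (z n) * cmod (x (z n))"
      using A z(1) by (intro mult_left_mono) auto
    also have "\<dots> \<le> K" using K z(1) by auto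
    finally have "(1/3) ^ n * (A (z n) * ?E) / 4 \<le> K" by (simp add: mult_ac)
    moreover have "(1/3) ^ n * 4 ^ n \<le> (1/3) ^ n * (A (z n) * ?E)"
      using z(2)[of n] by (intro mult_left_mono) auto
    ultimately show ?thesis by (simp flip: power_mult_distrib)
  qed
  moreover obtain n where "4 * K < (4/3) ^ n" using real_arch_pow[of "4/3" "4*K"] by auto
  ultimately show False by (metis divide_le_eq_numeral1(1) linorder_not_le mult.commute)
qed

text \<open>Condition W is used with the constant function 1, on which \<open>mult_op (g t)\<close>
  returns g t itself.\<close>

lemma set_integrable_multiplier:
  assumes W: "cond_W X N (\<lambda>t. mult_op (g t))" and z: "z \<in> disk"
  shows "set_integrable lborel {0<..<1} (\<lambda>t. g t z)"
proof -
  have "set_integrable lborel {0<..<1} (\<lambda>t. mult_op (g t) (\<lambda>z. if z \<in> disk then 1 else 0) z)"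
    using W one_in by (intro set_integrable_functional[OF cond_W_norm_continuous[OF W one_in] _ bounded_functional_eval])
      (auto simp: cond_W_def)
  then show ?thesis using z by (simp add: mult_op_def)
qed

text \<open>Let I(z) be the integral of \<open>cmod (g t z)\<close>. Integrating
  \<open>cmod (g t z * f z) \<le> eval_norm z * N (mult_op (g t) f)\<close> bounds
  \<open>I z / eval_norm z * cmod (f z)\<close> uniformly in z for each single f, by the integral
  that condition W makes finite. Uniform boundedness with the weight
  \<open>I z / eval_norm z\<close> then bounds I.\<close>

lemma mean_multiplier_bounded:
  assumes W: "cond_W X N (\<lambda>t. mult_op (g t))"
  shows "\<exists>K. \<forall>z\<in>disk. (LINT t:{0<..<1}|lborel. cmod (g t z)) \<le> K"
proof -
  define I where "I z = (LINT t:{0<..<1}|lborel. cmod (g t z))" for z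
  have "\<exists>K. \<forall>z\<in>disk. I z / eval_norm z * eval_norm z \<le> K"
  proof (rule uniform_boundedness_eval)
    fix z assume "z \<in> disk"
    have "I z \<ge> 0" unfolding I_def set_lebesgue_integral_def by (intro integral_nonneg_AE) auto
    then show "0 \<le> I z / eval_norm z" using eval_norm_pos[OF \<open>z \<in> disk\<close>] by simp
  next
    fix f assume f: "f \<in> X"
    have int: "set_integrable lborel {0<..<1} (\<lambda>t. N (mult_op (g t) f))"
      using W f by (auto simp: cond_W_def)
    have "I z / eval_norm z * cmod (f z) \<le> (LINT t:{0<..<1}|lborel. N (mult_op (g t) f))" if z: "z \<in> disk" for z
    proof -
      have "cmod (g t z) * cmod (f z) \<le> eval_norm z * N (mult_op (g t) f)" if "t \<in> {0<..<1}" for t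
      proof -
        have "mult_op (g t) f \<in> X" using W f that by (auto simp: cond_W_def bounded_op_def)
        from eval_le[OF this, of z] show ?thesis using z by (simp add: mult_op_def norm_mult)
      qed
      then have "(LINT t:{0<..<1}|lborel. cmod (g t z) * cmod (f z)) \<le> (LINT t:{0<..<1}|lborel. eval_norm z * N (mult_op (g t) f))"
        using int set_integrable_multiplier[OF W z] by (intro set_integral_mono) (auto intro: set_integrable_norm)
      then show ?thesis using eval_norm_pos[OF z] by (simp add: I_def field_simps)
    qed
    then show "\<exists>K. \<forall>z\<in>disk. I z / eval_norm z * cmod (f z) \<le> K" by blast
  qed
  then obtain K where "\<forall>z\<in>disk. I z / eval_norm z * eval_norm z \<le> K" by blast
  moreover have "I z / eval_norm z * eval_norm z = I z" if "z \<in> disk" for z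
    using eval_norm_pos[OF that] by simp
  ultimately show ?thesis unfolding I_def by metis
qed

end

subsection \<open>Peaking functions and the essential norm of multiplication operators\<close>

text \<open>Elements of X vanish off the open disk, whereas functions of the disk algebra are used
  with their boundary values; this cuts F down to an element of X while F itself keeps those
  values.\<close>

definition restrict_disk :: "(complex \<Rightarrow> complex) \<Rightarrow> complex \<Rightarrow> complex" where
  "restrict_disk F = (\<lambda>z. if z \<in> disk then F z else 0)"

lemma mult_op_restrict_disk: "mult_op g (restrict_disk F) = restrict_disk (\<lambda>z. g z * F z)"
  by (auto simp: mult_op_def restrict_disk_def)

lemma disk_algebra_bounded:
  assumes "disk_algebra g"
  obtains B where "B > 0" "\<And>z. z \<in> cball 0 1 \<Longrightarrow> cmod (g z) \<le> B"
proof -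
  have "bounded (g ` cball 0 1)"
    using assms by (intro compact_imp_bounded compact_continuous_image) (auto simp: disk_algebra_def)
  then show ?thesis using that unfolding bounded_pos by auto
qed

text \<open>The bound passes from the open disk to its closure by continuity, and the maximum
  principle places a point of maximal modulus on the circle.\<close>

lemma disk_algebra_sup_norm:
  assumes g: "disk_algebra g"
  shows "z \<in> cball 0 1 \<Longrightarrow> cmod (g z) \<le> sup_norm g"
    and "\<exists>\<xi>. cmod \<xi> = 1 \<and> cmod (g \<xi>) = sup_norm g"
proof -
  have cont: "continuous_on (cball 0 1) g" and hol: "g holomorphic_on ball 0 1"
    using g by (auto simp: disk_algebra_def disk_def)
  obtain B where "\<And>z. z \<in> cball 0 1 \<Longrightarrow> cmod (g z) \<le> B"
    using disk_algebra_bounded[OF g] by blast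
  then have bdd: "bdd_above ((\<lambda>z. cmod (g z)) ` disk)"
    by (auto simp: disk_def intro!: bdd_aboveI[of _ B])
  show le: "cmod (g z) \<le> sup_norm g" if "z \<in> cball 0 1" for z
  proof (rule continuous_le_on_closure[where S = disk and f = "\<lambda>z. cmod (g z)"])
    show "continuous_on (closure disk) (\<lambda>z. cmod (g z))"
      using cont by (simp add: disk_def continuous_on_norm)
    show "z \<in> closure disk" using that by (simp add: disk_def)
    show "cmod (g x) \<le> sup_norm g" if "x \<in> disk" for x
      unfolding sup_norm_def using that bdd by (intro cSUP_upper)
  qed
  have "continuous_on (sphere 0 1) (\<lambda>z. cmod (g z))"
    by (intro continuous_intros continuous_on_subset[OF cont]) auto
  then obtain \<xi> where \<xi>: "cmod \<xi> = 1" "\<And>z. cmod z = 1 \<Longrightarrow> cmod (g z) \<le> cmod (g \<xi>)"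
    using continuous_attains_sup[of "sphere (0::complex) 1" "\<lambda>z. cmod (g z)"] by auto
  have "cmod (g z) \<le> cmod (g \<xi>)" if "z \<in> ball 0 1" for z
    by (rule maximum_modulus_frontier[of g "ball 0 1"]) (use that \<xi> cont hol in auto)
  then have "sup_norm g \<le> cmod (g \<xi>)"
    unfolding sup_norm_def by (intro cSUP_least) (auto simp: disk_def)
  then show "\<exists>\<xi>. cmod \<xi> = 1 \<and> cmod (g \<xi>) = sup_norm g"
    using \<xi>(1) le[of \<xi>] by (intro exI[of _ \<xi>]) auto
qed

lemma EN_cong:
  assumes "\<And>f. f \<in> X \<Longrightarrow> S f = T f"
  shows "EN X N S = EN X N T"
  unfolding EN_def
proof (rule SUP_cong[OF refl])
  fix fs assume "fs \<in> {fs. (\<forall>n. fs n \<in> X \<and> N (fs n) = 1) \<and> weakly_null X N fs}"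
  then have "S (fs n) = T (fs n)" for n using assms by blast
  then show "limsup (\<lambda>n. ennreal (N (S (fs n)))) = limsup (\<lambda>n. ennreal (N (T (fs n))))" by simp
qed

lemma EN_le:
  assumes "\<And>f. f \<in> X \<Longrightarrow> N f = 1 \<Longrightarrow> N (S f) \<le> B"
  shows "EN X N S \<le> ennreal B"
  unfolding EN_def
proof (rule SUP_least)
  fix fs assume "fs \<in> {fs. (\<forall>n. fs n \<in> X \<and> N (fs n) = 1) \<and> weakly_null X N fs}"
  then have "ennreal (N (S (fs n))) \<le> ennreal B" for n using assms by (blast intro: ennreal_leI)
  then show "limsup (\<lambda>n. ennreal (N (S (fs n)))) \<le> ennreal B" by (intro Limsup_bounded always_eventually) blast
qed

text \<open>\<open>mu_ball\<close> keeps the normalising constants of the peaks from decaying too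
  fast, and \<open>mu_atom\<close> provides balls of small measure around \<xi>. The norm formula is
  stated on the disk algebra, where boundary values come from the continuous extension; peaks, their
  finite combinations and their products with g all stay there.\<close>

locale peaking_disk_space = disk_function_space +
  fixes p :: real and \<mu> :: "complex measure"
  assumes p: "p > 1" and finite_mu: "finite_measure \<mu>" and sets_mu [measurable_cong]: "sets \<mu> = sets borel"
    and mu_atom: "cmod \<xi> = 1 \<Longrightarrow> measure \<mu> {\<xi>} = 0"
    and mu_ball: "cmod \<xi> = 1 \<Longrightarrow> \<delta> > 0 \<Longrightarrow> measure \<mu> (cball 0 1 \<inter> ball \<xi> \<delta>) > 0"
    and norm_formula: "disk_algebra F \<Longrightarrow> N (restrict_disk F) powr p = (LINT z:cball 0 1|\<mu>. cmod (F z) powr p)"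
begin

interpretation mu: finite_measure \<mu> by (rule finite_mu)

lemma restrict_disk_in: "disk_algebra F \<Longrightarrow> restrict_disk F \<in> X"
proof -
  assume F: "disk_algebra F"
  obtain B where "\<And>z. z \<in> cball 0 1 \<Longrightarrow> cmod (F z) \<le> B" using disk_algebra_bounded[OF F] by blast
  then have "mult_op F (\<lambda>z. if z \<in> disk then 1 else 0) \<in> X"
    using multiplier[of F B, OF _ _ one_in] F by (auto simp: disk_algebra_def disk_def)
  then show "restrict_disk F \<in> X" by (simp add: mult_op_def restrict_disk_def if_distrib cong: if_cong)
qed

lemma set_integrable_cont:
  fixes k :: "complex \<Rightarrow> real"
  assumes "continuous_on (cball 0 1) k"
  shows "set_integrable \<mu> (cball 0 1) k"
proof -
  have "bounded (k ` cball 0 1)"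
    using assms by (intro compact_imp_bounded compact_continuous_image) auto
  then obtain B where "\<And>z. z \<in> cball 0 1 \<Longrightarrow> norm (k z) \<le> B" unfolding bounded_iff by blast
  then show ?thesis
    unfolding set_integrable_def using borel_measurable_continuous_on_indicator[OF _ assms]
    by (intro mu.integrable_const_bound[of _ "\<bar>B\<bar>"])
      (auto simp: measurable_cong_sets[OF sets_mu refl] indicator_def intro!: AE_I2 order_trans[OF _ abs_ge_self])
qed

lemma continuous_on_cmod_powr:
  "continuous_on S F \<Longrightarrow> continuous_on S (\<lambda>z. cmod (F z :: complex) powr p)"
  using p by (intro continuous_on_powr' continuous_intros) auto

lemma set_integrable_powr:
  assumes "continuous_on (cball 0 1) F"
  shows "set_integrable \<mu> (cball 0 1) (\<lambda>z. cmod (F z) powr p)"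
  using assms by (intro set_integrable_cont continuous_on_cmod_powr)

lemma set_integral_const: "(LINT z:cball 0 1|\<mu>. c) = measure \<mu> (cball 0 1) * (c::real)"
  unfolding set_lebesgue_integral_def by (simp add: mult.commute)

abbreviation (input) "Lp_power F \<equiv> LINT z:cball 0 1|\<mu>. cmod (F z) powr p"

text \<open>The factor \<open>cnj \<xi>\<close> rotates \<xi> to 1. On the closed disk the modulus
  is at most 1, with equality at \<xi> only.\<close>

definition peak_base :: "complex \<Rightarrow> complex \<Rightarrow> complex" where
  "peak_base \<xi> z = (1 + cnj \<xi> * z) / 2"

definition peak :: "complex \<Rightarrow> nat \<Rightarrow> complex \<Rightarrow> complex" where
  "peak \<xi> n z = peak_base \<xi> z ^ n / N (restrict_disk (\<lambda>z. peak_base \<xi> z ^ n))"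

lemma disk_algebra_peak_base: "disk_algebra (\<lambda>z. peak_base \<xi> z ^ n)"
  unfolding disk_algebra_def peak_base_def by (auto intro!: continuous_intros holomorphic_intros)

lemma disk_algebra_peak: "disk_algebra (peak \<xi> n)"
  using disk_algebra_peak_base[of \<xi> n] unfolding disk_algebra_def peak_def divide_inverse
  by (auto intro!: continuous_intros holomorphic_intros)

lemma norm_rotate_diff:
  assumes "cmod \<xi> = 1"
  shows "cmod (cnj \<xi> * z - 1) = dist z \<xi>"
proof -
  have "\<xi> * cnj \<xi> = 1" using assms by (simp add: complex_norm_square[symmetric])
  then have "z - \<xi> = \<xi> * (cnj \<xi> * z - 1)" by (simp add: algebra_simps)
  then show ?thesis using assms by (simp add: dist_norm norm_mult)
qed

text \<open>The parallelogram identity for 1 and w = \<open>cnj \<xi> * z\<close>: since w has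
  modulus at most 1, the distance of w from 1 is lost in the modulus of 1 + w.\<close>

lemma peak_base_far:
  assumes "cmod \<xi> = 1" "z \<in> cball 0 1" "dist z \<xi> \<ge> \<delta>" "0 \<le> \<delta>"
  shows "(cmod (peak_base \<xi> z))\<^sup>2 \<le> 1 - \<delta>\<^sup>2 / 4"
proof -
  have "(cmod (1 + w))\<^sup>2 + (cmod (w - 1))\<^sup>2 = 2 + 2 * (cmod w)\<^sup>2" for w
    unfolding cmod_power2 by (simp add: power2_eq_square algebra_simps)
  from this[of "cnj \<xi> * z"] have "(cmod (1 + cnj \<xi> * z))\<^sup>2 + (dist z \<xi>)\<^sup>2 \<le> 4"
    using assms norm_rotate_diff[OF assms(1)] by (simp add: norm_mult power_le_one)
  moreover have "\<delta>\<^sup>2 \<le> (dist z \<xi>)\<^sup>2" using assms by (intro power_mono)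
  ultimately show ?thesis by (simp add: peak_base_def norm_divide power_divide)
qed

lemma peak_base_near:
  assumes "cmod \<xi> = 1" "dist z \<xi> < \<eta>"
  shows "1 - \<eta> / 2 \<le> cmod (peak_base \<xi> z)"
proof -
  have "1 = peak_base \<xi> z - (cnj \<xi> * z - 1) / 2" by (simp add: peak_base_def field_simps)
  then have "1 \<le> cmod (peak_base \<xi> z) + cmod ((cnj \<xi> * z - 1) / 2)"
    by (metis norm_one norm_triangle_ineq4)
  then show ?thesis using norm_rotate_diff[OF assms(1)] assms by (simp add: norm_divide)
qed

text \<open>Only the ball of radius \<eta> around \<xi> is kept in the integral; there the base has
  modulus at least 1 - \<eta>/2. The constants thus decay no faster than a geometric sequence with
  ratio as close to 1 as desired.\<close>

lemma N_peak_base_ge: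
  assumes \<xi>: "cmod \<xi> = 1" and \<eta>: "0 < \<eta>" "\<eta> < 2"
  shows "(1 - \<eta> / 2) ^ n * measure \<mu> (cball 0 1 \<inter> ball \<xi> \<eta>) powr (1/p)
           \<le> N (restrict_disk (\<lambda>z. peak_base \<xi> z ^ n))"
proof -
  let ?D = "cball 0 1 :: complex set"
  let ?n = "N (restrict_disk (\<lambda>z. peak_base \<xi> z ^ n))"
  let ?m = "measure \<mu> (?D \<inter> ball \<xi> \<eta>)" and ?r = "(1 - \<eta> / 2) ^ n"
  note da = disk_algebra_peak_base[of \<xi> n]
  have "?r powr p * ?m = (\<integral>z. ?r powr p * indicator (?D \<inter> ball \<xi> \<eta>) z \<partial>\<mu>)" by simp
  also have "\<dots> \<le> Lp_power (\<lambda>z. peak_base \<xi> z ^ n)"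
    unfolding set_lebesgue_integral_def
  proof (rule integral_mono)
    show "integrable \<mu> (\<lambda>z. indicator ?D z *\<^sub>R cmod (peak_base \<xi> z ^ n) powr p)"
      using set_integrable_powr[of "\<lambda>z. peak_base \<xi> z ^ n"] da by (simp add: set_integrable_def disk_algebra_def)
    show "integrable \<mu> (\<lambda>z. ?r powr p * indicator (?D \<inter> ball \<xi> \<eta>) z)"
      by (intro integrable_mult_right integrable_real_indicator) (auto simp: sets_mu mu.emeasure_finite less_top[symmetric])
    show "?r powr p * indicator (?D \<inter> ball \<xi> \<eta>) z \<le> indicator ?D z *\<^sub>R cmod (peak_base \<xi> z ^ n) powr p" for z
      using peak_base_near[OF \<xi>, of z \<eta>] \<eta> p
      by (auto simp: indicator_def dist_commute norm_power intro!: powr_mono2 power_mono)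
  qed
  also have "\<dots> = ?n powr p" using norm_formula[OF da] by simp
  finally have "(?r powr p * ?m) powr (1/p) \<le> (?n powr p) powr (1/p)"
    using p by (intro powr_mono2) auto
  then show ?thesis
    using p \<eta> N_nonneg[OF restrict_disk_in[OF da]] by (simp add: powr_mult powr_powr)
qed

lemma N_peak_base_pos: "cmod \<xi> = 1 \<Longrightarrow> N (restrict_disk (\<lambda>z. peak_base \<xi> z ^ n)) > 0"
proof -
  assume \<xi>: "cmod \<xi> = 1"
  have "0 < measure \<mu> (cball 0 1 \<inter> ball \<xi> 1) powr (1/p)"
    using mu_ball[OF \<xi>, of 1] by simp
  then have "0 < (1 - 1/2) ^ n * measure \<mu> (cball 0 1 \<inter> ball \<xi> 1) powr (1/p)"
    by (intro mult_pos_pos) auto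
  also have "\<dots> \<le> N (restrict_disk (\<lambda>z. peak_base \<xi> z ^ n))"
    using N_peak_base_ge[OF \<xi>, of 1 n] by simp
  finally show ?thesis .
qed

lemma N_peak: "cmod \<xi> = 1 \<Longrightarrow> N (restrict_disk (peak \<xi> n)) = 1"
proof -
  assume \<xi>: "cmod \<xi> = 1"
  let ?c = "N (restrict_disk (\<lambda>z. peak_base \<xi> z ^ n))"
  have "restrict_disk (peak \<xi> n) = (\<lambda>z. (1 / ?c) * restrict_disk (\<lambda>z. peak_base \<xi> z ^ n) z)"
    by (auto simp: restrict_disk_def peak_def)
  then show ?thesis
    using N_peak_base_pos[OF \<xi>, of n] N_scale[OF restrict_disk_in[OF disk_algebra_peak_base[of \<xi> n]], of "1 / ?c"]
    by (simp add: norm_divide)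
qed

lemma integral_peak: "cmod \<xi> = 1 \<Longrightarrow> Lp_power (peak \<xi> n) = 1"
  using norm_formula[OF disk_algebra_peak[of \<xi> n]] N_peak[of \<xi> n] by simp

text \<open>Away from \<xi> the n-th power is at most \<open>\<rho> ^ n\<close>, while its norm is
  at least a constant times \<open>R ^ n\<close> with R larger than \<rho>, so the quotient decays
  geometrically and uniformly.\<close>

lemma peak_far:
  assumes \<xi>: "cmod \<xi> = 1" and "\<delta> > 0"
  obtains s where "s \<longlonglongrightarrow> 0" "\<And>n z. z \<in> cball 0 1 \<Longrightarrow> dist z \<xi> \<ge> \<delta> \<Longrightarrow> cmod (peak \<xi> n z) \<le> s n"
proof -
  \<comment> \<open>The choice \<eta> = d*d/8 gives \<rho>*\<rho> = 1 - 2*\<eta> and R*R = 1 -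
    \<eta> + \<eta>*\<eta>/4, hence \<rho> < R. Capping d at 1 keeps the argument of the square root
    positive.\<close>
  define d where "d = min \<delta> 1"
  define \<rho> where "\<rho> = sqrt (1 - d\<^sup>2 / 4)"
  define \<eta> where "\<eta> = d\<^sup>2 / 8"
  have d: "0 < d" "d \<le> 1" "d \<le> \<delta>" using \<open>\<delta> > 0\<close> by (auto simp: d_def)
  have d2: "0 < d\<^sup>2" "d\<^sup>2 \<le> 1" using d by (auto simp: power_le_one)
  define R where "R = 1 - \<eta> / 2"
  have R: "0 < R" "0 < \<eta>" "\<eta> < 2" "0 \<le> \<rho>" using d2 by (auto simp: R_def \<eta>_def \<rho>_def)
  have "\<rho>\<^sup>2 < R\<^sup>2"
  proof -
    have "\<rho>\<^sup>2 = 1 - 2 * \<eta>" using d2 by (simp add: \<rho>_def \<eta>_def)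
    also have "\<dots> < R\<^sup>2" using R by (simp add: R_def power2_eq_square algebra_simps add_pos_nonneg)
    finally show ?thesis .
  qed
  then have "\<rho> < R" using R by (simp add: power_less_imp_less_base)
  define m where "m = measure \<mu> (cball 0 1 \<inter> ball \<xi> \<eta>) powr (1/p)"
  have "m > 0" unfolding m_def using mu_ball[OF \<xi>, of \<eta>] R by simp
  show ?thesis
  proof (rule that)
    show "(\<lambda>n. (\<rho> / R) ^ n / m) \<longlonglongrightarrow> 0"
      using R \<open>\<rho> < R\<close> by (intro tendsto_divide_zero LIMSEQ_power_zero) auto
    fix n z assume z: "z \<in> cball 0 1" "dist z \<xi> \<ge> \<delta>"
    have "(cmod (peak_base \<xi> z))\<^sup>2 \<le> \<rho>\<^sup>2"
      using peak_base_far[OF \<xi> z(1), of d] z d d2 by (simp add: \<rho>_def)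
    then have "cmod (peak_base \<xi> z) \<le> \<rho>" using R(4) by (rule power2_le_imp_le)
    then have "cmod (peak_base \<xi> z) ^ n \<le> \<rho> ^ n" by (intro power_mono) auto
    moreover have "R ^ n * m \<le> N (restrict_disk (\<lambda>z. peak_base \<xi> z ^ n))"
      using N_peak_base_ge[OF \<xi> R(2,3), of n] by (simp add: R_def m_def)
    ultimately have "cmod (peak_base \<xi> z) ^ n / N (restrict_disk (\<lambda>z. peak_base \<xi> z ^ n)) \<le> \<rho> ^ n / (R ^ n * m)"
      using R \<open>m > 0\<close> by (intro frac_le) auto
    then show "cmod (peak \<xi> n z) \<le> (\<rho> / R) ^ n / m"
      using N_peak_base_pos[OF \<xi>, of n] by (simp add: peak_def norm_divide norm_power power_divide)
  qed
qed

lemma disk_algebra_mult: "disk_algebra F \<Longrightarrow> disk_algebra G \<Longrightarrow> disk_algebra (\<lambda>z. F z * G z)"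
  by (auto simp: disk_algebra_def intro!: continuous_intros holomorphic_intros)

text \<open>Near \<xi> the factor h is small and the peak has p-th power integral 1; elsewhere h is
  bounded and the peaks tend to 0 uniformly.\<close>

lemma peak_concentrates:
  assumes \<xi>: "cmod \<xi> = 1" and h: "disk_algebra h" "h \<xi> = 0"
  shows "(\<lambda>n. N (restrict_disk (\<lambda>z. h z * peak \<xi> n z))) \<longlonglongrightarrow> 0"
proof -
  let ?D = "cball 0 1 :: complex set"
  let ?I = "\<lambda>n. Lp_power (\<lambda>z. h z * peak \<xi> n z)"
  obtain B where B: "B > 0" "\<And>z. z \<in> ?D \<Longrightarrow> cmod (h z) \<le> B" using disk_algebra_bounded[OF h(1)] by blast
  have conth: "continuous_on ?D h" using h(1) by (simp add: disk_algebra_def)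
  have contp: "continuous_on ?D (peak \<xi> n)" for n using disk_algebra_peak by (simp add: disk_algebra_def)
  have Ieq: "?I n = N (restrict_disk (\<lambda>z. h z * peak \<xi> n z)) powr p" for n
    using norm_formula[OF disk_algebra_mult[OF h(1) disk_algebra_peak[of \<xi> n]]] by simp
  have "?I \<longlonglongrightarrow> 0"
  proof (rule LIMSEQ_I)
    fix e :: real assume "e > 0"
    \<comment> \<open>Chosen so that the part near \<xi> contributes at most e/4; the far part is
      eventually below e/2.\<close>
    define \<epsilon> where "\<epsilon> = (e / 4) powr (1/p)"
    have \<epsilon>: "\<epsilon> > 0" "\<epsilon> powr p = e / 4" using \<open>e > 0\<close> p by (auto simp: \<epsilon>_def powr_powr)
    have "\<xi> \<in> ?D" using \<xi> by simp
    then obtain \<delta> where \<delta>: "\<delta> > 0" "\<And>z. z \<in> ?D \<Longrightarrow> dist z \<xi> < \<delta> \<Longrightarrow> dist (h z) (h \<xi>) < \<epsilon>"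
      using conth \<epsilon>(1) unfolding continuous_on_iff by metis
    obtain s where s: "s \<longlonglongrightarrow> 0" "\<And>n z. z \<in> ?D \<Longrightarrow> dist z \<xi> \<ge> \<delta> \<Longrightarrow> cmod (peak \<xi> n z) \<le> s n"
      using peak_far[OF \<xi> \<delta>(1)] by blast
    have "(\<lambda>n. measure \<mu> ?D * (B * \<bar>s n\<bar>) powr p) \<longlonglongrightarrow> measure \<mu> ?D * (B * \<bar>0\<bar>) powr p"
      using p B(1) by (intro tendsto_mult tendsto_const tendsto_powr' tendsto_rabs s(1)) auto
    then have "(\<lambda>n. measure \<mu> ?D * (B * \<bar>s n\<bar>) powr p) \<longlonglongrightarrow> 0" by simp
    then have ev: "\<forall>\<^sub>F n in sequentially. measure \<mu> ?D * (B * \<bar>s n\<bar>) powr p < e / 2"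
      by (rule order_tendstoD) (use \<open>e > 0\<close> in auto)
    have bound: "?I n \<le> e / 4 + measure \<mu> ?D * (B * \<bar>s n\<bar>) powr p" for n
    proof -
      have "?I n \<le> (LINT z:?D|\<mu>. \<epsilon> powr p * cmod (peak \<xi> n z) powr p + (B * \<bar>s n\<bar>) powr p)"
      proof (rule set_integral_mono)
        show "set_integrable \<mu> ?D (\<lambda>z. cmod (h z * peak \<xi> n z) powr p)"
          using conth contp by (intro set_integrable_powr continuous_intros)
        show "set_integrable \<mu> ?D (\<lambda>z. \<epsilon> powr p * cmod (peak \<xi> n z) powr p + (B * \<bar>s n\<bar>) powr p)"
          using contp by (intro set_integrable_cont continuous_on_add continuous_on_mult continuous_on_const continuous_on_cmod_powr)
        fix z assume z: "z \<in> ?D"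
        show "cmod (h z * peak \<xi> n z) powr p \<le> \<epsilon> powr p * cmod (peak \<xi> n z) powr p + (B * \<bar>s n\<bar>) powr p"
        proof (cases "dist z \<xi> < \<delta>")
          case True
          then have "cmod (h z) \<le> \<epsilon>" using \<delta>(2)[OF z] h(2) by simp
          then have "cmod (h z * peak \<xi> n z) powr p \<le> (\<epsilon> * cmod (peak \<xi> n z)) powr p"
            using p by (auto simp: norm_mult intro!: powr_mono2 mult_right_mono)
          also have "\<dots> = \<epsilon> powr p * cmod (peak \<xi> n z) powr p" by (rule powr_mult)
          finally show ?thesis by (rule add_increasing2[rotated]) simp
        next
          case False
          then have "cmod (peak \<xi> n z) \<le> \<bar>s n\<bar>" using s(2)[OF z, of n] by linarith
          then have "cmod (h z * peak \<xi> n z) \<le> B * \<bar>s n\<bar>"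
            unfolding norm_mult using B(1) B(2)[OF z] by (intro mult_mono) auto
          then have "cmod (h z * peak \<xi> n z) powr p \<le> (B * \<bar>s n\<bar>) powr p"
            using p by (intro powr_mono2) auto
          then show ?thesis by (simp add: add_increasing)
        qed
      qed
      also have "\<dots> = \<epsilon> powr p * Lp_power (peak \<xi> n) + (LINT z:?D|\<mu>. (B * \<bar>s n\<bar>) powr p)"
        using contp set_integrable_powr[OF contp, of n] set_integrable_cont[OF continuous_on_const]
        by (subst set_integral_add) auto
      also have "\<dots> = e / 4 + measure \<mu> ?D * (B * \<bar>s n\<bar>) powr p"
        unfolding integral_peak[OF \<xi>] set_integral_const \<epsilon> by simp
      finally show ?thesis .
    qed
    from ev have "\<forall>\<^sub>F n in sequentially. norm (?I n - 0) < e"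
    proof (rule eventually_mono)
      fix n assume n: "measure \<mu> ?D * (B * \<bar>s n\<bar>) powr p < e / 2"
      have "?I n < e" using n bound[of n] \<open>e > 0\<close> by linarith
      then show "norm (?I n - 0) < e" by (simp add: Ieq)
    qed
    then show "\<exists>no. \<forall>n\<ge>no. norm (?I n - 0) < e" by (simp add: eventually_sequentially)
  qed
  then have "(\<lambda>n. ?I n powr (1/p)) \<longlonglongrightarrow> 0 powr (1/p)"
    using p by (intro tendsto_powr' tendsto_const) (auto simp: Ieq)
  moreover have "?I n powr (1/p) = N (restrict_disk (\<lambda>z. h z * peak \<xi> n z))" for n
    using N_nonneg[OF restrict_disk_in[OF disk_algebra_mult[OF h(1) disk_algebra_peak[of \<xi> n]]]] p
    by (simp add: Ieq powr_powr)
  ultimately show ?thesis by simp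
qed

lemma small_ball:
  assumes "cmod \<xi> = 1" "\<epsilon> > 0"
  obtains \<delta> where "\<delta> > 0" "measure \<mu> (ball \<xi> \<delta>) < \<epsilon>"
proof -
  have "(\<lambda>n. measure \<mu> (ball \<xi> (1 / Suc n))) \<longlonglongrightarrow> measure \<mu> (\<Inter>n. ball \<xi> (1 / Suc n))"
  proof (rule mu.finite_Lim_measure_decseq)
    show "decseq (\<lambda>n. ball \<xi> (1 / real (Suc n)))"
      by (intro decseq_SucI subset_ball divide_left_mono) auto
  qed (auto simp: sets_mu)
  moreover have "(\<Inter>n. ball \<xi> (1 / Suc n)) = {\<xi>}"
  proof (intro equalityI subsetI)
    fix z assume z: "z \<in> (\<Inter>n. ball \<xi> (1 / Suc n))"
    show "z \<in> {\<xi>}"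
    proof (rule ccontr)
      assume "z \<notin> {\<xi>}"
      then have "dist \<xi> z > 0" by auto
      then obtain n where "inverse (Suc n) < dist \<xi> z" using reals_Archimedean by blast
      moreover have "dist \<xi> z < 1 / Suc n" using z by auto
      ultimately show False by (simp add: inverse_eq_divide)
    qed
  qed auto
  ultimately have "(\<lambda>n. measure \<mu> (ball \<xi> (1 / Suc n))) \<longlonglongrightarrow> 0" using mu_atom[OF assms(1)] by simp
  then have "\<forall>\<^sub>F n in sequentially. measure \<mu> (ball \<xi> (1 / Suc n)) < \<epsilon>"
    using assms(2) by (auto dest: order_tendstoD)
  then obtain n where "measure \<mu> (ball \<xi> (1 / Suc n)) < \<epsilon>" by (auto simp: eventually_sequentially)
  then show ?thesis using that[of "1 / Suc n"] by simp
qed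

text \<open>In a small ball around \<xi>, convexity with weight 1/2 bounds the integrand by
  \<open>2 powr (p - 1)\<close> times the sum of the two p-th powers; outside it the peak is so
  small that the p-th power of F hardly changes. The excess consists of
  \<open>2 powr (p - 1)\<close> from the peak, 1 from F on the ball and 1 from the outside. It does
  not depend on F, so the estimate can be iterated.\<close>

lemma peak_almost_disjoint:
  assumes \<xi>: "cmod \<xi> = 1" and F: "disk_algebra F"
  shows "\<forall>\<^sub>F n in sequentially. \<forall>c. cmod c = 1 \<longrightarrow>
    Lp_power (\<lambda>z. F z + c * peak \<xi> n z)
      \<le> Lp_power F + (2 powr (p - 1) + 2)"
proof -
  let ?D = "cball 0 1 :: complex set"
  define \<kappa> where "\<kappa> = 2 powr (p - 1)"
  have "\<kappa> > 0" by (simp add: \<kappa>_def)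
  obtain M where M: "M > 0" "\<And>z. z \<in> ?D \<Longrightarrow> cmod (F z) \<le> M" using disk_algebra_bounded[OF F] by blast
  have contF: "continuous_on ?D F" using F by (simp add: disk_algebra_def)
  have contp: "continuous_on ?D (peak \<xi> n)" for n using disk_algebra_peak by (simp add: disk_algebra_def)
  have "\<kappa> * M powr p > 0" using \<open>\<kappa> > 0\<close> M by simp
  then obtain \<delta> where \<delta>: "\<delta> > 0" "measure \<mu> (ball \<xi> \<delta>) < 1 / (\<kappa> * M powr p)"
    using small_ball[OF \<xi>, of "1 / (\<kappa> * M powr p)"] by auto
  obtain s where s: "s \<longlonglongrightarrow> 0" "\<And>n z. z \<in> ?D \<Longrightarrow> dist z \<xi> \<ge> \<delta> \<Longrightarrow> cmod (peak \<xi> n z) \<le> s n"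
    using peak_far[OF \<xi> \<delta>(1)] by blast
  define \<tau> where "\<tau> = 1 / (measure \<mu> ?D + 1)"
  have \<tau>: "\<tau> > 0" "measure \<mu> ?D * \<tau> \<le> 1" by (auto simp: \<tau>_def add_nonneg_pos)
  \<comment> \<open>Outside the ball the perturbed modulus is at most M + s n, and s n is kept below
    1.\<close>
  have "uniformly_continuous_on {0..M + 1} (\<lambda>x::real. x powr p)"
    using p by (intro compact_uniformly_continuous continuous_on_powr' continuous_intros) auto
  then obtain \<gamma> where \<gamma>: "\<gamma> > 0" "\<And>x y. x \<in> {0..M+1} \<Longrightarrow> y \<in> {0..M+1} \<Longrightarrow> dist y x < \<gamma> \<Longrightarrow> dist (y powr p) (x powr p) < \<tau>"
    unfolding uniformly_continuous_on_def using \<tau>(1) by metis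
  have "\<forall>\<^sub>F n in sequentially. s n < min \<gamma> 1"
    using s(1) \<gamma>(1) by (intro order_tendstoD(2)) auto
  then show ?thesis
  proof (rule eventually_mono, intro allI impI)
    fix n c assume n: "s n < min \<gamma> 1" and c: "cmod c = 1"
    have pw: "cmod (F z + c * peak \<xi> n z) powr p \<le>
        (cmod (F z) powr p + \<tau>) + (\<kappa> * M powr p * indicator (ball \<xi> \<delta>) z + \<kappa> * cmod (peak \<xi> n z) powr p)"
      if z: "z \<in> ?D" for z
    proof (cases "dist z \<xi> < \<delta>")
      case True
      have "cmod (F z + c * peak \<xi> n z) powr p \<le> (cmod (F z) + cmod (peak \<xi> n z)) powr p"
        using p c norm_triangle_ineq[of "F z" "c * peak \<xi> n z"] by (intro powr_mono2) (auto simp: norm_mult)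
      also have "\<dots> \<le> (1/2) powr (1 - p) * cmod (F z) powr p + (1/2) powr (1 - p) * cmod (peak \<xi> n z) powr p"
        using powr_add_weighted_le[of p "cmod (F z)" "cmod (peak \<xi> n z)" "1/2"] p by simp
      also have "(1/2) powr (1 - p) = \<kappa>" by (simp add: \<kappa>_def powr_divide powr_diff)
      also have "\<kappa> * cmod (F z) powr p \<le> \<kappa> * M powr p"
        using M(2)[OF z] p \<open>\<kappa> > 0\<close> by (intro mult_left_mono powr_mono2) auto
      finally show ?thesis using True \<tau> by (simp add: dist_commute add_increasing)
    next
      case False
      have "cmod (F z + c * peak \<xi> n z) \<le> cmod (F z) + s n"
        using norm_triangle_ineq[of "F z" "c * peak \<xi> n z"] c s(2)[OF z, of n] False by (simp add: norm_mult)
      moreover have "0 \<le> s n" using s(2)[OF z, of n] False norm_ge_zero order_trans by (metis not_less)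
      ultimately have "cmod (F z + c * peak \<xi> n z) powr p \<le> (cmod (F z) + s n) powr p"
        using p by (intro powr_mono2) auto
      also have "\<dots> \<le> cmod (F z) powr p + \<tau>"
        using \<gamma>(2)[of "cmod (F z)" "cmod (F z) + s n"] M(2)[OF z] n \<open>0 \<le> s n\<close> by (auto simp: dist_real_def)
      finally show ?thesis using \<open>\<kappa> > 0\<close> M by (simp add: add_increasing2)
    qed
    have i1: "set_integrable \<mu> ?D (\<lambda>z. cmod (F z) powr p + \<tau>)"
      using contF by (intro set_integrable_cont continuous_on_add continuous_on_const continuous_on_cmod_powr)
    have i2: "set_integrable \<mu> ?D (\<lambda>z. \<kappa> * M powr p * indicator (ball \<xi> \<delta>) z :: real)"
      unfolding set_integrable_def
      by (rule mu.integrable_const_bound[of _ "\<kappa> * M powr p"])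
        (use \<open>\<kappa> * M powr p > 0\<close> in \<open>auto simp: indicator_def sets_mu measurable_cong_sets[OF sets_mu refl]\<close>)
    have i3: "set_integrable \<mu> ?D (\<lambda>z. \<kappa> * cmod (peak \<xi> n z) powr p)"
      using contp by (intro set_integrable_cont continuous_on_add continuous_on_mult continuous_on_const continuous_on_cmod_powr)
    have i4: "set_integrable \<mu> ?D (\<lambda>z. cmod (F z + c * peak \<xi> n z) powr p)"
      using contp contF by (intro set_integrable_powr continuous_intros)
    have "Lp_power (\<lambda>z. F z + c * peak \<xi> n z) \<le> (LINT z:?D|\<mu>.
        (cmod (F z) powr p + \<tau>) + (\<kappa> * M powr p * indicator (ball \<xi> \<delta>) z + \<kappa> * cmod (peak \<xi> n z) powr p))"
      by (rule set_integral_mono[OF i4 set_integral_add(1)[OF i1 set_integral_add(1)[OF i2 i3]] pw])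
    also have "\<dots> = (LINT z:?D|\<mu>. cmod (F z) powr p + \<tau>) + ((LINT z:?D|\<mu>. \<kappa> * M powr p * indicator (ball \<xi> \<delta>) z)
        + (LINT z:?D|\<mu>. \<kappa> * cmod (peak \<xi> n z) powr p))"
      unfolding set_integral_add(2)[OF i1 set_integral_add(1)[OF i2 i3]] set_integral_add(2)[OF i2 i3] ..
    also have "(LINT z:?D|\<mu>. cmod (F z) powr p + \<tau>) = Lp_power F + measure \<mu> ?D * \<tau>"
      unfolding set_integral_add(2)[OF set_integrable_powr[OF contF] set_integrable_cont[OF continuous_on_const]]
        set_integral_const ..
    also have "(LINT z:?D|\<mu>. \<kappa> * M powr p * indicator (ball \<xi> \<delta>) z) = \<kappa> * M powr p * measure \<mu> (?D \<inter> ball \<xi> \<delta>)"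
    proof -
      have "(LINT z:?D|\<mu>. \<kappa> * M powr p * indicator (ball \<xi> \<delta>) z) = (\<integral>z. \<kappa> * M powr p * indicator (?D \<inter> ball \<xi> \<delta>) z \<partial>\<mu>)"
        unfolding set_lebesgue_integral_def by (intro Bochner_Integration.integral_cong) (auto simp: indicator_def)
      then show ?thesis by simp
    qed
    also have "(LINT z:?D|\<mu>. \<kappa> * cmod (peak \<xi> n z) powr p) = \<kappa>"
      using integral_peak[OF \<xi>, of n] by simp
    also have "\<kappa> * M powr p * measure \<mu> (?D \<inter> ball \<xi> \<delta>) \<le> \<kappa> * M powr p * measure \<mu> (ball \<xi> \<delta>)"
      using \<open>\<kappa> * M powr p > 0\<close> by (intro mult_left_mono mu.finite_measure_mono) (auto simp: sets_mu)
    also have "\<dots> \<le> 1" using \<delta>(2) \<open>\<kappa> * M powr p > 0\<close> by (simp add: field_simps)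
    finally show "Lp_power (\<lambda>z. F z + c * peak \<xi> n z)
      \<le> Lp_power F + (2 powr (p - 1) + 2)"
      using \<tau>(2) by (simp add: \<kappa>_def)
  qed
qed

text \<open>A functional bounded away from 0 on the peaks would grow linearly on suitable sums of \<open>m\<close> of
  them, whereas almost disjointness makes the norm of these sums grow only like \<open>m powr (1/p)\<close>.\<close>

lemma peak_weakly_null:
  assumes \<xi>: "cmod \<xi> = 1"
  shows "weakly_null X N (\<lambda>n. restrict_disk (peak \<xi> n))"
  unfolding weakly_null_def
proof (intro allI impI)
  fix \<phi> assume \<phi>: "bounded_functional X N \<phi>"
  obtain C where C: "C \<ge> 0" "\<And>f. f \<in> X \<Longrightarrow> cmod (\<phi> f) \<le> C * N f"
    using bounded_functionalE[OF \<phi>] by blast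
  define L where "L = 2 powr (p - 1) + 2"
  have "L > 0" by (simp add: L_def add_pos_pos)
  show "(\<lambda>n. \<phi> (restrict_disk (peak \<xi> n))) \<longlonglongrightarrow> 0"
  proof (rule ccontr)
    assume "\<not> ?thesis"
    then obtain \<epsilon> where \<epsilon>: "\<epsilon> > 0" "\<And>k. \<exists>n\<ge>k. cmod (\<phi> (restrict_disk (peak \<xi> n))) \<ge> \<epsilon>"
      unfolding lim_sequentially by (auto simp: not_less)
    \<comment> \<open>P is a sum of m peaks with unimodular coefficients. Each new peak is taken far
      enough along the sequence to be almost disjoint from the sum built before it.\<close>
    have ex: "\<exists>P. disk_algebra P \<and> Lp_power P \<le> L * m \<and>
        Re (\<phi> (restrict_disk P)) \<ge> m * \<epsilon>" for m :: nat
    proof (induction m)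
      case 0
      have "\<phi> (\<lambda>z. 0) = 0" using functional_scale[OF \<phi> zero, of 0] by simp
      then show ?case
        by (intro exI[of _ "\<lambda>z. 0"]) (auto simp: disk_algebra_def restrict_disk_def)
    next
      case (Suc m)
      then obtain P where P: "disk_algebra P" "Lp_power P \<le> L * m"
        "Re (\<phi> (restrict_disk P)) \<ge> m * \<epsilon>" by blast
      obtain k where k: "\<And>n c. n \<ge> k \<Longrightarrow> cmod c = 1 \<Longrightarrow> Lp_power (\<lambda>z. P z + c * peak \<xi> n z)
          \<le> Lp_power P + L"
        using peak_almost_disjoint[OF \<xi> P(1)] unfolding eventually_sequentially L_def by blast
      obtain n where n: "n \<ge> k" "cmod (\<phi> (restrict_disk (peak \<xi> n))) \<ge> \<epsilon>" using \<epsilon>(2) by blast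
      let ?w = "\<phi> (restrict_disk (peak \<xi> n))"
      \<comment> \<open>The coefficient turns the value of \<phi> on the new peak into its modulus,
        so that the real parts add up without cancellation.\<close>
      define c where "c = cnj ?w / cmod ?w"
      have "cmod ?w > 0" using n(2) \<epsilon>(1) by linarith
      then have c: "cmod c = 1" "c * ?w = cmod ?w"
        by (auto simp: c_def norm_divide complex_norm_square[symmetric] power2_eq_square mult.commute)
      define Q where "Q = (\<lambda>z. P z + c * peak \<xi> n z)"
      have "disk_algebra Q" using P(1) disk_algebra_peak[of \<xi> n]
        by (auto simp: Q_def disk_algebra_def intro!: continuous_intros holomorphic_intros)
      moreover have "Lp_power Q \<le> L * Suc m"
        using k[OF n(1) c(1)] P(2) by (simp add: Q_def algebra_simps)
      moreover have "Re (\<phi> (restrict_disk Q)) \<ge> Suc m * \<epsilon>"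
      proof -
        have "restrict_disk Q = (\<lambda>z. 1 * restrict_disk P z + c * restrict_disk (peak \<xi> n) z)"
          by (auto simp: Q_def restrict_disk_def)
        then have "\<phi> (restrict_disk Q) = 1 * \<phi> (restrict_disk P) + c * ?w"
          using functional_lin[OF \<phi> restrict_disk_in[OF P(1)] restrict_disk_in[OF disk_algebra_peak[of \<xi> n]], of 1 c] by simp
        then show ?thesis using P(3) n(2) unfolding c(2) by (simp add: algebra_simps)
      qed
      ultimately show ?case by blast
    qed
    have bound: "m * \<epsilon> \<le> C * (L * m) powr (1/p)" for m :: nat
    proof -
      obtain P where P: "disk_algebra P" "Lp_power P \<le> L * m"
        "Re (\<phi> (restrict_disk P)) \<ge> m * \<epsilon>" using ex by blast
      have "N (restrict_disk P) powr p \<le> L * m" using norm_formula[OF P(1)] P(2) by simp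
      then have "(N (restrict_disk P) powr p) powr (1/p) \<le> (L * m) powr (1/p)"
        using p by (intro powr_mono2) auto
      then have "N (restrict_disk P) \<le> (L * m) powr (1/p)"
        using p N_nonneg[OF restrict_disk_in[OF P(1)]] by (simp add: powr_powr)
      then have "C * N (restrict_disk P) \<le> C * (L * m) powr (1/p)" using C by (intro mult_left_mono)
      then show ?thesis
        using P(3) C(2)[OF restrict_disk_in[OF P(1)]] complex_Re_le_cmod[of "\<phi> (restrict_disk P)"] by linarith
    qed
    \<comment> \<open>The exponent 1/p - 1 is negative exactly because p > 1, so the upper bound per
      summand falls below \<epsilon>.\<close>
    have "(\<lambda>m. C * (L * real m) powr (1/p) / real m) \<longlonglongrightarrow> 0"
    proof -
      have "(\<lambda>m. C * L powr (1/p) * real m powr (1/p - 1)) \<longlonglongrightarrow> C * L powr (1/p) * 0"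
        using p by (intro tendsto_intros tendsto_neg_powr filterlim_real_sequentially) auto
      moreover have "\<forall>\<^sub>F m in sequentially. C * L powr (1/p) * real m powr (1/p - 1) = C * (L * real m) powr (1/p) / real m"
        using eventually_gt_at_top[of 0] by eventually_elim (use \<open>L > 0\<close> in \<open>simp add: powr_mult powr_diff\<close>)
      ultimately show ?thesis by (auto dest: Lim_transform_eventually)
    qed
    then have "\<forall>\<^sub>F m in sequentially. C * (L * real m) powr (1/p) / real m < \<epsilon>"
      using \<epsilon>(1) by (auto dest: order_tendstoD)
    then have "\<forall>\<^sub>F m in sequentially. False"
      using eventually_gt_at_top[of 0]
    proof eventually_elim
      case (elim m)
      then show False using bound[of m] by (simp add: field_simps)
    qed
    then show False by simp
  qed
qed

text \<open>The peaks at \<xi> are asymptotic eigenvectors: g times the peak minus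
  \<open>g \<xi>\<close> times the peak is (g - g \<xi>) times the peak, where the first factor
  vanishes at \<xi>.\<close>

lemma EN_mult_op_ge:
  assumes \<xi>: "cmod \<xi> = 1" and g: "disk_algebra g"
  shows "ennreal (cmod (g \<xi>)) \<le> EN X N (mult_op g)"
proof -
  let ?f = "\<lambda>n. restrict_disk (peak \<xi> n)"
  have dh: "disk_algebra (\<lambda>z. g z - g \<xi>)"
    using g by (auto simp: disk_algebra_def intro!: continuous_intros holomorphic_intros)
  have "(\<lambda>n. N (mult_op g (?f n)) - cmod (g \<xi>)) \<longlonglongrightarrow> 0"
  proof (rule Lim_null_comparison)
    show "(\<lambda>n. N (restrict_disk (\<lambda>z. (g z - g \<xi>) * peak \<xi> n z))) \<longlonglongrightarrow> 0"
      by (rule peak_concentrates[OF \<xi> dh]) simp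
    have "norm (N (mult_op g (?f n)) - cmod (g \<xi>)) \<le> N (restrict_disk (\<lambda>z. (g z - g \<xi>) * peak \<xi> n z))" for n
    proof -
      have fX: "?f n \<in> X" by (rule restrict_disk_in[OF disk_algebra_peak])
      have mX: "mult_op g (?f n) \<in> X"
        unfolding mult_op_restrict_disk by (rule restrict_disk_in[OF disk_algebra_mult[OF g disk_algebra_peak]])
      have "N (\<lambda>z. g \<xi> * ?f n z) = cmod (g \<xi>)" using N_scale[OF fX] N_peak[OF \<xi>] by simp
      moreover have "restrict_disk (\<lambda>z. (g z - g \<xi>) * peak \<xi> n z) = (\<lambda>z. mult_op g (?f n) z - g \<xi> * ?f n z)"
        by (auto simp: mult_op_def restrict_disk_def algebra_simps)
      ultimately show ?thesis using N_diff_abs[OF mX scale[OF fX, of "g \<xi>"]] by simp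
    qed
    then show "\<forall>\<^sub>F n in sequentially. norm (N (mult_op g (?f n)) - cmod (g \<xi>)) \<le> N (restrict_disk (\<lambda>z. (g z - g \<xi>) * peak \<xi> n z))"
      by simp
  qed
  then have "(\<lambda>n. N (mult_op g (?f n))) \<longlonglongrightarrow> cmod (g \<xi>)" by (simp add: LIM_zero_iff)
  then have "(\<lambda>n. ennreal (N (mult_op g (?f n)))) \<longlonglongrightarrow> ennreal (cmod (g \<xi>))" by (rule tendsto_ennrealI)
  then have "limsup (\<lambda>n. ennreal (N (mult_op g (?f n)))) = ennreal (cmod (g \<xi>))"
    by (intro lim_imp_Limsup) auto
  then show ?thesis unfolding EN_def
    using restrict_disk_in[OF disk_algebra_peak] N_peak[OF \<xi>] peak_weakly_null[OF \<xi>]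
    by (intro SUP_upper2[of ?f]) auto
qed

lemma EN_mult_op:
  assumes g: "disk_algebra g"
  shows "EN X N (mult_op g) = ennreal (sup_norm g)"
proof (rule antisym)
  show "EN X N (mult_op g) \<le> ennreal (sup_norm g)"
  proof (rule EN_le)
    fix f assume "f \<in> X" "N f = 1"
    moreover have "N (mult_op g f) \<le> sup_norm g * N f"
    proof (rule conjunct2[OF multiplier])
      show "g holomorphic_on disk" using g by (simp add: disk_algebra_def)
      show "cmod (g z) \<le> sup_norm g" if "z \<in> disk" for z
        using that disk_algebra_sup_norm(1)[OF g, of z] by (simp add: disk_def)
    qed fact
    ultimately show "N (mult_op g f) \<le> sup_norm g" by simp
  qed
  obtain \<xi> where "cmod \<xi> = 1" "cmod (g \<xi>) = sup_norm g" using disk_algebra_sup_norm(2)[OF g] by blast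
  then show "ennreal (sup_norm g) \<le> EN X N (mult_op g)" using EN_mult_op_ge[OF _ g] by metis
qed

end

subsection \<open>The equality case\<close>

text \<open>Radii for reaching the circle from inside; with n + 2 even the first one is
  positive.\<close>

lemma tendsto_radius: "(\<lambda>n. 1 - 1 / real (n + 2)) \<longlonglongrightarrow> 1"
  using tendsto_diff[OF tendsto_const LIMSEQ_ignore_initial_segment[OF lim_1_over_n, of 2], of 1] by simp

context peaking_disk_space
begin

context
  fixes g :: "real \<Rightarrow> complex \<Rightarrow> complex"
  assumes g: "\<And>t. t \<in> {0<..<1} \<Longrightarrow> disk_algebra (g t)"
    and W: "cond_W X N (\<lambda>t. mult_op (g t))"
begin

section \<open>Measurability in t of boundary values and sup norms\<close>

lemma multiplier_continuous: "z \<in> disk \<Longrightarrow> continuous_on {0<..<1} (\<lambda>t. g t z)"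
  using norm_continuous_on_eval[OF cond_W_norm_continuous[OF W one_in], of z]
  by (simp add: mult_op_def)

text \<open>Condition W gives continuity in t at points of the open disk only. Values on the circle
  are pointwise limits of such functions, since each g t is continuous up to the boundary.\<close>

lemma multiplier_measurable:
  assumes "z \<in> cball 0 1"
  shows "(\<lambda>t. indicator {0<..<1} t *\<^sub>R g t z) \<in> borel_measurable borel"
proof (rule borel_measurable_LIMSEQ_metric)
  define r where "r n = complex_of_real (1 - 1 / real (n + 2))" for n
  have r1: "r \<longlonglongrightarrow> 1"
    using tendsto_of_real[OF tendsto_radius, where 'a = complex] by (simp add: r_def[abs_def])
  have rz: "r n * z \<in> disk" for n
  proof -
    have "cmod (r n) < 1" by (simp add: r_def del: of_real_diff)
    then show ?thesis using assms unfolding disk_def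
      by (simp add: norm_mult) (metis le_less_trans mult.right_neutral mult_left_mono norm_ge_zero)
  qed
  show "(\<lambda>t. indicator {0<..<1} t *\<^sub>R g t (r n * z)) \<in> borel_measurable borel" for n
    using borel_measurable_continuous_on_indicator[OF _ multiplier_continuous[OF rz]] by simp
  show "(\<lambda>n. indicator {0<..<1} t *\<^sub>R g t (r n * z)) \<longlonglongrightarrow> indicator {0<..<1} t *\<^sub>R g t z" for t
  proof (cases "t \<in> {0<..<1}")
    case True
    have c: "continuous_on (cball 0 1) (g t)" using g[OF True] by (simp add: disk_algebra_def)
    have l: "(\<lambda>n. r n * z) \<longlonglongrightarrow> z" using tendsto_mult_right[OF r1, of z] by simp
    have "(\<lambda>n. g t (r n * z)) \<longlonglongrightarrow> g t z"
      by (rule continuous_on_tendsto_compose[OF c l assms])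
        (use rz in \<open>auto simp: disk_def intro!: always_eventually less_imp_le\<close>)
    then show ?thesis using True by simp
  qed simp
qed

lemma sup_norm_ge_0: "t \<in> {0<..<1} \<Longrightarrow> sup_norm (g t) \<ge> 0"
  using order_trans[OF norm_ge_zero disk_algebra_sup_norm(1)[OF g, of t 0]] by simp

text \<open>On ]0,1[ the sup norm is a supremum of functions continuous in t, hence lower
  semicontinuous. For a \<ge> 0 the superlevel set is a union of open sets, so an uncountable index
  set does no harm.\<close>

lemma sup_norm_measurable:
  "(\<lambda>t. indicator {0<..<1} t *\<^sub>R sup_norm (g t)) \<in> borel_measurable borel"
  unfolding borel_measurable_iff_greater
proof
  fix a :: real
  let ?s = "\<lambda>t. indicator {0<..<1} t *\<^sub>R sup_norm (g t)"
  show "{w \<in> space borel. a < ?s w} \<in> sets borel"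
  proof (cases "a < 0")
    case True
    have "?s t \<ge> 0" for t using sup_norm_ge_0[of t] by (auto simp: indicator_def)
    then have "{w \<in> space borel. a < ?s w} = UNIV" using True less_le_trans by fastforce
    then show ?thesis by simp
  next
    case False
    have bdd: "bdd_above ((\<lambda>z. cmod (g t z)) ` disk)" if t01: "t \<in> {0<..<1}" for t
    proof -
      obtain B where "\<And>z. z \<in> cball 0 1 \<Longrightarrow> cmod (g t z) \<le> B"
        using disk_algebra_bounded[OF g[OF t01]] by blast
      then show ?thesis by (auto simp: disk_def intro!: bdd_aboveI[of _ B])
    qed
    have "{w \<in> space borel. a < ?s w} = (\<Union>z\<in>disk. {t \<in> {0<..<1}. cmod (g t z) \<in> {a<..}})"
    proof (intro equalityI subsetI)
      fix t assume t: "t \<in> {w \<in> space borel. a < ?s w}"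
      then have t01: "t \<in> {0<..<1}" using False by (cases "t \<in> {0<..<1}") simp_all
      then have "a < sup_norm (g t)" using t by simp
      then obtain z where "z \<in> disk" "a < cmod (g t z)"
        unfolding sup_norm_def using less_cSUP_iff[OF _ bdd[OF t01], of a] by (auto simp: disk_def)
      then show "t \<in> (\<Union>z\<in>disk. {t \<in> {0<..<1}. cmod (g t z) \<in> {a<..}})" using t01 by auto
    next
      fix t assume "t \<in> (\<Union>z\<in>disk. {t \<in> {0<..<1}. cmod (g t z) \<in> {a<..}})"
      then obtain z where z: "z \<in> disk" "t \<in> {0<..<1}" "a < cmod (g t z)" by auto
      then have "cmod (g t z) \<le> sup_norm (g t)"
        using disk_algebra_sup_norm(1)[OF g[OF z(2)], of z] by (simp add: disk_def)
      then show "t \<in> {w \<in> space borel. a < ?s w}" using z by simp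
    qed
    moreover have "open {t \<in> {0<..<1}. cmod (g t z) \<in> {a<..}}" if "z \<in> disk" for z
    proof -
      have "continuous_on {0<..<1} (\<lambda>t. cmod (g t z))"
        by (intro continuous_on_norm multiplier_continuous that)
      then have "open ((\<lambda>t. cmod (g t z)) -` {a<..} \<inter> {0<..<1})"
        using continuous_on_open_vimage[of "{0<..<1::real}" "\<lambda>t. cmod (g t z)"] by simp
      moreover have "(\<lambda>t. cmod (g t z)) -` {a<..} \<inter> {0<..<1} = {t \<in> {0<..<1}. cmod (g t z) \<in> {a<..}}" by auto
      ultimately show ?thesis by simp
    qed
    ultimately show ?thesis by (metis (no_types, lifting) borel_open open_UN)
  qed
qed

abbreviation (input) "EN_integral \<equiv> EN X N (integral_op X N (\<lambda>t. mult_op (g t)))"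
abbreviation (input) "integral_EN \<equiv> \<integral>\<^sup>+ t\<in>{0<..<1}. EN X N (mult_op (g t)) \<partial>lborel"
abbreviation (input) "common_peak \<equiv> \<exists>\<xi> \<theta>. cmod \<xi> = 1 \<and> cmod \<theta> = 1 \<and>
        (AE t in lborel. t \<in> {0<..<1} \<longrightarrow> \<theta> * g t \<xi> = complex_of_real (sup_norm (g t)))"
abbreviation (input) "G \<equiv> \<lambda>z. LINT t:{0<..<1}|lborel. g t z"

lemma EN_integral_op: "EN_integral = EN X N (mult_op G)"
  by (rule EN_cong) (rule integral_op_mult_op(1)[OF W])

text \<open>On the disk, G is the image of the constant 1 under the integral operator, and that
  image lies in X.\<close>

lemma G_holomorphic: "G holomorphic_on disk"
proof -
  have "mult_op G (\<lambda>z. if z \<in> disk then 1 else 0) holomorphic_on disk"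
    by (rule holo[OF integral_op_mult_op(2)[OF W one_in]])
  then show ?thesis by (rule holomorphic_transform) (simp add: mult_op_def)
qed

lemma nn_integral_EN:
  "integral_EN = (\<integral>\<^sup>+ t. ennreal (indicator {0<..<1} t *\<^sub>R sup_norm (g t)) \<partial>lborel)"
  using EN_mult_op[OF g] by (intro nn_integral_cong) (auto simp: indicator_def)

lemma equality_iff_finite:
  assumes fin: "(\<integral>\<^sup>+ t. ennreal (indicator {0<..<1} t *\<^sub>R sup_norm (g t)) \<partial>lborel) < \<infinity>"
  shows "EN_integral = integral_EN
    \<longleftrightarrow> common_peak"
proof -
  let ?s = "\<lambda>t. indicator {0<..<1} t *\<^sub>R sup_norm (g t)"
  have s0: "?s t \<ge> 0" for t using sup_norm_ge_0[of t] by (auto simp: indicator_def)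
  have ints: "integrable lborel ?s"
    using sup_norm_measurable fin s0 by (intro integrableI_nonneg) auto
  have le: "norm (indicator {0<..<1} t *\<^sub>R g t z) \<le> ?s t" if "z \<in> cball 0 1" for t z
    using disk_algebra_sup_norm(1)[OF g that, of t] by (auto simp: indicator_def)
  have intg: "integrable lborel (\<lambda>t. indicator {0<..<1} t *\<^sub>R g t z)" if "z \<in> cball 0 1" for z
    by (rule Bochner_Integration.integrable_bound[OF ints])
      (use multiplier_measurable[OF that] order_trans[OF le[OF that] abs_ge_self] in auto)
  define I where "I = (\<integral>t. ?s t \<partial>lborel)"
  have I0: "I \<ge> 0" unfolding I_def using s0 by (intro integral_nonneg_AE) auto
  have rhs: "integral_EN = ennreal I"
    unfolding nn_integral_EN I_def using ints s0 by (intro nn_integral_eq_integral) auto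
  have Gle: "cmod (G z) \<le> I" if "z \<in> cball 0 1" for z
    unfolding I_def set_lebesgue_integral_def
    by (rule Bochner_Integration.integral_norm_bound_integral[OF intg[OF that] ints le[OF that]])
  \<comment> \<open>Dominated convergence with the sup norms as majorant; this is where their
    integrability is decisive.\<close>
  have "continuous_on (cball 0 1) G"
    unfolding continuous_on_sequentially set_lebesgue_integral_def o_def
  proof (intro allI ballI impI)
    fix x :: "nat \<Rightarrow> complex" and z assume z: "z \<in> cball 0 1" and x: "(\<forall>n. x n \<in> cball 0 1) \<and> x \<longlonglongrightarrow> z"
    show "(\<lambda>n. \<integral>t. indicator {0<..<1} t *\<^sub>R g t (x n) \<partial>lborel) \<longlonglongrightarrow> (\<integral>t. indicator {0<..<1} t *\<^sub>R g t z \<partial>lborel)"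
    proof (rule integral_dominated_convergence[where w = ?s])
      show "(\<lambda>t. indicator {0<..<1} t *\<^sub>R g t z) \<in> borel_measurable lborel"
        "(\<lambda>t. indicator {0<..<1} t *\<^sub>R g t (x n)) \<in> borel_measurable lborel" for n
        using multiplier_measurable x z by auto
      show "AE t in lborel. norm (indicator {0<..<1} t *\<^sub>R g t (x n)) \<le> ?s t" for n
        using le x by (intro AE_I2) blast
      show "AE t in lborel. (\<lambda>n. indicator {0<..<1} t *\<^sub>R g t (x n)) \<longlonglongrightarrow> indicator {0<..<1} t *\<^sub>R g t z"
      proof (rule AE_I2)
        fix t :: real
        show "(\<lambda>n. indicator {0<..<1} t *\<^sub>R g t (x n)) \<longlonglongrightarrow> indicator {0<..<1} t *\<^sub>R g t z"
        proof (cases "t \<in> {0<..<1}")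
          case True
          have c: "continuous_on (cball 0 1) (g t)" using g[OF True] by (simp add: disk_algebra_def)
          have "(\<lambda>n. g t (x n)) \<longlonglongrightarrow> g t z"
            by (rule continuous_on_tendsto_compose[OF c conjunct2[OF x] z]) (use x in auto)
          then show ?thesis using True by simp
        qed simp
      qed
    qed (fact ints)
  qed
  then have G: "disk_algebra G" using G_holomorphic by (simp add: disk_algebra_def)
  have lhs: "EN_integral = ennreal (sup_norm G)"
    unfolding EN_integral_op by (rule EN_mult_op[OF G])
  obtain \<xi>0 where \<xi>0: "cmod \<xi>0 = 1" "cmod (G \<xi>0) = sup_norm G" using disk_algebra_sup_norm(2)[OF G] by blast
  have sle: "sup_norm G \<le> I" using Gle[of \<xi>0] \<xi>0 by simp
  have "sup_norm G \<ge> 0" unfolding \<xi>0(2)[symmetric] by simp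
  then have "EN_integral = integral_EN
      \<longleftrightarrow> sup_norm G = I"
    unfolding lhs rhs using I0 by simp
  also have "\<dots> \<longleftrightarrow> common_peak"
  proof
    assume eq: "sup_norm G = I"
    \<comment> \<open>The unimodular factor that turns \<open>G \<xi>0\<close> into its modulus. If
      \<open>G \<xi>0\<close> is 0, then I = 0 and any such factor serves.\<close>
    define \<theta> where "\<theta> = (if G \<xi>0 = 0 then 1 else cnj (G \<xi>0) / cmod (G \<xi>0))"
    have \<theta>: "cmod \<theta> = 1" "\<theta> * G \<xi>0 = I"
      using \<xi>0(2) eq by (auto simp: \<theta>_def norm_divide power2_eq_square complex_norm_square[symmetric] mult.commute)
    have \<xi>c: "\<xi>0 \<in> cball 0 1" using \<xi>0 by simp
    have int: "integrable lborel (\<lambda>t. Re (\<theta> * (indicator {0<..<1} t *\<^sub>R g t \<xi>0)))"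
      by (intro integrable_Re integrable_mult_right intg[OF \<xi>c])
    have "(\<integral>t. Re (\<theta> * (indicator {0<..<1} t *\<^sub>R g t \<xi>0)) \<partial>lborel) = Re (\<theta> * G \<xi>0)"
      unfolding set_lebesgue_integral_def integral_Re[OF integrable_mult_right[OF intg[OF \<xi>c]]]
        integral_mult_right_zero ..
    then have zero: "(\<integral>t. ?s t - Re (\<theta> * (indicator {0<..<1} t *\<^sub>R g t \<xi>0)) \<partial>lborel) = 0"
      using ints int \<theta>(2) by (simp add: I_def)
    \<comment> \<open>The real part never exceeds the sup norm, while both have the same integral;
      hence they agree almost everywhere.\<close>
    have nonneg: "0 \<le> ?s t - Re (\<theta> * (indicator {0<..<1} t *\<^sub>R g t \<xi>0))" for t
      using le[OF \<xi>c, of t] complex_Re_le_cmod[of "\<theta> * (indicator {0<..<1} t *\<^sub>R g t \<xi>0)"] \<theta>(1)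
      by (simp add: norm_mult)
    have "AE t in lborel. ?s t - Re (\<theta> * (indicator {0<..<1} t *\<^sub>R g t \<xi>0)) = 0"
      using zero nonneg ints int
      by (subst (asm) integral_nonneg_eq_0_iff_AE) auto
    then have "AE t in lborel. t \<in> {0<..<1} \<longrightarrow> \<theta> * g t \<xi>0 = complex_of_real (sup_norm (g t))"
    proof eventually_elim
      case (elim t)
      show ?case
      proof
        assume t: "t \<in> {0<..<1}"
        then have re: "Re (\<theta> * g t \<xi>0) = sup_norm (g t)" using elim by simp
        have "cmod (\<theta> * g t \<xi>0) \<le> sup_norm (g t)"
          using disk_algebra_sup_norm(1)[OF g[OF t] \<xi>c] \<theta>(1) by (simp add: norm_mult)
        \<comment> \<open>A number whose real part already equals the bound on its modulus has no
          imaginary part.\<close>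
        then have "(Im (\<theta> * g t \<xi>0))\<^sup>2 \<le> 0"
          using re cmod_power2[of "\<theta> * g t \<xi>0"] power_mono[of "cmod (\<theta> * g t \<xi>0)" "sup_norm (g t)" 2] by simp
        then show "\<theta> * g t \<xi>0 = complex_of_real (sup_norm (g t))"
          using re by (simp add: complex_eq_iff)
      qed
    qed
    then show common_peak
      using \<xi>0(1) \<theta>(1) by blast
  next
    assume common_peak
    then obtain \<xi> \<theta> where \<xi>: "cmod \<xi> = 1" "cmod \<theta> = 1"
      and ae: "AE t in lborel. t \<in> {0<..<1} \<longrightarrow> \<theta> * g t \<xi> = complex_of_real (sup_norm (g t))" by blast
    have \<xi>c: "\<xi> \<in> cball 0 1" using \<xi> by simp
    have mlb: "(\<lambda>t. indicator {0<..<1} t *\<^sub>R g t \<xi>) \<in> borel_measurable lborel"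
      using multiplier_measurable[OF \<xi>c] by simp
    have mls: "?s \<in> borel_measurable lborel"
      using sup_norm_measurable by simp
    have "\<theta> * G \<xi> = (\<integral>t. \<theta> * (indicator {0<..<1} t *\<^sub>R g t \<xi>) \<partial>lborel)"
      unfolding set_lebesgue_integral_def integral_mult_right_zero ..
    also have "\<dots> = (\<integral>t. complex_of_real (?s t) \<partial>lborel)"
    proof (rule integral_cong_AE)
      show "AE t in lborel. \<theta> * (indicator {0<..<1} t *\<^sub>R g t \<xi>) = complex_of_real (?s t)"
        using ae by eventually_elim (auto simp: indicator_def)
      show "(\<lambda>t. \<theta> * (indicator {0<..<1} t *\<^sub>R g t \<xi>)) \<in> borel_measurable lborel"
        by (intro borel_measurable_times borel_measurable_const mlb)
      show "(\<lambda>t. complex_of_real (?s t)) \<in> borel_measurable lborel"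
        by (rule measurable_compose[OF mls borel_measurable_of_real])
    qed
    also have "\<dots> = complex_of_real I" unfolding I_def by (rule integral_complex_of_real)
    finally have "cmod (\<theta> * G \<xi>) = I" using I0 by simp
    then have "I \<le> sup_norm G" using disk_algebra_sup_norm(1)[OF G \<xi>c] \<xi>(2) by (simp add: norm_mult)
    then show "sup_norm G = I" using sle by simp
  qed
  finally show ?thesis .
qed

text \<open>If the essential norms are not integrable, the uniform boundedness principle still bounds \<open>G\<close>,
  and by Fatou's lemma it also excludes a common peak point.\<close>

lemma equality_iff_infinite:
  assumes inf: "(\<integral>\<^sup>+ t. ennreal (indicator {0<..<1} t *\<^sub>R sup_norm (g t)) \<partial>lborel) = \<infinity>"
  shows "EN_integral \<noteq> integral_EN"
    and "\<not> common_peak"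
proof -
  obtain K where K: "\<And>z. z \<in> disk \<Longrightarrow> (LINT t:{0<..<1}|lborel. cmod (g t z)) \<le> K"
    using mean_multiplier_bounded[OF W] by blast
  have "cmod (G z) \<le> K" if "z \<in> disk" for z
    using K[OF that] set_integral_norm_bound[OF set_integrable_multiplier[OF W that]] by simp
  then have "N (mult_op G f) \<le> K * N f" if "f \<in> X" for f
    using multiplier[OF G_holomorphic _ that, of K] by blast
  then have "EN X N (mult_op G) \<le> ennreal K" using EN_le[of X N "mult_op G" K] by force
  then show "EN_integral \<noteq> integral_EN"
    unfolding nn_integral_EN inf EN_integral_op by (auto simp: top_unique)
  show "\<not> common_peak"
  proof (intro notI, elim exE conjE)
    fix \<xi> \<theta> :: complex
    assume \<xi>: "cmod \<xi> = 1" "cmod \<theta> = 1"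
      and ae: "AE t in lborel. t \<in> {0<..<1} \<longrightarrow> \<theta> * g t \<xi> = complex_of_real (sup_norm (g t))"
    \<comment> \<open>The uniform bound K is known inside the disk, so \<xi> is approached radially.
      Fatou's lemma then carries K over to the integral of the boundary moduli, which under a common
      peak is the infinite integral of the sup norms.\<close>
    define r where "r n = complex_of_real (1 - 1 / real (n + 2)) * \<xi>" for n
    have r1: "r \<longlonglongrightarrow> \<xi>"
      using tendsto_mult_right[OF tendsto_of_real[OF tendsto_radius, where 'a = complex], of \<xi>]
      by (simp add: r_def[abs_def])
    have rd: "r n \<in> disk" for n
      using \<xi> by (simp add: r_def disk_def norm_mult del: of_real_diff)
    have "(\<integral>\<^sup>+ t. ennreal (indicator {0<..<1} t *\<^sub>R sup_norm (g t)) \<partial>lborel)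
        = (\<integral>\<^sup>+ t. liminf (\<lambda>n. ennreal (indicator {0<..<1} t *\<^sub>R cmod (g t (r n)))) \<partial>lborel)"
    proof (rule nn_integral_cong_AE, use ae in eventually_elim)
      case (elim t)
      show ?case
      proof (cases "t \<in> {0<..<1}")
        case True
        have c: "continuous_on (cball 0 1) (g t)" using g[OF True] by (simp add: disk_algebra_def)
        have "(\<lambda>n. g t (r n)) \<longlonglongrightarrow> g t \<xi>"
          by (rule continuous_on_tendsto_compose[OF c r1])
            (use rd \<xi> in \<open>auto simp: disk_def intro!: always_eventually less_imp_le\<close>)
        then have "(\<lambda>n. ennreal (cmod (g t (r n)))) \<longlonglongrightarrow> ennreal (cmod (g t \<xi>))"
          by (intro tendsto_ennrealI tendsto_norm)
        then have "liminf (\<lambda>n. ennreal (cmod (g t (r n)))) = ennreal (cmod (g t \<xi>))"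
          by (intro lim_imp_Liminf) auto
        moreover have "cmod (g t \<xi>) = sup_norm (g t)"
          using arg_cong[OF mp[OF elim True], of cmod] \<xi>(2) sup_norm_ge_0[OF True] by (simp add: norm_mult)
        ultimately show ?thesis using True by simp
      qed (simp add: Liminf_const)
    qed
    also have "\<dots> \<le> liminf (\<lambda>n. \<integral>\<^sup>+ t. ennreal (indicator {0<..<1} t *\<^sub>R cmod (g t (r n))) \<partial>lborel)"
    proof (rule nn_integral_liminf)
      fix n
      have "(\<lambda>t. norm (indicator {0<..<1} t *\<^sub>R g t (r n))) \<in> borel_measurable borel"
        using rd[of n] by (intro measurable_compose[OF multiplier_measurable borel_measurable_norm]) (auto simp: disk_def)
      then show "(\<lambda>t. ennreal (indicator {0<..<1} t *\<^sub>R cmod (g t (r n)))) \<in> borel_measurable lborel"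
        by simp
    qed
    also have "\<dots> \<le> liminf (\<lambda>n. ennreal K)"
    proof (intro Liminf_mono always_eventually allI)
      fix n
      have "integrable lborel (\<lambda>t. indicator {0<..<1} t *\<^sub>R cmod (g t (r n)))"
        using set_integrable_norm[OF set_integrable_multiplier[OF W rd]] by (simp add: set_integrable_def)
      then have "(\<integral>\<^sup>+ t. ennreal (indicator {0<..<1} t *\<^sub>R cmod (g t (r n))) \<partial>lborel)
          = ennreal (LINT t:{0<..<1}|lborel. cmod (g t (r n)))"
        unfolding set_lebesgue_integral_def by (intro nn_integral_eq_integral) auto
      also have "\<dots> \<le> ennreal K" using K[OF rd] by (intro ennreal_leI)
      finally show "(\<integral>\<^sup>+ t. ennreal (indicator {0<..<1} t *\<^sub>R cmod (g t (r n))) \<partial>lborel) \<le> ennreal K" .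
    qed
    also have "\<dots> = ennreal K" by (simp add: Liminf_const)
    finally show False using inf by (simp add: top_unique)
  qed
qed

theorem equality_iff: "EN_integral = integral_EN \<longleftrightarrow> common_peak"
proof (cases "(\<integral>\<^sup>+ t. ennreal (indicator {0<..<1} t *\<^sub>R sup_norm (g t)) \<partial>lborel) = \<infinity>")
  case True
  then show ?thesis using equality_iff_infinite[OF True] by blast
next
  case False
  then show ?thesis by (intro equality_iff_finite) (simp add: less_top)
qed

end

end

subsection \<open>Integral means on circles\<close>

text \<open>The source of \<open>lower_semicont\<close> in both spaces, applied on single circles
  for Hardy spaces and to the weighted area for Bergman spaces.\<close>

lemma Fatou_Lp:
  fixes F :: "nat \<Rightarrow> 'a \<Rightarrow> complex" and p :: real
  assumes p: "p > 0" and [measurable]: "\<And>n. F n \<in> borel_measurable M" "h \<in> borel_measurable M"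
    and int: "\<And>n. integrable M (\<lambda>x. cmod (F n x) powr p)"
    and c: "\<And>n. (\<integral>x. cmod (F n x) powr p \<partial>M) powr (1/p) \<le> c n" "c \<longlonglongrightarrow> C"
    and lim: "AE x in M. (\<lambda>n. F n x) \<longlonglongrightarrow> h x"
  shows "integrable M (\<lambda>x. cmod (h x) powr p)" "(\<integral>x. cmod (h x) powr p \<partial>M) powr (1/p) \<le> C"
proof -
  have c0: "c n \<ge> 0" for n using c(1)[of n] powr_ge_zero order_trans by blast
  then have C0: "C \<ge> 0" using c(2) by (auto intro: LIMSEQ_le_const)
  have *: "(\<integral>\<^sup>+x. ennreal (cmod (h x) powr p) \<partial>M) \<le> ennreal (C powr p)"
  proof -
    have "(\<integral>\<^sup>+x. ennreal (cmod (h x) powr p) \<partial>M) = (\<integral>\<^sup>+x. liminf (\<lambda>n. ennreal (cmod (F n x) powr p)) \<partial>M)"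
    proof (rule nn_integral_cong_AE, use lim in eventually_elim)
      case (elim x)
      then have "(\<lambda>n. ennreal (cmod (F n x) powr p)) \<longlonglongrightarrow> ennreal (cmod (h x) powr p)"
        using p by (intro tendsto_ennrealI tendsto_powr' tendsto_norm tendsto_const) auto
      then show ?case using lim_imp_Liminf[OF trivial_limit_sequentially] by metis
    qed
    also have "\<dots> \<le> liminf (\<lambda>n. \<integral>\<^sup>+x. ennreal (cmod (F n x) powr p) \<partial>M)"
      by (rule nn_integral_liminf) measurable
    also have "\<dots> \<le> liminf (\<lambda>n. ennreal (c n powr p))"
    proof (intro Liminf_mono always_eventually allI)
      fix n
      have "(\<integral>x. cmod (F n x) powr p \<partial>M) = ((\<integral>x. cmod (F n x) powr p \<partial>M) powr (1/p)) powr p"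
        using p by (simp add: powr_powr)
      also have "\<dots> \<le> c n powr p" using c(1)[of n] p by (intro powr_mono2) auto
      finally show "(\<integral>\<^sup>+x. ennreal (cmod (F n x) powr p) \<partial>M) \<le> ennreal (c n powr p)"
        using nn_integral_eq_integral[OF int[of n]] by (simp add: ennreal_leI)
    qed
    also have "\<dots> = ennreal (C powr p)"
    proof -
      have "(\<lambda>n. ennreal (c n powr p)) \<longlonglongrightarrow> ennreal (C powr p)"
        using p c0 by (intro tendsto_ennrealI tendsto_powr' c(2) tendsto_const) auto
      then show ?thesis by (intro lim_imp_Liminf) auto
    qed
    finally show ?thesis .
  qed
  show int_h: "integrable M (\<lambda>x. cmod (h x) powr p)"
    using * by (intro integrableI_nonneg) (auto simp: le_less_trans)
  have "ennreal (\<integral>x. cmod (h x) powr p \<partial>M) \<le> ennreal (C powr p)"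
    using * nn_integral_eq_integral[OF int_h] by simp
  then have "(\<integral>x. cmod (h x) powr p \<partial>M) powr (1/p) \<le> (C powr p) powr (1/p)"
    using p by (intro powr_mono2) (auto simp: ennreal_le_iff)
  then show "(\<integral>x. cmod (h x) powr p \<partial>M) powr (1/p) \<le> C" using C0 p by (simp add: powr_powr)
qed

text \<open>The uniform distribution of the angle. Living on the real line, it serves circles of
  every radius at once; its image under \<open>cis\<close> is normalised arc length. Having total
  mass 1, it makes the mean of the modulus at most the L^p mean.\<close>

definition circle_measure :: "real measure" where
  "circle_measure = density lborel (\<lambda>\<theta>. ennreal (indicator {0..2*pi} \<theta> / (2*pi)))"

lemma sets_circle_measure [measurable_cong, simp]: "sets circle_measure = sets borel"
  by (simp add: circle_measure_def)

lemma space_circle_measure [simp]: "space circle_measure = UNIV"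
  by (simp add: circle_measure_def)

lemma integral_circle_measure:
  fixes w :: "real \<Rightarrow> 'a::{banach, second_countable_topology}"
  assumes "w \<in> borel_measurable borel"
  shows "(\<integral>\<theta>. w \<theta> \<partial>circle_measure) = (LINT \<theta>:{0..2*pi}|lborel. w \<theta>) /\<^sub>R (2*pi)"
proof -
  have "(\<integral>\<theta>. w \<theta> \<partial>circle_measure) = (\<integral>\<theta>. (indicator {0..2*pi} \<theta> / (2*pi)) *\<^sub>R w \<theta> \<partial>lborel)"
    unfolding circle_measure_def using assms by (intro integral_density) auto
  also have "\<dots> = (\<integral>\<theta>. inverse (2*pi) *\<^sub>R (indicator {0..2*pi} \<theta> *\<^sub>R w \<theta>) \<partial>lborel)"
    unfolding scaleR_scaleR by (simp only: divide_inverse mult.commute)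
  also have "\<dots> = inverse (2*pi) *\<^sub>R (\<integral>\<theta>. indicator {0..2*pi} \<theta> *\<^sub>R w \<theta> \<partial>lborel)"
    by (rule integral_scaleR_right)
  finally show ?thesis unfolding set_lebesgue_integral_def .
qed

lemma integral_circle_measure_continuous:
  fixes w :: "real \<Rightarrow> 'a::euclidean_space"
  assumes "continuous_on UNIV w"
  shows "(\<integral>\<theta>. w \<theta> \<partial>circle_measure) = integral {0..2*pi} w /\<^sub>R (2*pi)"
proof -
  have "set_integrable lborel {0..2*pi} w"
    by (intro borel_integrable_atLeastAtMost' continuous_on_subset[OF assms]) auto
  then show ?thesis
    by (simp add: integral_circle_measure borel_measurable_continuous_onI assms set_borel_integral_eq_integral)
qed

lemma emeasure_circle_measure:
  "A \<in> sets borel \<Longrightarrow> emeasure circle_measure A = emeasure lborel (A \<inter> {0..2*pi}) / ennreal (2*pi)"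
proof -
  assume [measurable]: "A \<in> sets borel"
  have "emeasure circle_measure A = (\<integral>\<^sup>+\<theta>. indicator (A \<inter> {0..2*pi}) \<theta> * ennreal (1 / (2*pi)) \<partial>lborel)"
    unfolding circle_measure_def
    by (subst emeasure_density) (auto intro!: nn_integral_cong simp: indicator_def)
  also have "\<dots> = emeasure lborel (A \<inter> {0..2*pi}) * ennreal (1 / (2*pi))"
    by (simp add: nn_integral_multc)
  finally show ?thesis by (simp add: divide_ennreal[symmetric] ennreal_times_divide)
qed

lemma emeasure_circle_measure_space: "emeasure circle_measure UNIV = 1"
  by (simp add: emeasure_circle_measure ennreal_divide_self)

interpretation circle_measure: finite_measure circle_measure
  by standard (simp add: emeasure_circle_measure_space)

lemma measure_circle_measure_space: "measure circle_measure UNIV = 1"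
  by (simp add: measure_def emeasure_circle_measure_space)

lemma integrable_circle_measure:
  fixes w :: "real \<Rightarrow> 'a::euclidean_space"
  assumes "continuous_on UNIV w"
  shows "integrable circle_measure w"
proof -
  have [measurable]: "w \<in> borel_measurable borel" by (rule borel_measurable_continuous_onI[OF assms])
  have "set_integrable lborel {0..2*pi} w"
    by (intro borel_integrable_atLeastAtMost' continuous_on_subset[OF assms]) auto
  then have "integrable lborel (\<lambda>\<theta>. (1 / (2*pi)) *\<^sub>R (indicator {0..2*pi} \<theta> *\<^sub>R w \<theta>))"
    unfolding set_integrable_def by (rule integrable_scaleR_right)
  then show ?thesis unfolding circle_measure_def by (subst integrable_density) auto
qed

lemma continuous_on_circle:
  assumes "f holomorphic_on disk" "cmod z < 1"
  shows "continuous_on UNIV (\<lambda>\<theta>. f (z * cis \<theta>))"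
proof (rule continuous_on_compose2[OF holomorphic_on_imp_continuous_on[OF assms(1)]])
  show "continuous_on UNIV (\<lambda>\<theta>. z * cis \<theta>)" by (intro continuous_intros)
  show "range (\<lambda>\<theta>. z * cis \<theta>) \<subseteq> disk" using assms(2) by (auto simp: disk_def norm_mult)
qed

lemma continuous_on_norm_powr:
  fixes w :: "'a::topological_space \<Rightarrow> complex"
  shows "continuous_on S w \<Longrightarrow> p > 0 \<Longrightarrow> continuous_on S (\<lambda>x. cmod (w x) powr p)"
  by (intro continuous_on_powr' continuous_intros) auto

lemma hp_mean_eq:
  assumes "f holomorphic_on disk" "\<bar>r\<bar> < 1"
  shows "hp_mean p f r = (\<integral>\<theta>. cmod (f (r * cis \<theta>)) powr p \<partial>circle_measure) powr (1/p)"
proof -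
  have "(\<lambda>\<theta>. f (r * cis \<theta>)) \<in> borel_measurable borel"
    using assms by (intro borel_measurable_continuous_onI continuous_on_circle) auto
  then show ?thesis
    unfolding hp_mean_def by (subst integral_circle_measure) (auto simp: field_simps)
qed

lemma integrable_circle_powr:
  assumes "f holomorphic_on disk" "cmod z < 1" "p > 0"
  shows "integrable circle_measure (\<lambda>\<theta>. cmod (f (z * cis \<theta>)) powr p)"
  using assms by (intro integrable_circle_measure continuous_on_norm_powr continuous_on_circle)

lemma circle_mean_le_Lp:
  fixes w :: "real \<Rightarrow> complex"
  assumes "p > 1" "continuous_on UNIV w"
  shows "(\<integral>\<theta>. cmod (w \<theta>) \<partial>circle_measure) \<le> (\<integral>\<theta>. cmod (w \<theta>) powr p \<partial>circle_measure) powr (1/p)"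
proof -
  have [measurable]: "w \<in> borel_measurable borel" by (rule borel_measurable_continuous_onI[OF assms(2)])
  define q where "q = p / (p - 1)"
  have q: "q > 1" "1/p + 1/q = 1" using assms(1) by (auto simp: q_def field_simps)
  have "(\<integral>\<theta>. cmod (w \<theta>) * 1 \<partial>circle_measure) \<le>
      (\<integral>\<theta>. cmod (w \<theta>) powr p \<partial>circle_measure) powr (1/p) * (\<integral>\<theta>. 1 powr q \<partial>circle_measure) powr (1/q)"
    using assms by (intro Holder_inequality q integrable_circle_measure continuous_on_norm_powr) auto
  then show ?thesis by (simp add: measure_circle_measure_space)
qed

text \<open>Cauchy's formula on the circle of radius R, whose points have distance at least R -
  \<open>cmod z\<close> from z.\<close>

lemma eval_le_circle_mean:
  assumes f: "f holomorphic_on disk" and z: "cmod z < R" "R < 1"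
  shows "cmod (f z) \<le> R / (R - cmod z) * (\<integral>\<theta>. cmod (f (R * cis \<theta>)) \<partial>circle_measure)"
proof -
  have "R > 0" using z norm_ge_zero[of z] by linarith
  have sub: "cball 0 R \<subseteq> disk" using z by (auto simp: disk_def)
  have cont: "continuous_on UNIV (\<lambda>\<theta>. f (R * cis \<theta>))"
    using z \<open>R > 0\<close> by (intro continuous_on_circle f) auto
  have "((\<lambda>u. f u / (u - z)) has_contour_integral (2 * of_real pi * \<i> * f z)) (circlepath 0 R)"
    using z by (intro Cauchy_integral_circlepath_simple holomorphic_on_subset[OF f sub]) auto
  then have hi: "((\<lambda>t. f (R * cis t) / (R * cis t - z) * R * \<i> * cis t) has_integral (2 * of_real pi * \<i> * f z)) {0..2*pi}"
    unfolding circlepath_def by (simp add: has_contour_integral_part_circlepath_iff)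
  have cint: "(\<lambda>t. R / (R - cmod z) * cmod (f (R * cis t))) integrable_on {0..2*pi}"
    by (intro integrable_continuous_real continuous_intros continuous_on_subset[OF cont]) auto
  have "cmod (2 * of_real pi * \<i> * f z) \<le> integral {0..2*pi} (\<lambda>t. R / (R - cmod z) * cmod (f (R * cis t)))"
    unfolding integral_unique[OF hi, symmetric]
  proof (rule Henstock_Kurzweil_Integration.integral_norm_bound_integral)
    fix t :: real
    have "R = cmod (R * cis t)" using \<open>R > 0\<close> by (simp add: norm_mult)
    then have "R - cmod z \<le> cmod (R * cis t - z)" by (metis norm_triangle_ineq2)
    then have "cmod (f (R * cis t)) * R / cmod (R * cis t - z) \<le> cmod (f (R * cis t)) * R / (R - cmod z)"
      using z \<open>R > 0\<close> by (intro divide_left_mono mult_nonneg_nonneg) (auto intro!: mult_pos_pos)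
    then show "cmod (f (R * cis t) / (R * cis t - z) * R * \<i> * cis t) \<le> R / (R - cmod z) * cmod (f (R * cis t))"
      using \<open>R > 0\<close> by (simp add: norm_mult norm_divide mult.commute)
  qed (use hi cint in auto)
  also have "\<dots> = 2 * pi * (R / (R - cmod z) * (\<integral>\<theta>. cmod (f (R * cis \<theta>)) \<partial>circle_measure))"
    using integral_circle_measure_continuous[OF continuous_on_norm[OF cont]] by (simp add: field_simps)
  finally have "2 * pi * cmod (f z) \<le> 2 * pi * (R / (R - cmod z) * (\<integral>\<theta>. cmod (f (R * cis \<theta>)) \<partial>circle_measure))"
    by (simp add: norm_mult)
  then show ?thesis by (rule mult_left_le_imp_le) simp
qed

lemma eval_le_hp_mean:
  assumes "p > 1" "f holomorphic_on disk" "cmod z < R" "R < 1"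
  shows "cmod (f z) \<le> R / (R - cmod z) * hp_mean p f R"
proof -
  have "R > 0" using assms norm_ge_zero[of z] by linarith
  have "cmod (f z) \<le> R / (R - cmod z) * (\<integral>\<theta>. cmod (f (R * cis \<theta>)) \<partial>circle_measure)"
    by (rule eval_le_circle_mean[OF assms(2-4)])
  also have "\<dots> \<le> R / (R - cmod z) * hp_mean p f R"
    unfolding hp_mean_eq[OF assms(2)] using assms \<open>R > 0\<close>
    by (intro mult_left_mono) (subst hp_mean_eq, auto intro!: circle_mean_le_Lp continuous_on_circle)
  finally show ?thesis .
qed

text \<open>The integrand is periodic in the angle. After reducing the shift modulo 2 pi, the
  shifted interval is cut at 2 pi and the piece beyond it is moved back to the start.\<close>

lemma circle_measure_rotate:
  fixes w :: "complex \<Rightarrow> real"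
  assumes cont: "continuous_on (sphere 0 r) w" and "r \<ge> 0"
  shows "(\<integral>\<theta>. w (r * cis (\<theta> + \<alpha>)) \<partial>circle_measure) = (\<integral>\<theta>. w (r * cis \<theta>) \<partial>circle_measure)"
proof -
  define v where "v \<theta> = w (r * cis \<theta>)" for \<theta>
  have v: "continuous_on UNIV v"
    unfolding v_def
    by (rule continuous_on_compose2[OF cont]) (use \<open>r \<ge> 0\<close> in \<open>auto simp: norm_mult intro!: continuous_intros\<close>)
  have per: "v (\<theta> + 2 * pi * of_int k) = v \<theta>" for \<theta> k
    unfolding v_def by (simp add: cis_mult[symmetric] cis_multiple_2pi)
  have int: "v integrable_on {a..b}" for a b
    by (intro integrable_continuous_real continuous_on_subset[OF v]) auto
  have shift: "integral {a..b} (\<lambda>\<theta>. v (\<theta> + c)) = integral {a + c..b + c} v" for a b c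
    using integral_shift_Icc_real[of a b v c] by (simp add: o_def add.commute)
  \<comment> \<open>The number of full turns in the shift; what remains lies in [0, 2 pi].\<close>
  define k where "k = \<lfloor>\<alpha> / (2*pi)\<rfloor>"
  define \<beta> where "\<beta> = \<alpha> - 2 * pi * of_int k"
  have \<beta>: "0 \<le> \<beta>" "\<beta> \<le> 2 * pi"
  proof -
    have "of_int k \<le> \<alpha> / (2*pi)" "\<alpha> / (2*pi) < of_int k + 1" unfolding k_def by linarith+
    then have "of_int k * (2*pi) \<le> \<alpha>" "\<alpha> < (of_int k + 1) * (2*pi)"
      by (auto simp: pos_le_divide_eq pos_divide_less_eq)
    then show "0 \<le> \<beta>" "\<beta> \<le> 2 * pi" by (auto simp: \<beta>_def algebra_simps)
  qed
  have "integral {0..2*pi} (\<lambda>\<theta>. v (\<theta> + \<alpha>)) = integral {0..2*pi} (\<lambda>\<theta>. v (\<theta> + \<beta>))"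
    using per[of "\<theta> + \<beta>" k for \<theta>] by (simp add: \<beta>_def algebra_simps)
  also have "\<dots> = integral {\<beta>..2*pi + \<beta>} v" using shift[of 0 "2*pi" \<beta>] by simp
  also have "\<dots> = integral {\<beta>..2*pi} v + integral {2*pi..2*pi + \<beta>} v"
    using \<beta> int by (intro Henstock_Kurzweil_Integration.integral_combine[symmetric]) auto
  also have "integral {2*pi..2*pi + \<beta>} v = integral {0..\<beta>} v"
    using shift[of 0 \<beta> "2*pi"] per[of _ 1] by (simp add: add.commute)
  also have "integral {\<beta>..2*pi} v + integral {0..\<beta>} v = integral {0..2*pi} v"
    using \<beta> int Henstock_Kurzweil_Integration.integral_combine[of 0 \<beta> "2*pi" v] by simp
  finally have "integral {0..2*pi} (\<lambda>\<theta>. v (\<theta> + \<alpha>)) = integral {0..2*pi} v" .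
  moreover have "continuous_on UNIV (\<lambda>\<theta>. v (\<theta> + \<alpha>))"
    by (intro continuous_on_compose2[OF v] continuous_intros) auto
  ultimately show ?thesis using integral_circle_measure_continuous v unfolding v_def by metis
qed

lemma hp_mean_rotate:
  assumes "f holomorphic_on disk" "cmod z < 1" "p > 0"
  shows "(\<integral>\<theta>. cmod (f (z * cis \<theta>)) powr p \<partial>circle_measure) powr (1/p) = hp_mean p f (cmod z)"
proof -
  have "z * cis \<theta> = cmod z * cis (\<theta> + Arg z)" for \<theta>
    by (simp add: cis_mult[symmetric] Arg_eq[of z] mult.assoc) (metis Arg_eq cis_conv_exp mult.commute mult.left_commute mult_zero_left norm_zero of_real_0)
  moreover have "continuous_on (sphere 0 (cmod z)) (\<lambda>z. cmod (f z) powr p)"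
    using assms by (intro continuous_on_norm_powr continuous_on_subset[OF holomorphic_on_imp_continuous_on]) (auto simp: disk_def)
  ultimately show ?thesis
    using circle_measure_rotate[of "cmod z" "\<lambda>z. cmod (f z) powr p" "Arg z"] hp_mean_eq[OF assms(1), of "cmod z" p] assms
    by simp
qed

text \<open>The pointwise form of the norming functional of L^p: its product with w is the p-th
  power of the modulus, and its own modulus is the (p - 1)-st power, so it maps L^p into the L^q of
  the conjugate exponent. At w = 0 the value is 0.\<close>

definition dual_power :: "real \<Rightarrow> complex \<Rightarrow> complex" where
  "dual_power p w = complex_of_real (cmod w powr (p - 2)) * cnj w"

lemma dual_power_mult: "w * dual_power p w = complex_of_real (cmod w powr p)"
proof (cases "w = 0")
  case False
  have "w * dual_power p w = complex_of_real (cmod w powr (p - 2)) * (w * cnj w)"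
    by (simp add: dual_power_def mult_ac)
  also have "\<dots> = complex_of_real (cmod w powr (p - 2) * (cmod w)\<^sup>2)"
    using complex_norm_square[of w] by simp
  also have "cmod w powr (p - 2) * (cmod w)\<^sup>2 = cmod w powr p"
    using False powr_add[of "cmod w" "p - 2" 2] by simp
  finally show ?thesis .
qed (simp add: dual_power_def)

lemma norm_dual_power: "cmod (dual_power p w) = cmod w powr (p - 1)"
proof (cases "w = 0")
  case False
  then show ?thesis using powr_add[of "cmod w" "p - 2" 1] by (simp add: dual_power_def norm_mult)
qed (simp add: dual_power_def)

text \<open>For p < 2 the first factor is unbounded near 0, so continuity there is read off from the
  modulus of the whole product, a positive power of the modulus of w.\<close>

lemma continuous_dual_power:
  assumes "p > 1"
  shows "continuous_on UNIV (dual_power p)"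
  unfolding continuous_on_eq_continuous_at[OF open_UNIV]
proof
  fix w :: complex
  show "isCont (dual_power p) w"
  proof (cases "w = 0")
    case True
    have "((\<lambda>w. cmod w powr (p - 1)) \<longlongrightarrow> cmod 0 powr (p - 1)) (at 0)"
      using assms by (intro tendsto_powr' tendsto_norm tendsto_const tendsto_ident_at) auto
    then have "(dual_power p \<longlongrightarrow> 0) (at 0)"
      using tendsto_norm_zero_cancel[of "dual_power p" "at 0"] by (simp add: norm_dual_power)
    then show ?thesis using True by (simp add: isCont_def dual_power_def)
  next
    case False
    then show ?thesis unfolding dual_power_def
      by (intro continuous_mult isCont_of_real continuous_at_within_powr continuous_norm continuous_ident continuous_const isCont_cnj) auto
  qed
qed

text \<open>The maximum principle for \<open>z \<mapsto> \<integral> f(z cis \<theta>) k(\<theta>)\<close>, where \<open>k\<close> is the norming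
  functional of \<open>f(r cis \<theta>)\<close> in the dual of \<open>L\<^sup>p\<close>, replaces the subharmonicity of \<open>|f| powr p\<close>.\<close>

lemma hp_mean_mono:
  assumes p: "p > 1" and f: "f holomorphic_on disk" and r: "0 \<le> r" "r \<le> R" "R < 1"
  shows "hp_mean p f r \<le> hp_mean p f R"
proof (cases "r = R")
  case False
  then have "r < R" "R > 0" using r by auto
  define k where "k \<theta> = dual_power p (f (r * cis \<theta>))" for \<theta>
  have fr: "continuous_on UNIV (\<lambda>\<theta>. f (r * cis \<theta>))" using r by (intro continuous_on_circle f) auto
  have k: "continuous_on UNIV k"
    unfolding k_def by (rule continuous_on_compose2[OF continuous_dual_power[OF p] fr]) auto
  define q where "q = p / (p - 1)"
  have q: "q > 1" "1/p + 1/q = 1" "(p - 1) * q = p" using p by (auto simp: q_def field_simps)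
  define A where "A = hp_mean p f r"
  have "A \<ge> 0" by (simp add: A_def hp_mean_def)
  have Ap: "(\<integral>\<theta>. cmod (f (r * cis \<theta>)) powr p \<partial>circle_measure) = A powr p"
    using hp_mean_eq[OF f, of r p] r p by (simp add: A_def powr_powr)
  define F where "F z = integral {0..2*pi} (\<lambda>\<theta>. f (z * cis \<theta>) * k \<theta>)" for z
  have contz: "continuous_on UNIV (\<lambda>\<theta>. f (z * cis \<theta>) * k \<theta>)" if "cmod z < 1" for z
    by (intro continuous_on_mult continuous_on_circle f that k)
  have FH: "F holomorphic_on disk"
    \<comment> \<open>Differentiation under the integral sign; k depends on the angle alone.\<close>
    unfolding F_def cbox_interval[symmetric]
  proof (rule leibniz_rule_holomorphic)
    fix z t assume z: "z \<in> disk"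
    then have zt: "z * cis t \<in> disk" by (simp add: disk_def norm_mult)
    have "(f has_field_derivative deriv f (z * cis t)) (at (z * cis t))"
      using holomorphic_derivI[OF f _ zt] by (simp add: disk_def)
    then have "((\<lambda>z. f (z * cis t) * k t) has_field_derivative deriv f (z * cis t) * cis t * k t) (at z)"
      by (auto intro!: derivative_eq_intros DERIV_chain2[of f])
    then show "((\<lambda>z. f (z * cis t) * k t) has_field_derivative deriv f (z * cis t) * cis t * k t) (at z within disk)"
      by (rule has_field_derivative_at_within)
  next
    fix z assume "z \<in> disk"
    then have "cmod z < 1" by (simp add: disk_def)
    then show "(\<lambda>\<theta>. f (z * cis \<theta>) * k \<theta>) integrable_on cbox 0 (2 * pi)"
      by (rule integrable_continuous[OF continuous_on_subset[OF contz subset_UNIV]])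
  next
    have d: "continuous_on disk (deriv f)"
      by (intro holomorphic_on_imp_continuous_on holomorphic_deriv f) (simp add: disk_def)
    have "continuous_on (disk \<times> cbox 0 (2 * pi)) (\<lambda>x. deriv f (fst x * cis (snd x)) * cis (snd x) * k (snd x))"
      by (intro continuous_intros continuous_on_compose2[OF d] continuous_on_compose2[OF k])
        (auto simp: disk_def norm_mult)
    then show "continuous_on (disk \<times> cbox 0 (2 * pi)) (\<lambda>(z, t). deriv f (z * cis t) * cis t * k t)"
      by (simp add: case_prod_beta')
  qed (simp add: disk_def)
  \<comment> \<open>Hoelder's inequality on the larger circle: by rotation invariance the L^p factor
    is \<open>hp_mean p f R\<close> at every z of modulus R, and the q-norm of k is
    \<open>A powr (p - 1)\<close>.\<close>
  have bound: "cmod (F z) \<le> 2 * pi * (hp_mean p f R * A powr (p - 1))" if z: "cmod z = R" for z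
  proof -
    have z1: "cmod z < 1" using z r by simp
    have fz: "continuous_on UNIV (\<lambda>\<theta>. f (z * cis \<theta>))" by (intro continuous_on_circle f z1)
    have [measurable]: "(\<lambda>\<theta>. f (z * cis \<theta>)) \<in> borel_measurable borel" "k \<in> borel_measurable borel"
      by (intro borel_measurable_continuous_onI fz k)+
    have kq: "cmod (k \<theta>) powr q = cmod (f (r * cis \<theta>)) powr p" for \<theta>
      using q(3) by (simp add: k_def norm_dual_power powr_powr)
    have "cmod (F z / (2 * pi)) = cmod (\<integral>\<theta>. f (z * cis \<theta>) * k \<theta> \<partial>circle_measure)"
      by (subst integral_circle_measure_continuous[OF contz[OF z1]])
        (simp add: F_def norm_divide field_simps)
    also have "\<dots> \<le> (\<integral>\<theta>. cmod (f (z * cis \<theta>) * k \<theta>) \<partial>circle_measure)" by (rule integral_norm_bound)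
    also have "\<dots> = (\<integral>\<theta>. cmod (f (z * cis \<theta>)) * cmod (k \<theta>) \<partial>circle_measure)" by (simp add: norm_mult)
    also have "\<dots> \<le> (\<integral>\<theta>. cmod (f (z * cis \<theta>)) powr p \<partial>circle_measure) powr (1/p) * (\<integral>\<theta>. cmod (k \<theta>) powr q \<partial>circle_measure) powr (1/q)"
      using p q fz k by (intro Holder_inequality integrable_circle_measure continuous_on_norm_powr) auto
    also have "\<dots> = hp_mean p f R * A powr (p - 1)"
      unfolding kq Ap using hp_mean_rotate[OF f z1, of p] p z by (simp add: powr_powr q_def)
    finally show ?thesis by (simp add: norm_divide field_simps)
  qed
  have "cmod (F r) \<le> 2 * pi * (hp_mean p f R * A powr (p - 1))"
  proof (rule maximum_modulus_frontier[of F "ball 0 R"])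
    have sub: "cball 0 R \<subseteq> disk" "ball 0 R \<subseteq> disk" using r by (auto simp: disk_def)
    show "F holomorphic_on interior (ball 0 R)" using holomorphic_on_subset[OF FH sub(2)] by simp
    show "continuous_on (closure (ball 0 R)) F"
      using holomorphic_on_imp_continuous_on[OF holomorphic_on_subset[OF FH sub(1)]] \<open>R > 0\<close> by simp
    show "cmod (F z) \<le> 2 * pi * (hp_mean p f R * A powr (p - 1))" if "z \<in> frontier (ball 0 R)" for z
      using bound[of z] that \<open>R > 0\<close> by simp
  qed (use r \<open>r < R\<close> in auto)
  \<comment> \<open>At the point r the functional norms f: the integrand is the p-th power of the
    modulus. Comparison with the bound leaves a common factor \<open>A powr (p - 1)\<close> to
    cancel.\<close>
  moreover have "F r = complex_of_real (2 * pi * A powr p)"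
  proof -
    have "F r = integral {0..2*pi} (\<lambda>\<theta>. complex_of_real (cmod (f (r * cis \<theta>)) powr p))"
      unfolding F_def k_def dual_power_mult ..
    also have "\<dots> = complex_of_real (integral {0..2*pi} (\<lambda>\<theta>. cmod (f (r * cis \<theta>)) powr p))"
      using p by (intro integral_unique has_integral_of_real integrable_integral integrable_continuous_real
        continuous_on_norm_powr continuous_on_subset[OF fr]) auto
    also have "integral {0..2*pi} (\<lambda>\<theta>. cmod (f (r * cis \<theta>)) powr p) = 2 * pi * A powr p"
      unfolding Ap[symmetric] using p fr
      by (subst integral_circle_measure_continuous) (auto intro!: continuous_on_norm_powr)
    finally show ?thesis .
  qed
  ultimately have "2 * pi * A powr p \<le> 2 * pi * (hp_mean p f R * A powr (p - 1))"
    by (simp add: norm_mult)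
  then have le: "A powr p \<le> hp_mean p f R * A powr (p - 1)"
    by (rule mult_left_le_imp_le) simp
  show ?thesis
  proof (cases "A = 0")
    case True
    then show ?thesis by (simp add: A_def[symmetric]) (simp add: hp_mean_def)
  next
    case False
    then have "A powr (p - 1) > 0" "A powr p = A * A powr (p - 1)"
      using \<open>A \<ge> 0\<close> powr_add[of A 1 "p - 1"] by auto
    then show ?thesis using le by (simp add: A_def[symmetric])
  qed
qed simp

subsection \<open>Hardy spaces\<close>

lemma measurable_circle_measure [simp]: "measurable circle_measure M = measurable borel M"
  by (rule measurable_cong_sets) simp_all

lemma hp_mean_nonneg: "hp_mean p f r \<ge> 0"
  by (simp add: hp_mean_def)

lemma hp_mean_tendsto:
  assumes p: "p > 1" and f: "f holomorphic_on disk" and B: "\<And>r. 0 < r \<Longrightarrow> r < 1 \<Longrightarrow> hp_mean p f r \<le> B"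
  shows "\<exists>L. (hp_mean p f \<longlongrightarrow> L) (at_left 1)"
proof -
  \<comment> \<open>Monotonicity is known for nonnegative radii, so the one-sided limit is taken
    within ]0,1[, which gives the same filter.\<close>
  have "(hp_mean p f \<longlongrightarrow> Sup (hp_mean p f ` ({..<1} \<inter> {0<..}))) (at 1 within ({..<1} \<inter> {0<..}))"
    using B hp_mean_mono[OF p f] by (intro Lim_left_bound) auto
  moreover have "at 1 within ({..<1} \<inter> {0<..}) = at_left (1::real)"
    by (rule at_within_nhd[of _ "{0<..}"]) auto
  ultimately show ?thesis by auto
qed

context
  fixes p :: real
  assumes p: "p > 1"
begin

lemma Hardy_space_holo: "f \<in> Hardy_space p \<Longrightarrow> f holomorphic_on disk"
  and Hardy_space_ext: "f \<in> Hardy_space p \<Longrightarrow> extensional_disk f"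
  by (auto simp: Hardy_space_def)

lemma Hardy_norm_tendsto: "f \<in> Hardy_space p \<Longrightarrow> (hp_mean p f \<longlongrightarrow> Hardy_norm p f) (at_left 1)"
  unfolding Hardy_space_def Hardy_norm_def by (auto simp: tendsto_Lim)

lemma hp_mean_le_Hardy_norm:
  assumes "f \<in> Hardy_space p" "0 \<le> r" "r < 1"
  shows "hp_mean p f r \<le> Hardy_norm p f"
proof (rule tendsto_lowerbound[OF Hardy_norm_tendsto[OF assms(1)]])
  have "\<forall>\<^sub>F s in at_left 1. r < s" using assms by (intro order_tendstoD(1)[OF tendsto_ident_at]) auto
  moreover have "\<forall>\<^sub>F s::real in at_left 1. s < 1" by (simp add: eventually_at_left_field) (auto intro: exI[of _ 0])
  ultimately show "\<forall>\<^sub>F s in at_left 1. hp_mean p f r \<le> hp_mean p f s"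
    by eventually_elim (use assms in \<open>auto intro!: hp_mean_mono p Hardy_space_holo\<close>)
qed simp

text \<open>Membership demands that a limit exist, which sums and limits do not visibly inherit. A
  uniform bound on the means is inherited, and monotonicity turns it into the limit.\<close>

lemma Hardy_spaceI:
  assumes "f holomorphic_on disk" "extensional_disk f" and B: "\<And>r. 0 < r \<Longrightarrow> r < 1 \<Longrightarrow> hp_mean p f r \<le> B"
  shows "f \<in> Hardy_space p" "Hardy_norm p f \<le> B"
proof -
  show "f \<in> Hardy_space p"
    using hp_mean_tendsto[OF p assms(1) B] assms by (auto simp: Hardy_space_def)
  from Hardy_norm_tendsto[OF this] show "Hardy_norm p f \<le> B"
  proof (rule tendsto_upperbound)
    show "\<forall>\<^sub>F r in at_left 1. hp_mean p f r \<le> B"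
      using B by (simp add: eventually_at_left_field) (auto intro!: exI[of _ 0])
  qed simp
qed

lemma hp_mean_add_le:
  assumes "f holomorphic_on disk" "h holomorphic_on disk" "\<bar>r\<bar> < 1"
  shows "hp_mean p (\<lambda>z. f z + h z) r \<le> hp_mean p f r + hp_mean p h r"
proof -
  have m: "(\<lambda>\<theta>. k (r * cis \<theta>)) \<in> borel_measurable circle_measure" if "k holomorphic_on disk" for k
    using continuous_on_circle[OF that, of r] assms(3) by (simp add: borel_measurable_continuous_onI)
  have i: "integrable circle_measure (\<lambda>\<theta>. cmod (k (r * cis \<theta>)) powr p)" if "k holomorphic_on disk" for k
    using integrable_circle_powr[OF that, of r p] p assms(3) by simp
  show ?thesis
    using Minkowski_inequality[of p "\<lambda>\<theta>. f (r * cis \<theta>)" circle_measure "\<lambda>\<theta>. h (r * cis \<theta>)"] m i assms p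
    by (simp add: hp_mean_eq holomorphic_on_add)
qed

lemma hp_mean_scale:
  shows "hp_mean p (\<lambda>z. a * f z) r = cmod a * hp_mean p f r"
proof -
  have "(LINT \<theta>:{0..2*pi}|lborel. cmod (a * f (r * cis \<theta>)) powr p) =
      (LINT \<theta>:{0..2*pi}|lborel. cmod a powr p * cmod (f (r * cis \<theta>)) powr p)"
    by (simp add: norm_mult powr_mult)
  also have "\<dots> = cmod a powr p * (LINT \<theta>:{0..2*pi}|lborel. cmod (f (r * cis \<theta>)) powr p)"
    by simp
  finally show ?thesis
    unfolding hp_mean_def using p by (simp add: powr_mult powr_divide powr_powr)
qed

text \<open>The product enters as a function k equal to it on the disk only, to fit
  \<open>mult_op\<close>, which truncates.\<close>

lemma hp_mean_mult_le:
  assumes g: "g holomorphic_on disk" "\<And>z. z \<in> disk \<Longrightarrow> cmod (g z) \<le> B" and f: "f holomorphic_on disk" and r: "0 \<le> r" "r < 1"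
    and eq: "\<And>z. z \<in> disk \<Longrightarrow> k z = g z * f z"
  shows "hp_mean p k r \<le> B * hp_mean p f r"
proof -
  have "B \<ge> 0" using order_trans[OF norm_ge_zero g(2)[of 0]] by (simp add: disk_def)
  have k: "k holomorphic_on disk"
    using holomorphic_on_mult[OF g(1) f] by (rule holomorphic_transform) (simp add: eq)
  have rd: "r * cis \<theta> \<in> disk" for \<theta> using r by (simp add: disk_def norm_mult)
  have "(\<integral>\<theta>. cmod (k (r * cis \<theta>)) powr p \<partial>circle_measure) \<le> (\<integral>\<theta>. B powr p * cmod (f (r * cis \<theta>)) powr p \<partial>circle_measure)"
  proof (rule integral_mono)
    show "integrable circle_measure (\<lambda>\<theta>. cmod (k (r * cis \<theta>)) powr p)"
      "integrable circle_measure (\<lambda>\<theta>. B powr p * cmod (f (r * cis \<theta>)) powr p)"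
      using integrable_circle_powr[OF k, of r p] integrable_circle_powr[OF f, of r p] r p by auto
    fix \<theta>
    have "cmod (k (r * cis \<theta>)) \<le> B * cmod (f (r * cis \<theta>))"
      unfolding eq[OF rd] norm_mult using g(2)[OF rd] by (intro mult_right_mono) auto
    then have "cmod (k (r * cis \<theta>)) powr p \<le> (B * cmod (f (r * cis \<theta>))) powr p"
      using p by (intro powr_mono2) auto
    then show "cmod (k (r * cis \<theta>)) powr p \<le> B powr p * cmod (f (r * cis \<theta>)) powr p"
      by (simp add: powr_mult)
  qed
  also have "\<dots> = B powr p * (\<integral>\<theta>. cmod (f (r * cis \<theta>)) powr p \<partial>circle_measure)" by simp
  finally have "hp_mean p k r \<le> (B powr p * (\<integral>\<theta>. cmod (f (r * cis \<theta>)) powr p \<partial>circle_measure)) powr (1/p)"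
    using hp_mean_eq[OF k] r p by (simp add: powr_mono2)
  also have "\<dots> = B * hp_mean p f r"
    using hp_mean_eq[OF f, of r p] r p \<open>B \<ge> 0\<close> by (simp add: powr_mult powr_powr)
  finally show ?thesis .
qed

lemma Hardy_disk_function_space: "disk_function_space (Hardy_space p) (Hardy_norm p)"
proof
  show "f holomorphic_on disk" "extensional_disk f" if "f \<in> Hardy_space p" for f
    using that by (auto simp: Hardy_space_def)
next
  fix f h a b assume f: "f \<in> Hardy_space p" and h: "h \<in> Hardy_space p"
  show "(\<lambda>z. a * f z + b * h z) \<in> Hardy_space p"
  proof (rule Hardy_spaceI)
    show "(\<lambda>z. a * f z + b * h z) holomorphic_on disk"
      using f h Hardy_space_holo by (intro holomorphic_intros) auto
    show "extensional_disk (\<lambda>z. a * f z + b * h z)"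
      using Hardy_space_ext[OF f] Hardy_space_ext[OF h] by (simp add: extensional_disk_def)
    fix r :: real assume r: "0 < r" "r < 1"
    have "hp_mean p (\<lambda>z. a * f z + b * h z) r \<le> hp_mean p (\<lambda>z. a * f z) r + hp_mean p (\<lambda>z. b * h z) r"
      using f h r Hardy_space_holo by (intro hp_mean_add_le holomorphic_on_mult) auto
    also have "\<dots> \<le> cmod a * Hardy_norm p f + cmod b * Hardy_norm p h"
      unfolding hp_mean_scale using f h r hp_mean_le_Hardy_norm by (intro add_mono mult_left_mono) auto
    finally show "hp_mean p (\<lambda>z. a * f z + b * h z) r \<le> cmod a * Hardy_norm p f + cmod b * Hardy_norm p h" .
  qed
next
  fix f h assume f: "f \<in> Hardy_space p" and h: "h \<in> Hardy_space p"
  show "Hardy_norm p (\<lambda>z. f z + h z) \<le> Hardy_norm p f + Hardy_norm p h"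
  proof (rule Hardy_spaceI)
    show "(\<lambda>z. f z + h z) holomorphic_on disk"
      using f h Hardy_space_holo by (intro holomorphic_intros) auto
    show "extensional_disk (\<lambda>z. f z + h z)"
      using Hardy_space_ext[OF f] Hardy_space_ext[OF h] by (simp add: extensional_disk_def)
    fix r :: real assume r: "0 < r" "r < 1"
    have "hp_mean p (\<lambda>z. f z + h z) r \<le> hp_mean p f r + hp_mean p h r"
      using f h r Hardy_space_holo by (intro hp_mean_add_le) auto
    also have "\<dots> \<le> Hardy_norm p f + Hardy_norm p h"
      using f h r hp_mean_le_Hardy_norm by (intro add_mono) auto
    finally show "hp_mean p (\<lambda>z. f z + h z) r \<le> Hardy_norm p f + Hardy_norm p h" .
  qed
next
  have h: "(\<lambda>z. if z \<in> disk then 1 else 0 :: complex) holomorphic_on disk"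
    by (rule holomorphic_transform[of "\<lambda>_. 1"]) auto
  show "(\<lambda>z. if z \<in> disk then 1 else 0) \<in> Hardy_space p"
  proof (rule Hardy_spaceI[OF h, of 1])
    show "extensional_disk (\<lambda>z. if z \<in> disk then 1 else 0)" by (simp add: extensional_disk_def)
    fix r :: real assume r: "0 < r" "r < 1"
    then have "complex_of_real r * cis \<theta> \<in> disk" for \<theta> by (simp add: disk_def norm_mult)
    then show "hp_mean p (\<lambda>z. if z \<in> disk then 1 else 0) r \<le> 1"
      using hp_mean_eq[OF h, of r p] r by (simp add: measure_circle_measure_space)
  qed
next
  show "0 \<le> Hardy_norm p f" if "f \<in> Hardy_space p" for f
    using order_trans[OF hp_mean_nonneg hp_mean_le_Hardy_norm[OF that, of 0]] by simp
next
  fix f a assume f: "f \<in> Hardy_space p"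
  have "(hp_mean p (\<lambda>z. a * f z) \<longlongrightarrow> cmod a * Hardy_norm p f) (at_left 1)"
    unfolding hp_mean_scale by (intro tendsto_intros Hardy_norm_tendsto f)
  then show "Hardy_norm p (\<lambda>z. a * f z) = cmod a * Hardy_norm p f"
    unfolding Hardy_norm_def[of p "\<lambda>z. a * f z"] by (intro tendsto_Lim) auto
next
  fix r :: real assume r: "0 \<le> r" "r < 1"
  \<comment> \<open>A circle midway between radius r and the boundary, at distance R - r > 0 from
    all points considered.\<close>
  define R where "R = (1 + r) / 2"
  have R: "r < R" "R < 1" "0 < R" using r by (auto simp: R_def)
  have "cmod (f z) \<le> R / (R - r) * Hardy_norm p f" if f: "f \<in> Hardy_space p" and z: "cmod z \<le> r" for f z
  proof -
    have "cmod (f z) \<le> R / (R - cmod z) * hp_mean p f R"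
      using f z R Hardy_space_holo by (intro eval_le_hp_mean p) auto
    also have "\<dots> \<le> R / (R - r) * Hardy_norm p f"
      using R z hp_mean_le_Hardy_norm[OF f, of R] hp_mean_nonneg
      by (intro mult_mono divide_left_mono) auto
    finally show ?thesis .
  qed
  then show "\<exists>C. \<forall>f\<in>Hardy_space p. \<forall>z. cmod z \<le> r \<longrightarrow> cmod (f z) \<le> C * Hardy_norm p f" by blast
next
  fix F c C h
  assume F: "\<And>n. F n \<in> Hardy_space p" "\<And>n. Hardy_norm p (F n) \<le> c n" and c: "c \<longlonglongrightarrow> C"
    and lim: "\<And>z. z \<in> disk \<Longrightarrow> (\<lambda>n. F n z) \<longlonglongrightarrow> h z" and h: "h holomorphic_on disk" "extensional_disk h"
  \<comment> \<open>Fatou's lemma is used on each fixed circle inside the disk; the bound is the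
    same for all of them.\<close>
  have "hp_mean p h r \<le> C" if r: "0 < r" "r < 1" for r
  proof -
    have m: "(\<lambda>\<theta>. k (r * cis \<theta>)) \<in> borel_measurable circle_measure" if "k holomorphic_on disk" for k
      using continuous_on_circle[OF that, of r] r by (simp add: borel_measurable_continuous_onI)
    have Fh: "F n holomorphic_on disk" for n using F Hardy_space_holo by auto
    have rd: "r * cis \<theta> \<in> disk" for \<theta> using r by (simp add: disk_def norm_mult)
    have "(\<integral>\<theta>. cmod (h (r * cis \<theta>)) powr p \<partial>circle_measure) powr (1/p) \<le> C"
    proof (rule Fatou_Lp(2))
      show "(\<integral>\<theta>. cmod (F n (r * cis \<theta>)) powr p \<partial>circle_measure) powr (1/p) \<le> c n" for n
        using hp_mean_le_Hardy_norm[OF F(1)[of n], of r] F(2)[of n] hp_mean_eq[OF Fh, of r p n] r by simp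
      show "AE \<theta> in circle_measure. (\<lambda>n. F n (r * cis \<theta>)) \<longlonglongrightarrow> h (r * cis \<theta>)"
        using lim[OF rd] by simp
      show "integrable circle_measure (\<lambda>\<theta>. cmod (F n (r * cis \<theta>)) powr p)" for n
        using integrable_circle_powr[OF Fh, of r p n] r p by simp
    qed (use p c m h Fh in auto)
    then show ?thesis using hp_mean_eq[OF h(1), of r p] r by simp
  qed
  from Hardy_spaceI[OF h this] show "h \<in> Hardy_space p \<and> Hardy_norm p h \<le> C" by blast
next
  fix g B f assume g: "g holomorphic_on disk" "\<And>z. z \<in> disk \<Longrightarrow> cmod (g z) \<le> B" and f: "f \<in> Hardy_space p"
  have "B \<ge> 0" using order_trans[OF norm_ge_zero g(2)[of 0]] by (simp add: disk_def)
  have "mult_op g f holomorphic_on disk"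
    using holomorphic_on_mult[OF g(1) Hardy_space_holo[OF f]] by (rule holomorphic_transform) (simp add: mult_op_def)
  moreover have "extensional_disk (mult_op g f)" by (simp add: extensional_disk_def mult_op_def)
  moreover have "hp_mean p (mult_op g f) r \<le> B * Hardy_norm p f" if "0 < r" "r < 1" for r
  proof -
    have "hp_mean p (mult_op g f) r \<le> B * hp_mean p f r"
      using that by (intro hp_mean_mult_le[OF g Hardy_space_holo[OF f]]) (auto simp: mult_op_def)
    also have "\<dots> \<le> B * Hardy_norm p f"
      using that \<open>B \<ge> 0\<close> by (intro mult_left_mono hp_mean_le_Hardy_norm f) auto
    finally show ?thesis .
  qed
  ultimately show "mult_op g f \<in> Hardy_space p \<and> Hardy_norm p (mult_op g f) \<le> B * Hardy_norm p f"
    using Hardy_spaceI by blast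
qed

text \<open>Along radii tending to 1 the means converge to the Hardy norm by definition, and by
  dominated convergence to the mean of the boundary values, F being bounded and continuous on the
  closed disk.\<close>

lemma Hardy_norm_disk_algebra:
  assumes F: "disk_algebra F" and X: "restrict_disk F \<in> Hardy_space p"
  shows "Hardy_norm p (restrict_disk F) powr p = (\<integral>\<theta>. cmod (F (cis \<theta>)) powr p \<partial>circle_measure)"
proof -
  have cont: "continuous_on (cball 0 1) F" using F by (simp add: disk_algebra_def)
  obtain B where B: "\<And>z. z \<in> cball 0 1 \<Longrightarrow> cmod (F z) \<le> B" using disk_algebra_bounded[OF F] by blast
  define r where "r n = 1 - 1 / real (n + 2)" for n
  have r: "0 < r n" "r n < 1" for n by (auto simp: r_def)
  have r1: "r \<longlonglongrightarrow> 1"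
    using tendsto_radius by (simp add: r_def[abs_def])
  have rd: "r n * cis \<theta> \<in> disk" for n \<theta> using r[of n] by (simp add: disk_def norm_mult)
  have contc: "continuous_on UNIV (\<lambda>\<theta>. F (s * cis \<theta>))" if "0 \<le> s" "s \<le> 1" for s :: real
    by (rule continuous_on_compose2[OF cont]) (use that in \<open>auto simp: norm_mult intro!: continuous_intros\<close>)
  have L1: "(\<lambda>n. \<integral>\<theta>. cmod (F (r n * cis \<theta>)) powr p \<partial>circle_measure) \<longlonglongrightarrow> (\<integral>\<theta>. cmod (F (cis \<theta>)) powr p \<partial>circle_measure)"
  proof (rule integral_dominated_convergence[where w = "\<lambda>_. B powr p"])
    show "(\<lambda>\<theta>. cmod (F (cis \<theta>)) powr p) \<in> borel_measurable circle_measure"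
      "(\<lambda>\<theta>. cmod (F (r n * cis \<theta>)) powr p) \<in> borel_measurable circle_measure" for n
      using contc[of 1] contc[of "r n"] r[of n] p
      by (auto intro!: borel_measurable_continuous_onI continuous_on_norm_powr)
    show "AE \<theta> in circle_measure. norm (cmod (F (r n * cis \<theta>)) powr p) \<le> B powr p" for n
      using B p r[of n] by (auto intro!: AE_I2 powr_mono2 simp: norm_mult)
    show "AE \<theta> in circle_measure. (\<lambda>n. cmod (F (r n * cis \<theta>)) powr p) \<longlonglongrightarrow> cmod (F (cis \<theta>)) powr p"
    proof (rule AE_I2)
      fix \<theta>
      have "(\<lambda>n. complex_of_real (r n) * cis \<theta>) \<longlonglongrightarrow> complex_of_real 1 * cis \<theta>"
        by (intro tendsto_intros r1)
      then have "(\<lambda>n. F (r n * cis \<theta>)) \<longlonglongrightarrow> F (cis \<theta>)"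
        using r by (intro continuous_on_tendsto_compose[OF cont]) (auto simp: norm_mult less_imp_le)
      then show "(\<lambda>n. cmod (F (r n * cis \<theta>)) powr p) \<longlonglongrightarrow> cmod (F (cis \<theta>)) powr p"
        using p by (intro tendsto_powr' tendsto_norm tendsto_const) auto
    qed
  qed simp
  have eq: "(\<integral>\<theta>. cmod (F (r n * cis \<theta>)) powr p \<partial>circle_measure) = hp_mean p (restrict_disk F) (r n) powr p" for n
    using hp_mean_eq[OF Hardy_space_holo[OF X], of "r n" p] r[of n] p rd[of n]
    by (simp add: powr_powr restrict_disk_def)
  have L2: "(\<lambda>n. hp_mean p (restrict_disk F) (r n) powr p) \<longlonglongrightarrow> Hardy_norm p (restrict_disk F) powr p"
  proof -
    have "filterlim r (at_left 1) sequentially"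
      unfolding filterlim_at using r1 less_imp_neq[OF r(2)] r(2) by simp
    then have "(\<lambda>n. hp_mean p (restrict_disk F) (r n)) \<longlonglongrightarrow> Hardy_norm p (restrict_disk F)"
      by (rule filterlim_compose[OF Hardy_norm_tendsto[OF X]])
    then show ?thesis using p by (intro tendsto_powr' tendsto_const) (auto simp: hp_mean_nonneg)
  qed
  show ?thesis by (rule LIMSEQ_unique[OF L2 L1[unfolded eq]])
qed

lemma Hardy_peaking_disk_space:
  "peaking_disk_space (Hardy_space p) (Hardy_norm p) p (distr circle_measure borel cis)"
proof -
  interpret disk_function_space "Hardy_space p" "Hardy_norm p" by (rule Hardy_disk_function_space)
  have cism[measurable]: "cis \<in> borel_measurable borel"
    by (intro borel_measurable_continuous_onI continuous_intros)
  have cisc: "cis \<in> circle_measure \<rightarrow>\<^sub>M borel" by simp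
  show ?thesis
  proof (rule peaking_disk_space.intro[OF Hardy_disk_function_space peaking_disk_space_axioms.intro])
    show "p > 1" by (rule p)
    show "finite_measure (distr circle_measure borel cis)"
      by (rule circle_measure.finite_measure_distr[OF cisc])
    show "sets (distr circle_measure borel cis) = sets borel" by simp
  next
    fix \<xi> :: complex assume "cmod \<xi> = 1"
    \<comment> \<open>The angles over \<xi> differ by multiples of 2 pi; they form a countable set,
      hence a null set.\<close>
    have "\<theta> \<in> range (\<lambda>k. Arg \<xi> + 2 * pi * of_int k)" if "cis \<theta> = \<xi>" for \<theta>
    proof -
      have "cis (Arg \<xi>) = \<xi>" 
        using \<open>cmod \<xi> = 1\<close> cis_Arg[of \<xi>] by (cases "\<xi> = 0") (auto simp: sgn_eq)
      then have "sin \<theta> = sin (Arg \<xi>) \<and> cos \<theta> = cos (Arg \<xi>)" using that by (metis cis.sel)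
      then show ?thesis unfolding sin_cos_eq_iff by auto
    qed
    then have "cis -` {\<xi>} \<inter> {0..2*pi} \<subseteq> range (\<lambda>k::int. Arg \<xi> + 2 * pi * of_int k)" by blast
    then have "countable (cis -` {\<xi>} \<inter> {0..2*pi})" by (rule countable_subset) simp
    then have "emeasure lborel (cis -` {\<xi>} \<inter> {0..2*pi}) = 0" by (rule emeasure_lborel_countable)
    then show "measure (distr circle_measure borel cis) {\<xi>} = 0"
      using measurable_sets[OF cism, of "{\<xi>}"]
      by (subst measure_distr) (simp_all add: measure_def emeasure_circle_measure)
  next
    fix \<xi> :: complex and \<delta> :: real assume \<xi>: "cmod \<xi> = 1" and "\<delta> > 0"
    define V where "V = cis -` ball \<xi> \<delta>"
    have "open V" unfolding V_def by (intro open_vimage continuous_intros) auto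
    obtain \<alpha> where \<alpha>: "0 \<le> \<alpha>" "\<alpha> < 2*pi" "\<xi> = cis \<alpha>"
      using complex_unimodular_polar[OF \<xi>] by (metis cis.code complex_eq cis_conv_exp)
    have "\<alpha> \<in> V" using \<open>\<delta> > 0\<close> \<alpha> by (simp add: V_def)
    then obtain e where e: "e > 0" "ball \<alpha> e \<subseteq> V" using \<open>open V\<close> by (meson openE)
    \<comment> \<open>The angle of \<xi> may be 0, so the interval is opened to the right of it; as
      the angle is below 2 pi, cutting at 2 pi leaves positive length.\<close>
    define b where "b = min (\<alpha> + e/2) (2*pi)"
    have "\<alpha> < b" using e \<alpha> by (auto simp: b_def)
    have sub: "{\<alpha>..b} \<subseteq> V \<inter> {0..2*pi}"
      using e \<alpha> by (auto simp: b_def dist_real_def intro!: subsetD[OF e(2)])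
    have "0 < emeasure lborel {\<alpha>..b}" using \<open>\<alpha> < b\<close> by simp
    also have "\<dots> \<le> emeasure lborel (V \<inter> {0..2*pi})"
      using \<open>open V\<close> sub by (intro emeasure_mono) auto
    finally have "emeasure circle_measure V \<noteq> 0"
      using \<open>open V\<close> by (simp add: emeasure_circle_measure ennreal_divide_eq_0_iff)
    then have "measure circle_measure V > 0"
      by (simp add: circle_measure.emeasure_eq_measure zero_less_measure_iff)
    moreover have "cis -` (cball 0 1 \<inter> ball \<xi> \<delta>) = V" by (auto simp: V_def)
    ultimately show "measure (distr circle_measure borel cis) (cball 0 1 \<inter> ball \<xi> \<delta>) > 0"
      by (subst measure_distr) auto
  next
    fix F assume F: "disk_algebra F"
    have cont: "continuous_on (cball 0 1) F" using F by (simp add: disk_algebra_def)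
    obtain B where B: "\<And>z. z \<in> cball 0 1 \<Longrightarrow> cmod (F z) \<le> B" using disk_algebra_bounded[OF F] by blast
    have "mult_op F (\<lambda>z. if z \<in> disk then 1 else 0) \<in> Hardy_space p"
      using multiplier[OF _ _ one_in, of F B] F B by (auto simp: disk_algebra_def disk_def)
    then have X: "restrict_disk F \<in> Hardy_space p"
      by (simp add: mult_op_def restrict_disk_def if_distrib cong: if_cong)
    have "(\<lambda>z. indicator (cball 0 1) z *\<^sub>R (cmod (F z) powr p)) \<in> borel_measurable borel"
      using p by (intro borel_measurable_continuous_on_indicator continuous_on_norm_powr cont) auto
    then have "(LINT z:cball 0 1|distr circle_measure borel cis. cmod (F z) powr p)
        = (\<integral>\<theta>. indicator (cball 0 1) (cis \<theta>) *\<^sub>R (cmod (F (cis \<theta>)) powr p) \<partial>circle_measure)"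
      unfolding set_lebesgue_integral_def by (intro integral_distr) auto
    also have "\<dots> = (\<integral>\<theta>. cmod (F (cis \<theta>)) powr p \<partial>circle_measure)" by simp
    finally show "Hardy_norm p (restrict_disk F) powr p = (LINT z:cball 0 1|distr circle_measure borel cis. cmod (F z) powr p)"
      using Hardy_norm_disk_algebra[OF F X] by simp
  qed
qed

end

subsection \<open>Rotation invariance and the weighted area measure\<close>

text \<open>Rotation invariance of area is imported from orthogonal maps of \<open>real^2\<close>
  through this identification.\<close>

definition vec2_complex :: "real^2 \<Rightarrow> complex" where
  "vec2_complex x = Complex (x $ 1) (x $ 2)"

definition complex_vec2 :: "complex \<Rightarrow> real^2" where
  "complex_vec2 z = vector [Re z, Im z]"

lemma vec2_complex_inverse: "complex_vec2 (vec2_complex x) = x" "vec2_complex (complex_vec2 z) = z"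
  by (simp_all add: vec2_complex_def complex_vec2_def vec_eq_iff forall_2)

lemma linear_vec2_complex: "linear vec2_complex"
  by (rule linearI) (auto simp: vec2_complex_def complex_eq_iff)

lemma linear_complex_vec2: "linear complex_vec2"
  by (rule linearI) (auto simp: complex_vec2_def vec_eq_iff forall_2)

lemma norm_vec2_complex: "cmod (vec2_complex x) = norm x"
  by (simp add: vec2_complex_def cmod_def norm_vec_def L2_set_def UNIV_2)

lemma vec2_complex_measurable: "vec2_complex \<in> borel_measurable borel"
  by (intro borel_measurable_continuous_onI linear_continuous_on linear_conv_bounded_linear[THEN iffD1] linear_vec2_complex)

text \<open>Boxes correspond to boxes with the same side lengths, and the values on boxes determine
  \<open>lborel\<close>.\<close>

lemma distr_vec2_complex: "distr lborel borel vec2_complex = lborel"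
proof (rule lborel_eqI[symmetric])
  fix l u :: complex assume le: "\<And>b. b \<in> Basis \<Longrightarrow> l \<bullet> b \<le> u \<bullet> b"
  have B: "(Basis :: (real^2) set) = {axis 1 1, axis 2 1}"
    by (auto simp: Basis_vec_def UNIV_2)
  have "axis 1 1 \<noteq> (axis 2 1 :: real^2)" by (simp add: axis_eq_axis)
  have "vec2_complex -` box l u = box (complex_vec2 l) (complex_vec2 u)"
    by (auto simp: vec2_complex_def complex_vec2_def mem_box_cart forall_2 in_box_complex_iff)
  then have "emeasure (distr lborel borel vec2_complex) (box l u) = emeasure lborel (box (complex_vec2 l) (complex_vec2 u))"
    using vec2_complex_measurable by (simp add: emeasure_distr)
  also have "\<dots> = ennreal (\<Prod>b\<in>Basis. (complex_vec2 u - complex_vec2 l) \<bullet> b)"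
    using le[of 1] le[of \<i>] by (intro emeasure_lborel_box) (auto simp: B complex_vec2_def inner_axis Basis_complex_def)
  also have "(\<Prod>b\<in>Basis. (complex_vec2 u - complex_vec2 l) \<bullet> b) = (\<Prod>b\<in>Basis. (u - l) \<bullet> b)"
    using \<open>axis 1 1 \<noteq> axis 2 1\<close> by (simp add: B complex_vec2_def inner_axis Basis_complex_def complex_eq_iff)
  finally show "emeasure (distr lborel borel vec2_complex) (box l u) = ennreal (\<Prod>b\<in>Basis. (u - l) \<bullet> b)" .
qed simp

text \<open>The preimage of a box under the rotation is its image under the inverse rotation.
  Transported to \<open>real^2\<close> the latter is the orthogonal map T, which preserves the
  measure.\<close>

lemma distr_lborel_rotation:
  "distr lborel borel (\<lambda>w. cis \<theta> * w) = (lborel :: complex measure)"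
proof (rule lborel_eqI[symmetric])
  fix l u :: complex assume le: "\<And>b. b \<in> Basis \<Longrightarrow> l \<bullet> b \<le> u \<bullet> b"
  define T where "T = (\<lambda>x. complex_vec2 (cis (-\<theta>) * vec2_complex x))"
  have "linear (\<lambda>w. cis (-\<theta>) * w)" by (rule linearI) (auto simp: algebra_simps)
  then have "linear T"
    unfolding T_def using linear_compose[OF linear_compose[OF linear_vec2_complex] linear_complex_vec2]
    by (simp add: o_def)
  moreover have "norm (T x) = norm x" for x
    unfolding norm_vec2_complex[symmetric] T_def vec2_complex_inverse by (simp add: norm_mult)
  ultimately have T: "orthogonal_transformation T" by (simp add: orthogonal_transformation)
  have mr: "(\<lambda>w. cis \<theta> * w) \<in> borel_measurable borel"
    by (intro borel_measurable_continuous_onI continuous_intros)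
  let ?S = "vec2_complex -` box l u" and ?R = "(\<lambda>w. cis \<theta> * w) -` box l u"
  have S: "?S \<in> sets borel" using measurable_sets[OF vec2_complex_measurable, of "box l u"] by simp
  have R: "?R \<in> sets borel" using measurable_sets[OF mr, of "box l u"] by simp
  have RS: "vec2_complex -` ?R \<in> sets borel" using measurable_sets[OF vec2_complex_measurable R] by simp
  have em: "emeasure lborel (vec2_complex -` A) = emeasure lborel A" if "A \<in> sets borel" for A
    using that vec2_complex_measurable emeasure_distr[of vec2_complex lborel borel A] unfolding distr_vec2_complex by simp
  have img: "vec2_complex -` ?R = T ` ?S"
  proof (intro equalityI subsetI)
    fix x assume "x \<in> vec2_complex -` ?R"
    moreover have "x = T (complex_vec2 (cis \<theta> * vec2_complex x))"
      unfolding T_def vec2_complex_inverse by (simp add: mult.assoc[symmetric] cis_mult vec2_complex_inverse)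
    ultimately show "x \<in> T ` ?S" by (intro image_eqI) (auto simp: vec2_complex_inverse)
  next
    fix x assume "x \<in> T ` ?S"
    then show "x \<in> vec2_complex -` ?R"
      by (auto simp: T_def vec2_complex_inverse mult.assoc[symmetric] cis_mult)
  qed
  have fin: "emeasure lborel ?S < \<infinity>"
    using em[of "box l u"] emeasure_lborel_box_finite[of l u] by simp
  then have lm: "?S \<in> lmeasurable" using S by (intro fmeasurableI) auto
  have "emeasure lebesgue (vec2_complex -` ?R) = emeasure lebesgue ?S"
    unfolding img using measure_orthogonal_image[OF T lm] measurable_orthogonal_image[OF T lm] lm
    by (simp add: emeasure_eq_measure2)
  then have "emeasure lborel ?R = emeasure lborel (box l u)"
    using em[OF R] em[of "box l u"] S RS by simp
  then show "emeasure (distr lborel borel (\<lambda>w. cis \<theta> * w)) (box l u) = ennreal (\<Prod>b\<in>Basis. (u - l) \<bullet> b)"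
    using mr le by (simp add: emeasure_distr)
qed simp

section \<open>The weighted area measure of the disk\<close>

definition bergman_measure :: "real \<Rightarrow> complex measure" where
  "bergman_measure \<alpha> = density lborel (\<lambda>z. ennreal (indicator disk z * bergman_weight \<alpha> z))"

lemma sets_bergman_measure [simp, measurable_cong]: "sets (bergman_measure \<alpha>) = sets borel"
  by (simp add: bergman_measure_def)

lemma space_bergman_measure [simp]: "space (bergman_measure \<alpha>) = UNIV"
  by (simp add: bergman_measure_def)

lemma measurable_bergman_measure [simp]: "measurable (bergman_measure \<alpha>) M = measurable borel M"
  by (rule measurable_cong_sets) simp_all

lemma open_disk: "open disk"
  by (simp add: disk_def)

lemma disk_borel [measurable]: "disk \<in> sets borel"
  by (simp add: disk_def)

lemma bergman_weight_measurable [measurable]: "bergman_weight \<alpha> \<in> borel_measurable borel"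
  unfolding bergman_weight_def by measurable

context
  fixes \<alpha> :: real
  assumes \<alpha>: "\<alpha> > -1"
begin

lemma bergman_weight_nonneg: "bergman_weight \<alpha> z \<ge> 0"
  using \<alpha> by (simp add: bergman_weight_def)

lemma bergman_weight_pos: "z \<in> disk \<Longrightarrow> bergman_weight \<alpha> z > 0"
proof -
  assume "z \<in> disk"
  then have "(cmod z)\<^sup>2 < 1" by (simp add: disk_def power_less_one_iff abs_square_less_1)
  then show ?thesis using \<alpha> by (simp add: bergman_weight_def)
qed

lemma nn_integral_bergman:
  "k \<in> borel_measurable borel \<Longrightarrow>
    (\<integral>\<^sup>+z. k z \<partial>bergman_measure \<alpha>) = (\<integral>\<^sup>+z. ennreal (indicator disk z * bergman_weight \<alpha> z) * k z \<partial>lborel)"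
  unfolding bergman_measure_def by (subst nn_integral_density) auto

text \<open>On the annulus where \<open>1 - |z|\<^sup>2\<close> is about \<open>2\<^sup>-\<^sup>k\<close>, of area \<open>\<pi> 2\<^sup>-\<^sup>k\<^sup>-\<^sup>1\<close>, the weight is comparable to \<open>2 powr (- k \<alpha>)\<close>.\<close>

lemma emeasure_bergman_finite: "emeasure (bergman_measure \<alpha>) UNIV < \<infinity>"
proof -
  define A where "A k = ball (0::complex) (sqrt (1 - (1/2) ^ Suc k)) - ball 0 (sqrt (1 - (1/2) ^ k))" for k :: nat
  \<comment> \<open>The ratio of the dominating geometric series: each annulus multiplies the area
    by 1/2 and the weight by \<open>2 powr (- \<alpha>)\<close>. It is below 1 because \<alpha> >
    -1.\<close>
  define q where "q = 2 powr (-1 - \<alpha>)"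
  have q: "0 < q" "q < 1" unfolding q_def using \<alpha> powr_less_mono[of "-1 - \<alpha>" 0 2] by auto
  \<comment> \<open>On the k-th annulus, 1 - |z|^2 is \<open>(1/2) ^ k\<close> times a factor in
    [1/2, 1]; \<open>2 powr \<bar>\<alpha>\<bar>\<close> bounds the \<alpha>-th power of that factor
    for either sign of \<alpha>.\<close>
  define b where "b k = (\<alpha> + 1) / pi * (2 powr \<bar>\<alpha>\<bar> * ((1/2) ^ k) powr \<alpha>)" for k :: nat
  have b0: "b k \<ge> 0" for k using \<alpha> by (simp add: b_def)
  have half: "(1/2::real) ^ k \<le> 1" "(1/2::real) ^ k > 0" for k :: nat by (auto simp: power_le_one)
  have mA: "A k \<in> sets lborel" for k by (simp add: A_def)
  have eA: "emeasure lborel (A k) = ennreal (pi * (1/2) ^ Suc k)" for k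
  proof -
    have ball: "emeasure lborel (ball (0::complex) (sqrt s)) = ennreal (pi * s)" if "s \<ge> 0" for s
      using that by (simp add: emeasure_ball unit_ball_vol_2)
    have "emeasure lborel (A k) = emeasure lborel (ball (0::complex) (sqrt (1 - (1/2) ^ Suc k))) - emeasure lborel (ball (0::complex) (sqrt (1 - (1/2) ^ k)))"
      unfolding A_def
    proof (rule emeasure_Diff)
      show "ball 0 (sqrt (1 - (1/2) ^ k)) \<subseteq> ball (0::complex) (sqrt (1 - (1/2) ^ Suc k))"
        using half[of k] by (intro subset_ball) simp
    qed (auto simp: ball half)
    also have "\<dots> = ennreal (pi * (1 - (1/2) ^ Suc k) - pi * (1 - (1/2) ^ k))"
      using half[of k] half[of "Suc k"] by (subst (1 2) ball) (auto simp: ennreal_minus)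
    also have "pi * (1 - (1/2) ^ Suc k) - pi * (1 - (1/2) ^ k) = pi * (1/2) ^ Suc k"
      by (simp add: algebra_simps)
    finally show ?thesis .
  qed
  have wb: "bergman_weight \<alpha> z \<le> b k" if z: "z \<in> A k" for z k
  proof -
    define s where "s = (1 - (cmod z)\<^sup>2) / (1/2) ^ k"
    have "cmod z < sqrt (1 - (1/2) ^ Suc k)" "sqrt (1 - (1/2) ^ k) \<le> cmod z"
      using z by (auto simp: A_def)
    then have "(cmod z)\<^sup>2 < 1 - (1/2) ^ Suc k" "1 - (1/2) ^ k \<le> (cmod z)\<^sup>2"
      using power_strict_mono[of "cmod z" "sqrt (1 - (1/2) ^ Suc k)" 2] power_mono[of "sqrt (1 - (1/2) ^ k)" "cmod z" 2]
        half[of k] by auto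
    then have s: "1/2 \<le> s" "s \<le> 1" using half(2)[of k] by (auto simp: s_def field_simps)
    have "s powr \<alpha> \<le> 2 powr \<bar>\<alpha>\<bar>"
    proof (cases "\<alpha> \<ge> 0")
      case True
      then have "s powr \<alpha> \<le> 1" using s powr_mono2[of \<alpha> s 1] by simp
      also have "1 \<le> 2 powr \<bar>\<alpha>\<bar>" using ge_one_powr_ge_zero[of 2 "\<bar>\<alpha>\<bar>"] by simp
      finally show ?thesis .
    next
      case False
      then have "s powr \<alpha> \<le> (1/2) powr \<alpha>" using s by (intro powr_mono2') auto
      then show ?thesis using False by (simp add: powr_divide powr_minus_divide)
    qed
    moreover have "1 - (cmod z)\<^sup>2 = s * (1/2) ^ k" using half(2)[of k] by (simp add: s_def)
    ultimately have "(1 - (cmod z)\<^sup>2) powr \<alpha> \<le> 2 powr \<bar>\<alpha>\<bar> * ((1/2) ^ k) powr \<alpha>"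
      by (simp add: powr_mult mult_right_mono)
    then have "(\<alpha> + 1) / pi * (1 - (cmod z)\<^sup>2) powr \<alpha> \<le> b k"
      unfolding b_def using \<alpha> by (intro mult_left_mono) auto
    then show ?thesis by (simp add: bergman_weight_def)
  qed
  have cover: "\<exists>k. z \<in> A k" if z: "z \<in> disk" for z
  proof -
    have "(cmod z)\<^sup>2 < 1" using z by (simp add: disk_def power_less_one_iff abs_square_less_1)
    then obtain n :: nat where n: "(1/2) ^ n < 1 - (cmod z)\<^sup>2"
      using real_arch_pow_inv[of "1 - (cmod z)\<^sup>2" "1/2"] by auto
    \<comment> \<open>The least index of a disk containing z is not 0, since P 0 would require |z|^2
      < 0; its predecessor is the number of the annulus.\<close>
    define P where "P k \<longleftrightarrow> (cmod z)\<^sup>2 < 1 - (1/2) ^ k" for k :: nat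
    have "P n" using n by (simp add: P_def)
    define m where "m = (LEAST k. P k)"
    have "P m" unfolding m_def by (rule LeastI[of P, OF \<open>P n\<close>])
    then have "m \<noteq> 0" by (auto simp: P_def intro: ccontr)
    then obtain k where k: "m = Suc k" by (cases m) auto
    then have "\<not> P k" using not_less_Least[of k P] by (simp add: m_def)
    have "cmod z < sqrt (1 - (1/2) ^ Suc k)"
      using \<open>P m\<close> k unfolding P_def by (intro real_less_rsqrt) simp
    moreover have "sqrt (1 - (1/2) ^ k) \<le> cmod z"
      using \<open>\<not> P k\<close> unfolding P_def by (intro real_le_lsqrt) auto
    ultimately show ?thesis by (auto simp: A_def)
  qed
  have "emeasure (bergman_measure \<alpha>) UNIV = (\<integral>\<^sup>+z. ennreal (indicator disk z * bergman_weight \<alpha> z) \<partial>lborel)"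
    unfolding bergman_measure_def by (subst emeasure_density) auto
  also have "\<dots> \<le> (\<integral>\<^sup>+z. (\<Sum>k. ennreal (b k) * indicator (A k) z) \<partial>lborel)"
  proof (rule nn_integral_mono)
    fix z :: complex
    show "ennreal (indicator disk z * bergman_weight \<alpha> z) \<le> (\<Sum>k. ennreal (b k) * indicator (A k) z)"
    proof (cases "z \<in> disk")
      case True
      then obtain k where k: "z \<in> A k" using cover by blast
      have "ennreal (bergman_weight \<alpha> z) \<le> ennreal (b k) * indicator (A k) z"
        using wb[OF k] k by (simp add: ennreal_leI)
      also have "\<dots> \<le> (\<Sum>k. ennreal (b k) * indicator (A k) z)"
      proof -
        have "t k \<le> suminf t" for t :: "nat \<Rightarrow> ennreal" using sum_le_suminf[of t "{k}"] by simp
        then show ?thesis .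
      qed
      finally show ?thesis using True by simp
    qed simp
  qed
  also have "\<dots> = (\<Sum>k. \<integral>\<^sup>+z. ennreal (b k) * indicator (A k) z \<partial>lborel)"
    by (rule nn_integral_suminf) (use mA in measurable)
  also have "\<dots> = (\<Sum>k. ennreal (b k * (pi * (1/2) ^ Suc k)))"
    by (simp only: nn_integral_cmult_indicator[OF mA] eA ennreal_mult'[OF b0])
  also have "\<dots> = (\<Sum>k. ennreal ((\<alpha> + 1) / 2 * 2 powr \<bar>\<alpha>\<bar> * q ^ k))"
  proof -
    have "b k * (pi * (1/2) ^ Suc k) = (\<alpha> + 1) / 2 * 2 powr \<bar>\<alpha>\<bar> * q ^ k" for k
    proof -
      have "((1/2) ^ k) powr \<alpha> * (1/2) ^ k = q ^ k"
      proof -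
        have h: "(1/2::real) ^ k = 2 powr (- real k)"
          by (simp add: powr_minus powr_realpow power_one_over inverse_eq_divide)
        have "q ^ k = 2 powr (real k * (-1 - \<alpha>))"
          unfolding powr_realpow[OF q(1), symmetric] unfolding q_def powr_powr by (simp only: mult.commute)
        also have "\<dots> = 2 powr (- real k * \<alpha>) * 2 powr (- real k)"
          by (simp add: powr_add[symmetric] algebra_simps)
        finally show ?thesis unfolding h powr_powr by simp
      qed
      then show ?thesis by (simp add: b_def)
    qed
    then show ?thesis by simp
  qed
  also have "\<dots> < \<infinity>"
  proof -
    have "summable (\<lambda>k. (\<alpha> + 1) / 2 * 2 powr \<bar>\<alpha>\<bar> * q ^ k)"
      using q by (intro summable_mult summable_geometric) auto
    then show ?thesis using \<alpha> q by (subst suminf_ennreal2) auto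
  qed
  finally show ?thesis .
qed

end

subsection \<open>Weighted Bergman spaces\<close>

lemma holomorphic_extensional_measurable:
  assumes "f holomorphic_on disk" "extensional_disk f"
  shows "f \<in> borel_measurable borel"
proof -
  have "(\<lambda>z. indicator disk z *\<^sub>R f z) \<in> borel_measurable borel"
    by (rule borel_measurable_continuous_on_indicator[OF disk_borel holomorphic_on_imp_continuous_on[OF assms(1)]])
  moreover have "(\<lambda>z. indicator disk z *\<^sub>R f z) = f"
    using assms(2) by (auto simp: extensional_disk_def indicator_def)
  ultimately show ?thesis by simp
qed

context
  fixes \<alpha> :: real
  assumes \<alpha>: "\<alpha> > -1"
begin

interpretation bergman: finite_measure "bergman_measure \<alpha>"
  using emeasure_bergman_finite[OF \<alpha>] by (intro finite_measureI) simp

lemma integrable_bergman_iff: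
  fixes k :: "complex \<Rightarrow> real"
  assumes "k \<in> borel_measurable borel"
  shows "integrable (bergman_measure \<alpha>) k \<longleftrightarrow> set_integrable lborel disk (\<lambda>z. k z * bergman_weight \<alpha> z)"
  unfolding bergman_measure_def set_integrable_def
  using assms bergman_weight_nonneg[OF \<alpha>]
  by (subst integrable_density) (auto simp: mult_ac intro!: AE_I2)

lemma integral_bergman:
  fixes k :: "complex \<Rightarrow> real"
  assumes "k \<in> borel_measurable borel"
  shows "(\<integral>z. k z \<partial>bergman_measure \<alpha>) = (LINT z:disk|lborel. k z * bergman_weight \<alpha> z)"
  unfolding bergman_measure_def set_lebesgue_integral_def
  using assms bergman_weight_nonneg[OF \<alpha>]
  by (subst integral_density) (auto simp: mult_ac intro!: AE_I2)

lemma AE_bergman: "AE z in bergman_measure \<alpha>. z \<in> disk"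
  unfolding bergman_measure_def by (subst AE_density) (auto simp: indicator_def)

text \<open>The weight is positive on the disk, and a nonempty open set is not Lebesgue
  null.\<close>

lemma bergman_open_pos:
  assumes "open U" "U \<subseteq> disk" "U \<noteq> {}"
  shows "measure (bergman_measure \<alpha>) U > 0"
proof -
  have [measurable]: "U \<in> sets borel" using assms by simp
  have "emeasure (bergman_measure \<alpha>) U \<noteq> 0"
  proof
    assume "emeasure (bergman_measure \<alpha>) U = 0"
    then have "(\<integral>\<^sup>+z. ennreal (indicator disk z * bergman_weight \<alpha> z) * indicator U z \<partial>lborel) = 0"
      unfolding bergman_measure_def by (subst (asm) emeasure_density) auto
    then have "AE z in lborel. ennreal (indicator disk z * bergman_weight \<alpha> z) * indicator U z = 0"
      by (subst (asm) nn_integral_0_iff_AE) auto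
    then have "AE z in lborel. z \<notin> U"
    proof eventually_elim
      case (elim z)
      show ?case
      proof
        assume "z \<in> U"
        then show False using elim bergman_weight_pos[OF \<alpha>, of z] assms(2) by (auto simp: ennreal_eq_0_iff)
      qed
    qed
    then have "emeasure lborel U = 0"
      by (subst (asm) AE_iff_measurable[of U]) auto
    then have "negligible U" using assms(1) by (simp add: negligible_iff_null_sets null_sets_def)
    then show False using open_not_negligible[OF assms(1,3)] by simp
  qed
  then show ?thesis by (simp add: bergman.emeasure_eq_measure zero_less_measure_iff)
qed

text \<open>The weight and the disk depend on the modulus alone, so rotation invariance of area
  carries over.\<close>

lemma nn_integral_bergman_rotate:
  assumes [measurable]: "k \<in> borel_measurable borel"
  shows "(\<integral>\<^sup>+z. k (cis \<theta> * z) \<partial>bergman_measure \<alpha>) = (\<integral>\<^sup>+z. k z \<partial>bergman_measure \<alpha>)"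
proof -
  have mr [measurable]: "(\<lambda>w. cis \<theta> * w) \<in> borel_measurable borel"
    by (intro borel_measurable_continuous_onI continuous_intros)
  let ?k = "\<lambda>z. ennreal (indicator disk z * bergman_weight \<alpha> z) * k z"
  have "(\<integral>\<^sup>+z. k (cis \<theta> * z) \<partial>bergman_measure \<alpha>) = (\<integral>\<^sup>+z. ?k (cis \<theta> * z) \<partial>lborel)"
    by (subst nn_integral_bergman[OF \<alpha>]) (auto intro!: nn_integral_cong simp: bergman_weight_def disk_def norm_mult indicator_def)
  also have "\<dots> = (\<integral>\<^sup>+z. ?k z \<partial>distr lborel borel (\<lambda>w. cis \<theta> * w))"
    by (subst nn_integral_distr) auto
  also have "\<dots> = (\<integral>\<^sup>+z. k z \<partial>bergman_measure \<alpha>)"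
    unfolding distr_lborel_rotation by (subst nn_integral_bergman[OF \<alpha>]) auto
  finally show ?thesis .
qed

text \<open>Averaging the rotation invariance over all angles and exchanging the integrals does the
  work of polar coordinates: estimates on circles become estimates for the area.\<close>

lemma bergman_integral_circle_means:
  assumes [measurable]: "k \<in> borel_measurable borel"
  shows "(\<integral>\<^sup>+z. k z \<partial>bergman_measure \<alpha>) = (\<integral>\<^sup>+z. (\<integral>\<^sup>+\<theta>. k (z * cis \<theta>) \<partial>circle_measure) \<partial>bergman_measure \<alpha>)"
proof -
  interpret circ: finite_measure circle_measure
    by (intro finite_measureI) (simp add: emeasure_circle_measure_space)
  interpret pair_sigma_finite circle_measure "bergman_measure \<alpha>" ..
  have "(\<lambda>x. snd x * cis (fst x)) \<in> borel_measurable (borel :: (real \<times> complex) measure)"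
    by (intro borel_measurable_continuous_onI continuous_intros)
  then have "(\<lambda>x. snd x * cis (fst x)) \<in> borel_measurable ((borel :: real measure) \<Otimes>\<^sub>M (borel :: complex measure))"
    by (simp add: borel_prod)
  then have [measurable]: "(\<lambda>x. snd x * cis (fst x)) \<in> borel_measurable (circle_measure \<Otimes>\<^sub>M bergman_measure \<alpha>)"
    by (subst measurable_cong_sets[OF sets_pair_measure_cong[OF sets_circle_measure sets_bergman_measure] refl])
  have m: "(\<lambda>(\<theta>, z). k (z * cis \<theta>)) \<in> borel_measurable (circle_measure \<Otimes>\<^sub>M bergman_measure \<alpha>)"
    unfolding case_prod_beta' by measurable
  have "(\<integral>\<^sup>+z. (\<integral>\<^sup>+\<theta>. k (z * cis \<theta>) \<partial>circle_measure) \<partial>bergman_measure \<alpha>)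
      = (\<integral>\<^sup>+\<theta>. (\<integral>\<^sup>+z. k (z * cis \<theta>) \<partial>bergman_measure \<alpha>) \<partial>circle_measure)"
    by (rule Fubini'[OF m])
  also have "\<dots> = (\<integral>\<^sup>+\<theta>. (\<integral>\<^sup>+z. k z \<partial>bergman_measure \<alpha>) \<partial>circle_measure)"
    using nn_integral_bergman_rotate[OF assms] by (simp add: mult.commute)
  also have "\<dots> = (\<integral>\<^sup>+z. k z \<partial>bergman_measure \<alpha>)"
    by (simp add: emeasure_circle_measure_space)
  finally show ?thesis by simp
qed

context
  fixes p :: real
  assumes p: "p > 1"
begin

lemma Bergman_space_iff:
  "f \<in> Bergman_space p \<alpha> \<longleftrightarrow> f holomorphic_on disk \<and> extensional_disk f \<and>
     integrable (bergman_measure \<alpha>) (\<lambda>z. cmod (f z) powr p)"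
proof -
  have "(\<lambda>z. cmod (f z) powr p) \<in> borel_measurable borel" if "f holomorphic_on disk" "extensional_disk f"
    using holomorphic_extensional_measurable[OF that] by measurable
  then show ?thesis unfolding Bergman_space_def using integrable_bergman_iff by auto
qed

lemma Bergman_space_measurable: "f \<in> Bergman_space p \<alpha> \<Longrightarrow> f \<in> borel_measurable borel"
  using holomorphic_extensional_measurable by (simp add: Bergman_space_iff)

lemma Bergman_norm_eq:
  assumes [measurable]: "f \<in> borel_measurable borel"
  shows "Bergman_norm p \<alpha> f = (\<integral>z. cmod (f z) powr p \<partial>bergman_measure \<alpha>) powr (1/p)"
  unfolding Bergman_norm_def by (subst integral_bergman) auto

text \<open>Every circle through the annulus U surrounds z at distance at least (1 - r)/2, so its
  integral mean controls \<open>f z\<close>. Integrating this over U, which has positive measure,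
  brings in the Bergman norm.\<close>

lemma Bergman_eval:
  assumes f: "f \<in> Bergman_space p \<alpha>" and r: "r < 1" and z: "cmod z \<le> r"
  defines "U \<equiv> {\<zeta> \<in> disk. (1 + r) / 2 < cmod \<zeta>}"
  shows "cmod (f z) \<le> 2 / ((1 - r) * measure (bergman_measure \<alpha>) U powr (1/p)) * Bergman_norm p \<alpha> f"
proof -
  have p0: "p > 0" using p by simp
  have r0: "0 \<le> r" using z norm_ge_zero[of z] by linarith
  have fh: "f holomorphic_on disk" using f by (simp add: Bergman_space_iff)
  have [measurable]: "f \<in> borel_measurable borel" by (rule Bergman_space_measurable[OF f])
  have int: "integrable (bergman_measure \<alpha>) (\<lambda>z. cmod (f z) powr p)" using f by (simp add: Bergman_space_iff)
  have "U = disk \<inter> (cmod -` {(1 + r) / 2<..})" by (auto simp: U_def)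
  then have "open U" using open_disk by (auto intro!: open_Int open_vimage continuous_intros)
  then have [measurable]: "U \<in> sets borel" by simp
  \<comment> \<open>The midpoint of the radii (1 + r)/2 and 1, showing that U is nonempty.\<close>
  have "complex_of_real ((3 + r) / 4) \<in> U" using r r0 by (auto simp: U_def disk_def simp del: of_real_divide of_real_add)
  then have m: "measure (bergman_measure \<alpha>) U > 0" using \<open>open U\<close> by (intro bergman_open_pos) (auto simp: U_def)
  define c where "c = ((1 - r) / 2 * cmod (f z)) powr p"
  have circ: "ennreal (c * indicator U \<zeta>) \<le> (\<integral>\<^sup>+\<theta>. ennreal (cmod (f (\<zeta> * cis \<theta>)) powr p) \<partial>circle_measure)" for \<zeta>
  proof (cases "\<zeta> \<in> U")
    case True
    let ?R = "cmod \<zeta>"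
    have R: "(1 + r) / 2 < ?R" "?R < 1" using True by (auto simp: U_def disk_def)
    have "cmod (f z) \<le> ?R / (?R - cmod z) * hp_mean p f ?R"
      using R z r0 by (intro eval_le_hp_mean p fh) auto
    \<comment> \<open>The radius is below 1 in the numerator, and the denominator is at least (1 +
      r)/2 - r.\<close>
    also have "\<dots> \<le> 1 / ((1 - r) / 2) * hp_mean p f ?R"
      using R z r by (intro mult_right_mono hp_mean_nonneg frac_le) (auto simp: field_simps)
    finally have "(1 - r) / 2 * cmod (f z) \<le> hp_mean p f ?R" using r by (simp add: field_simps)
    then have "c \<le> hp_mean p f ?R powr p" unfolding c_def using p r by (intro powr_mono2) auto
    also have "\<dots> = (\<integral>\<theta>. cmod (f (\<zeta> * cis \<theta>)) powr p \<partial>circle_measure)"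
      unfolding hp_mean_rotate[OF fh R(2) p0, symmetric] powr_powr using p by simp
    finally have "ennreal c \<le> ennreal (\<integral>\<theta>. cmod (f (\<zeta> * cis \<theta>)) powr p \<partial>circle_measure)" by (rule ennreal_leI)
    also have "\<dots> = (\<integral>\<^sup>+\<theta>. ennreal (cmod (f (\<zeta> * cis \<theta>)) powr p) \<partial>circle_measure)"
      using p by (intro nn_integral_eq_integral[symmetric] integrable_circle_powr fh R) auto
    finally show ?thesis using True by simp
  qed simp
  have "ennreal (c * measure (bergman_measure \<alpha>) U) = (\<integral>\<^sup>+\<zeta>. ennreal (c * indicator U \<zeta>) \<partial>bergman_measure \<alpha>)"
  proof -
    have "(\<integral>\<^sup>+\<zeta>. ennreal (c * indicator U \<zeta>) \<partial>bergman_measure \<alpha>) = (\<integral>\<^sup>+\<zeta>. ennreal c * indicator U \<zeta> \<partial>bergman_measure \<alpha>)"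
      by (intro nn_integral_cong) (auto simp: indicator_def)
    also have "\<dots> = ennreal c * emeasure (bergman_measure \<alpha>) U" by (rule nn_integral_cmult_indicator) simp
    finally show ?thesis by (simp add: bergman.emeasure_eq_measure ennreal_mult' c_def)
  qed
  also have "\<dots> \<le> (\<integral>\<^sup>+\<zeta>. (\<integral>\<^sup>+\<theta>. ennreal (cmod (f (\<zeta> * cis \<theta>)) powr p) \<partial>circle_measure) \<partial>bergman_measure \<alpha>)"
    by (intro nn_integral_mono circ)
  also have "\<dots> = (\<integral>\<^sup>+\<zeta>. ennreal (cmod (f \<zeta>) powr p) \<partial>bergman_measure \<alpha>)"
    by (rule bergman_integral_circle_means[symmetric]) measurable
  also have "\<dots> = ennreal (\<integral>\<zeta>. cmod (f \<zeta>) powr p \<partial>bergman_measure \<alpha>)"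
    by (intro nn_integral_eq_integral int) auto
  finally have "c * measure (bergman_measure \<alpha>) U \<le> (\<integral>\<zeta>. cmod (f \<zeta>) powr p \<partial>bergman_measure \<alpha>)"
    by (subst (asm) ennreal_le_iff) (auto intro!: integral_nonneg_AE)
  then have "(c * measure (bergman_measure \<alpha>) U) powr (1/p) \<le> Bergman_norm p \<alpha> f"
    using p by (simp add: Bergman_norm_eq powr_mono2 c_def)
  then have "(1 - r) / 2 * cmod (f z) * measure (bergman_measure \<alpha>) U powr (1/p) \<le> Bergman_norm p \<alpha> f"
    using p r by (simp add: c_def powr_mult powr_powr)
  then show ?thesis using m r by (simp add: field_simps)
qed

lemma Bergman_disk_function_space: "disk_function_space (Bergman_space p \<alpha>) (Bergman_norm p \<alpha>)"
proof
  show "f holomorphic_on disk" "extensional_disk f" if "f \<in> Bergman_space p \<alpha>" for f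
    using that by (auto simp: Bergman_space_def)
next
  fix f h a b assume f: "f \<in> Bergman_space p \<alpha>" and h: "h \<in> Bergman_space p \<alpha>"
  have [measurable]: "f \<in> borel_measurable borel" "h \<in> borel_measurable borel"
    using f h Bergman_space_measurable by auto
  have sc: "integrable (bergman_measure \<alpha>) (\<lambda>z. cmod (c * k z) powr p)" if "k \<in> Bergman_space p \<alpha>" for c k
    using that by (simp add: Bergman_space_iff norm_mult powr_mult)
  have "integrable (bergman_measure \<alpha>) (\<lambda>z. cmod (a * f z + b * h z) powr p)"
    using p f h by (intro Lp_add_integrable sc) auto
  then show "(\<lambda>z. a * f z + b * h z) \<in> Bergman_space p \<alpha>"
    using f h unfolding Bergman_space_iff
    by (auto simp: extensional_disk_def intro!: holomorphic_intros)
next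
  fix f h assume f: "f \<in> Bergman_space p \<alpha>" and h: "h \<in> Bergman_space p \<alpha>"
  have [measurable]: "f \<in> borel_measurable borel" "h \<in> borel_measurable borel"
    using f h Bergman_space_measurable by auto
  show "Bergman_norm p \<alpha> (\<lambda>z. f z + h z) \<le> Bergman_norm p \<alpha> f + Bergman_norm p \<alpha> h"
    using p f h Minkowski_inequality[of p f "bergman_measure \<alpha>" h]
    by (simp add: Bergman_norm_eq Bergman_space_iff)
next
  have [measurable]: "(\<lambda>z. if z \<in> disk then 1 else 0 :: complex) \<in> borel_measurable borel" by measurable
  have "integrable (bergman_measure \<alpha>) (\<lambda>z. cmod (if z \<in> disk then 1 else 0 :: complex) powr p)"
    by (rule bergman.integrable_const_bound[of _ 1]) (auto intro!: AE_I2)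
  moreover have "(\<lambda>z. if z \<in> disk then 1 else 0 :: complex) holomorphic_on disk"
    by (rule holomorphic_transform[of "\<lambda>_. 1"]) auto
  ultimately show "(\<lambda>z. if z \<in> disk then 1 else 0) \<in> Bergman_space p \<alpha>"
    unfolding Bergman_space_iff by (simp add: extensional_disk_def)
next
  show "0 \<le> Bergman_norm p \<alpha> f" for f by (simp add: Bergman_norm_def)
next
  fix f a assume "f \<in> Bergman_space p \<alpha>"
  then have [measurable]: "f \<in> borel_measurable borel" by (rule Bergman_space_measurable)
  show "Bergman_norm p \<alpha> (\<lambda>z. a * f z) = cmod a * Bergman_norm p \<alpha> f"
    using p by (simp add: Bergman_norm_eq norm_mult powr_mult powr_powr)
next
  fix r :: real assume "0 \<le> r" "r < 1"
  then show "\<exists>C. \<forall>f\<in>Bergman_space p \<alpha>. \<forall>z. cmod z \<le> r \<longrightarrow> cmod (f z) \<le> C * Bergman_norm p \<alpha> f"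
    using Bergman_eval by blast
next
  fix F c C h
  assume F: "\<And>n. F n \<in> Bergman_space p \<alpha>" "\<And>n. Bergman_norm p \<alpha> (F n) \<le> c n" and c: "c \<longlonglongrightarrow> C"
    and lim: "\<And>z. z \<in> disk \<Longrightarrow> (\<lambda>n. F n z) \<longlonglongrightarrow> h z" and h: "h holomorphic_on disk" "extensional_disk h"
  have [measurable]: "h \<in> borel_measurable borel" "F n \<in> borel_measurable borel" for n
    using holomorphic_extensional_measurable[OF h] Bergman_space_measurable[OF F(1)] by auto
  have p0: "p > 0" using p by simp
  have 1: "integrable (bergman_measure \<alpha>) (\<lambda>z. cmod (F n z) powr p)" for n
    using F(1)[of n] by (simp add: Bergman_space_iff)
  have 2: "(\<integral>z. cmod (F n z) powr p \<partial>bergman_measure \<alpha>) powr (1/p) \<le> c n" for n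
    using F(2)[of n] by (simp add: Bergman_norm_eq)
  \<comment> \<open>Convergence is given on the disk, which carries the whole measure.\<close>
  have 3: "AE z in bergman_measure \<alpha>. (\<lambda>n. F n z) \<longlonglongrightarrow> h z"
    using AE_bergman by eventually_elim (rule lim)
  have "integrable (bergman_measure \<alpha>) (\<lambda>z. cmod (h z) powr p)"
    "(\<integral>z. cmod (h z) powr p \<partial>bergman_measure \<alpha>) powr (1/p) \<le> C"
    using Fatou_Lp[OF p0 _ _ 1 2 c 3] by simp_all
  then show "h \<in> Bergman_space p \<alpha> \<and> Bergman_norm p \<alpha> h \<le> C"
    using h by (simp add: Bergman_space_iff Bergman_norm_eq)
next
  fix g B f assume g: "g holomorphic_on disk" "\<And>z. z \<in> disk \<Longrightarrow> cmod (g z) \<le> B" and f: "f \<in> Bergman_space p \<alpha>"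
  have "B \<ge> 0" using order_trans[OF norm_ge_zero g(2)[of 0]] by (simp add: disk_def)
  have hol: "mult_op g f holomorphic_on disk"
    using holomorphic_on_mult[OF g(1), of f] f unfolding Bergman_space_iff
    by (intro holomorphic_transform[of "\<lambda>z. g z * f z" disk "mult_op g f"]) (auto simp: mult_op_def)
  have ext: "extensional_disk (mult_op g f)" by (simp add: extensional_disk_def mult_op_def)
  have [measurable]: "mult_op g f \<in> borel_measurable borel" "f \<in> borel_measurable borel"
    using holomorphic_extensional_measurable[OF hol ext] Bergman_space_measurable[OF f] by auto
  have le: "cmod (mult_op g f z) powr p \<le> B powr p * cmod (f z) powr p" for z
  proof -
    have "cmod (mult_op g f z) \<le> B * cmod (f z)"
      using g(2)[of z] \<open>B \<ge> 0\<close> by (auto simp: mult_op_def norm_mult mult_right_mono)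
    then have "cmod (mult_op g f z) powr p \<le> (B * cmod (f z)) powr p" using p by (intro powr_mono2) auto
    then show ?thesis by (simp add: powr_mult)
  qed
  have int: "integrable (bergman_measure \<alpha>) (\<lambda>z. B powr p * cmod (f z) powr p)"
    using f by (simp add: Bergman_space_iff)
  then have int': "integrable (bergman_measure \<alpha>) (\<lambda>z. cmod (mult_op g f z) powr p)"
    by (rule Bochner_Integration.integrable_bound) (use le in \<open>auto intro!: AE_I2\<close>)
  have "(\<integral>z. cmod (mult_op g f z) powr p \<partial>bergman_measure \<alpha>) \<le> (\<integral>z. B powr p * cmod (f z) powr p \<partial>bergman_measure \<alpha>)"
    by (rule integral_mono[OF int' int le])
  also have "\<dots> = B powr p * (\<integral>z. cmod (f z) powr p \<partial>bergman_measure \<alpha>)" by simp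
  finally have "Bergman_norm p \<alpha> (mult_op g f) \<le> (B powr p * (\<integral>z. cmod (f z) powr p \<partial>bergman_measure \<alpha>)) powr (1/p)"
    using p by (simp add: Bergman_norm_eq powr_mono2)
  also have "\<dots> = B * Bergman_norm p \<alpha> f"
    using p \<open>B \<ge> 0\<close> by (simp add: Bergman_norm_eq powr_mult powr_powr)
  finally show "mult_op g f \<in> Bergman_space p \<alpha> \<and> Bergman_norm p \<alpha> (mult_op g f) \<le> B * Bergman_norm p \<alpha> f"
    using hol ext int' by (simp add: Bergman_space_iff)
qed

lemma Bergman_peaking_disk_space:
  "peaking_disk_space (Bergman_space p \<alpha>) (Bergman_norm p \<alpha>) p (bergman_measure \<alpha>)"
proof (rule peaking_disk_space.intro[OF Bergman_disk_function_space peaking_disk_space_axioms.intro])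
  show "p > 1" by (rule p)
  show "finite_measure (bergman_measure \<alpha>)" by (rule bergman.finite_measure_axioms)
  show "sets (bergman_measure \<alpha>) = sets borel" by simp
next
  fix \<xi> :: complex assume "cmod \<xi> = 1"
  have "AE z in bergman_measure \<alpha>. z \<notin> {\<xi>}"
    using AE_bergman by eventually_elim (use \<open>cmod \<xi> = 1\<close> in \<open>auto simp: disk_def\<close>)
  then have "emeasure (bergman_measure \<alpha>) {\<xi>} = 0"
    by (subst (asm) AE_iff_measurable[of "{\<xi>}"]) auto
  then show "measure (bergman_measure \<alpha>) {\<xi>} = 0" by (simp add: measure_def)
next
  fix \<xi> :: complex and \<delta> :: real assume \<xi>: "cmod \<xi> = 1" and "\<delta> > 0"
  \<comment> \<open>The center \<xi> lies outside the open disk; a nearby point of the disk shows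
    that the ball meets it in a nonempty open set.\<close>
  have "\<xi> \<in> closure disk" using \<xi> by (simp add: disk_def)
  then obtain y where "y \<in> disk" "dist y \<xi> < \<delta>"
    using \<open>\<delta> > 0\<close> unfolding closure_approachable by blast
  then have "y \<in> disk \<inter> ball \<xi> \<delta>" by (simp add: dist_commute)
  then have "disk \<inter> ball \<xi> \<delta> \<noteq> {}" by blast
  then have "0 < measure (bergman_measure \<alpha>) (disk \<inter> ball \<xi> \<delta>)"
    using open_disk by (intro bergman_open_pos) auto
  also have "\<dots> \<le> measure (bergman_measure \<alpha>) (cball 0 1 \<inter> ball \<xi> \<delta>)"
    by (intro bergman.finite_measure_mono) (auto simp: disk_def)
  finally show "0 < measure (bergman_measure \<alpha>) (cball 0 1 \<inter> ball \<xi> \<delta>)" .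
next
  fix F assume F: "disk_algebra F"
  have hol: "restrict_disk F holomorphic_on disk"
    using F by (intro holomorphic_transform[of F disk "restrict_disk F"]) (auto simp: disk_algebra_def restrict_disk_def)
  have ext: "extensional_disk (restrict_disk F)" by (simp add: extensional_disk_def restrict_disk_def)
  have [measurable]: "restrict_disk F \<in> borel_measurable borel"
    by (rule holomorphic_extensional_measurable[OF hol ext])
  have "(\<lambda>z. indicator (cball 0 1) z *\<^sub>R (cmod (F z) powr p)) \<in> borel_measurable borel"
    using p F by (intro borel_measurable_continuous_on_indicator continuous_on_norm_powr) (auto simp: disk_algebra_def)
  \<comment> \<open>The circle is a null set for the weighted area, so truncating F to the open disk
    does not change the integral.\<close>
  then have "(\<integral>z. cmod (restrict_disk F z) powr p \<partial>bergman_measure \<alpha>) = (LINT z:cball 0 1|bergman_measure \<alpha>. cmod (F z) powr p)"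
    unfolding set_lebesgue_integral_def
  proof (intro integral_cong_AE)
    show "AE z in bergman_measure \<alpha>. cmod (restrict_disk F z) powr p = indicator (cball 0 1) z *\<^sub>R (cmod (F z) powr p)"
      using AE_bergman by eventually_elim (auto simp: restrict_disk_def disk_def)
  qed auto
  moreover have "Bergman_norm p \<alpha> (restrict_disk F) powr p = (\<integral>z. cmod (restrict_disk F z) powr p \<partial>bergman_measure \<alpha>)"
    using p by (simp add: Bergman_norm_eq powr_powr)
  ultimately show "Bergman_norm p \<alpha> (restrict_disk F) powr p = (LINT z:cball 0 1|bergman_measure \<alpha>. cmod (F z) powr p)"
    by simp
qed

end

end

theorem theorem4p2:
  fixes p \<alpha> :: real
    and X :: "(complex \<Rightarrow> complex) set" and N :: "(complex \<Rightarrow> complex) \<Rightarrow> real"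
    and g :: "real \<Rightarrow> complex \<Rightarrow> complex"
  assumes "p > 1" and "\<alpha> > -1"
    and "(X, N) = (Hardy_space p, Hardy_norm p) \<or> (X, N) = (Bergman_space p \<alpha>, Bergman_norm p \<alpha>)"
    and "\<forall>t\<in>{0<..<1}. disk_algebra (g t)"
    and "cond_W X N (\<lambda>t. mult_op (g t))"
  shows "EN X N (integral_op X N (\<lambda>t. mult_op (g t)))
           = (\<integral>\<^sup>+ t\<in>{0<..<1}. EN X N (mult_op (g t)) \<partial>lborel)
         \<longleftrightarrow> (\<exists>\<xi> \<theta>. cmod \<xi> = 1 \<and> cmod \<theta> = 1 \<and>
               (AE t in lborel. t \<in> {0<..<1} \<longrightarrow> \<theta> * g t \<xi> = complex_of_real (sup_norm (g t))))"
proof -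
  \<comment> \<open>The measure is the image of \<open>circle_measure\<close> under
    \<open>cis\<close> in the Hardy case and \<open>bergman_measure \<alpha>\<close> in the Bergman
    case.\<close>
  have "\<exists>\<mu>. peaking_disk_space X N p \<mu>"
    using assms(3) Hardy_peaking_disk_space[OF assms(1)] Bergman_peaking_disk_space[OF assms(2,1)] by auto
  then obtain \<mu> where "peaking_disk_space X N p \<mu>" by blast
  then show ?thesis
    using assms(4,5) by (intro peaking_disk_space.equality_iff) auto
qed

end
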